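(* Let $n \geq 2$. The restriction map $$r : \mathrm{EndAut}(\mathcal{O}_n,\mathcal{D}_n) \to \mathrm{Aut}(\mathcal{D}_n), \qquad r(\lambda) = \lambda|_{\mathcal{D}_n},$$ is not surjective. Furthermore, $r(\mathrm{EndAut}(\mathcal{O}_n,\mathcal{D}_n))$ is not a subgroup of $\mathrm{Aut}(\mathcal{D}_n)$, and it is the disjoint union of the subgroup of those automorphisms of $\mathcal{D}_n$ that are extensible to automorphisms of $\mathcal{O}_n$ and the subsemigroup of those automorphisms of $\mathcal{D}_n$ that are extensible to proper endomorphisms of $\mathcal{O}_n$.
   Context: For an integer $n \geq 2$, the Cuntz algebra $\mathcal{O}_n$ is the universal unital $C^*$-algebra generated by isometries $S_1,\ldots,S_n$ with $\sum_{i=1}^n S_iS_i^*=1$. Endomorphisms of $\mathcal{O}_n$ are unital $*$-endomorphisms, and $\mathrm{End}(\mathcal{O}_n)$ is the semigroup of all of them under composition. An endomorphism is proper if it is not an automorphism. The diagonal $\mathcal{D}_n$ is the commutative $C^*$-subalgebra of $\mathcal{O}_n$ that is the norm closure of $\bigcup_{k \geq 1}\mathcal{D}_n^k$, where $\mathcal{D}_n^k = \mathrm{span}\{S_{\alpha_1}\cdots S_{\alpha_k}S_{\alpha_k}^*\cdots S_{\alpha_1}^* : 1 \leq \alpha_j \leq n\} \simeq \mathbb{C}^{n^k}$. $\mathrm{Aut}(\mathcal{D}_n)$ is the group of $*$-automorphisms of $\mathcal{D}_n$. $\mathrm{EndAut}(\mathcal{O}_n,\mathcal{D}_n)$ is the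 subsemigroup of $\mathrm{End}(\mathcal{O}_n)$ of those endomorphisms that restrict to automorphisms of $\mathcal{D}_n$. *)

theory Defs
  imports
    "HOL-Analysis.Analysis"
    "HOL-Library.Poly_Mapping"
    "HOL-Algebra.Group"
begin

section \<open>Unital C*-algebras\<close>

text \<open>\<^class>\<open>monoid_mult\<close> rather than \<^class>\<open>ring_1\<close>, so that the zero algebra is not excluded.\<close>

class unital_cstar_algebra = real_normed_algebra + complete_space + monoid_mult +
  fixes scaleC :: "complex \<Rightarrow> 'a \<Rightarrow> 'a" (infixr "*\<^sub>C" 75)
    and adj :: "'a \<Rightarrow> 'a"
  assumes scaleC_add_right: "c *\<^sub>C (x + y) = c *\<^sub>C x + c *\<^sub>C y"
    and scaleC_add_left: "(c + d) *\<^sub>C x = c *\<^sub>C x + d *\<^sub>C x"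
    and scaleC_scaleC: "c *\<^sub>C d *\<^sub>C x = (c * d) *\<^sub>C x"
    and scaleC_of_real: "complex_of_real r *\<^sub>C x = r *\<^sub>R x"
    and mult_scaleC_left: "(c *\<^sub>C x) * y = c *\<^sub>C (x * y)"
    and mult_scaleC_right: "x * (c *\<^sub>C y) = c *\<^sub>C (x * y)"
    and norm_scaleC: "norm (c *\<^sub>C x) = cmod c * norm x"
    and adj_add: "adj (x + y) = adj x + adj y"
    and adj_scaleC: "adj (c *\<^sub>C x) = cnj c *\<^sub>C adj x"
    and adj_mult: "adj (x * y) = adj y * adj x"
    and adj_adj: "adj (adj x) = x"
    and norm_adj_mult_self: "norm (adj x * x) = (norm x)\<^sup>2"

lemma scaleC_one: "1 *\<^sub>C x = (x :: 'a::unital_cstar_algebra)"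
  using scaleC_of_real[of 1 x] by simp

global_interpretation cvec: vector_space "scaleC :: complex \<Rightarrow> 'a::unital_cstar_algebra \<Rightarrow> 'a"
  by unfold_locales (simp_all add: scaleC_add_right scaleC_add_left scaleC_scaleC scaleC_one)

definition unital_star_hom ::
    "('a::unital_cstar_algebra \<Rightarrow> 'b::unital_cstar_algebra) \<Rightarrow> bool"
  where "unital_star_hom f \<longleftrightarrow>
    (\<forall>x y. f (x + y) = f x + f y) \<and>
    (\<forall>c x. f (c *\<^sub>C x) = c *\<^sub>C f x) \<and>
    (\<forall>x y. f (x * y) = f x * f y) \<and>
    (\<forall>x. f (adj x) = adj (f x)) \<and>
    f 1 = 1"

section \<open>The free unital *-algebra on a set of generators\<close>

text \<open>Letters are generators (tag \<^term>\<open>False\<close>) and their formal adjoints (tag \<^term>\<open>True\<close>).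
  The additive monoid structure on words is concatenation, which turns finitely supported
  functions into a convolution algebra.\<close>

datatype 'n star_word = Word (letters: "('n \<times> bool) list")

instantiation star_word :: (type) monoid_add
begin

definition "0 = Word []"
definition "v + w = Word (letters v @ letters w)"

instance
  by standard (auto simp: zero_star_word_def plus_star_word_def)

end

type_synonym 'n free_star = "'n star_word \<Rightarrow>\<^sub>0 complex"

definition word_adj :: "'n star_word \<Rightarrow> 'n star_word"
  where "word_adj w = Word (rev (map (\<lambda>(i, b). (i, \<not> b)) (letters w)))"

lemma word_adj_plus: "word_adj (v + w) = word_adj w + word_adj v"
  by (simp add: word_adj_def plus_star_word_def)

lemma word_adj_word_adj [simp]: "word_adj (word_adj w) = w"
  by (cases w) (simp add: word_adj_def rev_map comp_def case_prod_beta)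

lemma word_adj_0 [simp]: "word_adj 0 = 0"
  by (simp add: word_adj_def zero_star_word_def)

definition extend_linear ::
    "('k \<Rightarrow> 'c::comm_monoid_add \<Rightarrow> 'b::comm_monoid_add) \<Rightarrow> ('k \<Rightarrow>\<^sub>0 'c) \<Rightarrow> 'b"
  where "extend_linear h x = (\<Sum>w\<in>Poly_Mapping.keys x. h w (Poly_Mapping.lookup x w))"

lemma extend_linear_superset:
  assumes "\<And>w. h w 0 = 0" "finite A" "Poly_Mapping.keys x \<subseteq> A"
  shows "extend_linear h x = (\<Sum>w\<in>A. h w (Poly_Mapping.lookup x w))"
  unfolding extend_linear_def
  by (rule sum.mono_neutral_left) (use assms in \<open>auto simp: in_keys_iff\<close>)

lemma extend_linear_add:
  assumes "\<And>w. h w 0 = 0" "\<And>w a b. h w (a + b) = h w a + h w b"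
  shows "extend_linear h (x + y) = extend_linear h x + extend_linear h y"
proof -
  let ?A = "Poly_Mapping.keys x \<union> Poly_Mapping.keys y"
  have "Poly_Mapping.keys (x + y) \<subseteq> ?A" by (rule Poly_Mapping.keys_add)
  then show ?thesis
    using assms by (simp add: extend_linear_superset[of h ?A] lookup_add sum.distrib)
qed

lemma extend_linear_single:
  assumes "\<And>w. h w 0 = 0"
  shows "extend_linear h (Poly_Mapping.single w c) = h w c"
  using extend_linear_superset[of h "{w}" "Poly_Mapping.single w c"] assms by simp

lemma extend_linear_0 [simp]: "extend_linear h 0 = 0"
  by (simp add: extend_linear_def)

lemma free_star_expand:
  "x = (\<Sum>w\<in>Poly_Mapping.keys x. Poly_Mapping.single w (Poly_Mapping.lookup x w))"
proof (rule poly_mapping_eqI)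
  fix k
  show "Poly_Mapping.lookup x k = Poly_Mapping.lookup
    (\<Sum>w\<in>Poly_Mapping.keys x. Poly_Mapping.single w (Poly_Mapping.lookup x w)) k"
    by (simp add: Poly_Mapping.lookup_sum lookup_single when_def in_keys_iff sum.delta)
qed

lemma free_star_induct [case_names single add]:
  fixes x :: "'n free_star"
  assumes s: "\<And>w c. P (Poly_Mapping.single w c)"
    and a: "\<And>x y. P x \<Longrightarrow> P y \<Longrightarrow> P (x + y)"
  shows "P x"
proof -
  have z: "P 0" using s[of 0 0] by simp
  have "P (\<Sum>w\<in>A. Poly_Mapping.single w (f w))" if "finite A" for A and f :: "'n star_word \<Rightarrow> complex"
    using that by (induction A) (auto simp: z s a)
  then show ?thesis by (subst free_star_expand) simp
qed

definition free_scale :: "complex \<Rightarrow> 'n free_star \<Rightarrow> 'n free_star"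
  where "free_scale c x = Poly_Mapping.single 0 c * x"

definition free_adj :: "'n free_star \<Rightarrow> 'n free_star"
  where "free_adj = extend_linear (\<lambda>w c. Poly_Mapping.single (word_adj w) (cnj c))"

definition free_gen :: "'n \<Rightarrow> 'n free_star"
  where "free_gen i = Poly_Mapping.single (Word [(i, False)]) 1"

lemma free_adj_single [simp]:
  "free_adj (Poly_Mapping.single w c) = Poly_Mapping.single (word_adj w) (cnj c)"
  by (simp add: free_adj_def extend_linear_single)

lemma free_adj_add: "free_adj (x + y) = free_adj x + free_adj y"
  unfolding free_adj_def by (rule extend_linear_add) (auto simp: single_add)

lemma free_adj_mult: "free_adj (x * y) = free_adj y * free_adj x"
proof (induction x rule: free_star_induct)
  case (single w c)
  show ?case
    by (induction y rule: free_star_induct)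
       (simp_all add: mult_single word_adj_plus mult.commute free_adj_add algebra_simps)
qed (simp add: free_adj_add algebra_simps)

lemma free_adj_free_adj [simp]: "free_adj (free_adj x) = x"
  by (induction x rule: free_star_induct) (simp_all add: free_adj_add)

lemma free_adj_one [simp]: "free_adj 1 = 1"
  using free_adj_single[of 0 1] by simp

lemma free_scale_add_right: "free_scale c (x + y) = free_scale c x + free_scale c y"
  by (simp add: free_scale_def algebra_simps)

lemma free_scale_add_left: "free_scale (c + d) x = free_scale c x + free_scale d x"
  by (simp add: free_scale_def single_add algebra_simps)

lemma free_scale_free_scale: "free_scale c (free_scale d x) = free_scale (c * d) x"
  by (simp add: free_scale_def mult_single mult.assoc[symmetric])

lemma free_scale_one [simp]: "free_scale 1 x = x"
  by (simp add: free_scale_def)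

lemma free_scale_mult_left: "free_scale c x * y = free_scale c (x * y)"
  by (simp add: free_scale_def mult.assoc)

lemma free_const_commute: "x * Poly_Mapping.single 0 c = Poly_Mapping.single 0 c * (x :: 'n free_star)"
  by (induction x rule: free_star_induct) (simp_all add: mult_single mult.commute algebra_simps)

lemma free_scale_mult_right: "x * free_scale c y = free_scale c (x * y)"
  by (metis free_const_commute free_scale_def mult.assoc)

lemma free_adj_scale: "free_adj (free_scale c x) = free_scale (cnj c) (free_adj x)"
  by (simp add: free_scale_def free_adj_mult free_const_commute)

lemma free_scale_minus_one: "free_scale (- 1) x = - x"
  by (simp add: free_scale_def single_uminus)

lemma free_scale_single: "free_scale c (Poly_Mapping.single w d) = Poly_Mapping.single w (c * d)"
  by (simp add: free_scale_def mult_single)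

lemma free_adj_diff: "free_adj (x - y) = free_adj x - free_adj y"
  using free_adj_add[of "x - y" y] by (simp add: algebra_simps)

lemma free_scale_diff: "free_scale c (x - y) = free_scale c x - free_scale c y"
  by (simp add: free_scale_def algebra_simps)

section \<open>The universal C*-seminorm for the Cuntz relations\<close>

locale cstar_seminorm =
  fixes p :: "'n free_star \<Rightarrow> real"
  assumes add: "p (x + y) \<le> p x + p y"
    and scale: "p (free_scale c x) = cmod c * p x"
    and mult: "p (x * y) \<le> p x * p y"
    and adj_self: "p (free_adj x * x) = (p x)\<^sup>2"
begin

lemma zero [simp]: "p 0 = 0"
  using scale[of 0 0] by (simp add: free_scale_def)

lemma uminus: "p (- x) = p x"
  using scale[of "-1" x] by (simp add: free_scale_minus_one)

lemma nonneg [simp]: "0 \<le> p x"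
  using add[of x "- x"] by (simp add: uminus)

lemma minus_commute: "p (x - y) = p (y - x)"
  using uminus[of "x - y"] by simp

lemma diff_triangle: "p (x - z) \<le> p (x - y) + p (y - z)"
  using add[of "x - y" "y - z"] by simp

lemma abs_diff: "\<bar>p x - p y\<bar> \<le> p (x - y)"
  using add[of "x - y" y] add[of "y - x" x] minus_commute[of x y] by simp

lemma adj_le: "p x \<le> p (free_adj x)"
proof (cases "p x = 0")
  case False
  then have "0 < p x" using nonneg[of x] by linarith
  moreover have "p x * p x \<le> p (free_adj x) * p x"
    using mult[of "free_adj x" x] adj_self[of x] by (simp add: power2_eq_square)
  ultimately show ?thesis by simp
qed simp

lemma adj: "p (free_adj x) = p x"
  using adj_le[of x] adj_le[of "free_adj x"] by simp

lemma one_le: "p 1 \<le> 1"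
proof -
  have "p 1 = (p 1)\<^sup>2" using adj_self[of 1] by simp
  then have "p 1 = 0 \<or> p 1 = 1" by (simp add: power2_eq_square)
  then show ?thesis by auto
qed

end

definition cuntz_seminorm :: "('n::finite free_star \<Rightarrow> real) \<Rightarrow> bool"
  where "cuntz_seminorm p \<longleftrightarrow> cstar_seminorm p \<and>
    (\<forall>i. p (free_adj (free_gen i) * free_gen i - 1) = 0) \<and>
    p ((\<Sum>i\<in>UNIV. free_gen i * free_adj (free_gen i)) - 1) = 0"

definition cuntz_norm :: "'n::finite free_star \<Rightarrow> real"
  where "cuntz_norm x = (SUP p\<in>Collect cuntz_seminorm. p x)"

lemma cuntz_seminormD:
  assumes "cuntz_seminorm p"
  shows "cstar_seminorm p" "p (free_adj (free_gen i) * free_gen i - 1) = 0"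
    "p ((\<Sum>i\<in>UNIV. free_gen i * free_adj (free_gen i)) - 1) = 0"
  using assms by (auto simp: cuntz_seminorm_def)

lemma cuntz_seminorm_gen:
  assumes "cuntz_seminorm p"
  shows "p (free_gen i) \<le> 1"
proof -
  interpret cstar_seminorm p
    using assms by (simp add: cuntz_seminormD)
  have "(p (free_gen i))\<^sup>2 \<le> p (free_adj (free_gen i) * free_gen i - 1) + p 1"
    using add[of "free_adj (free_gen i) * free_gen i - 1" 1] by (simp add: adj_self)
  also have "\<dots> \<le> 1\<^sup>2" using one_le by (simp add: cuntz_seminormD[OF assms])
  finally show ?thesis by (rule power2_le_imp_le) simp
qed

lemma cuntz_seminorm_word:
  assumes "cuntz_seminorm p"
  shows "p (Poly_Mapping.single (Word l) 1) \<le> 1"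
proof -
  interpret cstar_seminorm p
    using assms by (simp add: cuntz_seminormD)
  have letter: "p (Poly_Mapping.single (Word [a]) 1) \<le> 1" for a
  proof (cases a)
    case (Pair i b)
    have "free_adj (free_gen i) = Poly_Mapping.single (Word [(i, True)]) 1"
      by (simp add: free_gen_def word_adj_def)
    then show ?thesis
      using cuntz_seminorm_gen[OF assms, of i] adj[of "free_gen i"] Pair
      by (cases b) (auto simp: free_gen_def)
  qed
  show ?thesis
  proof (induction l)
    case Nil
    then show ?case using one_le by (simp flip: zero_star_word_def)
  next
    case (Cons a l)
    have "Poly_Mapping.single (Word (a # l)) 1 =
        Poly_Mapping.single (Word [a]) 1 * (Poly_Mapping.single (Word l) 1 :: 'a free_star)"
      by (simp add: mult_single plus_star_word_def)
    then have "p (Poly_Mapping.single (Word (a # l)) 1) \<le>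
        p (Poly_Mapping.single (Word [a]) 1) * p (Poly_Mapping.single (Word l) 1)"
      using mult by metis
    also have "\<dots> \<le> 1" using letter Cons by (simp add: mult_le_one)
    finally show ?case .
  qed
qed

lemma cuntz_seminorm_bounded: "\<exists>B. \<forall>p. cuntz_seminorm p \<longrightarrow> p x \<le> B"
proof (induction x rule: free_star_induct)
  case (single w c)
  have "p (Poly_Mapping.single w c) \<le> cmod c" if p: "cuntz_seminorm p" for p
  proof -
    interpret cstar_seminorm p
      using p by (simp add: cuntz_seminormD)
    have "p (Poly_Mapping.single w c) = cmod c * p (Poly_Mapping.single w 1)"
      using scale[of c "Poly_Mapping.single w 1"] by (simp add: free_scale_single)
    also have "\<dots> \<le> cmod c"
      using cuntz_seminorm_word[OF p, of "letters w"] by (simp add: mult_left_le)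
    finally show ?thesis .
  qed
  then show ?case by blast
next
  case (add x y)
  then obtain B C where "\<forall>p. cuntz_seminorm p \<longrightarrow> p x \<le> B" "\<forall>p. cuntz_seminorm p \<longrightarrow> p y \<le> C"
    by blast
  then have "\<forall>p. cuntz_seminorm p \<longrightarrow> p (x + y) \<le> B + C"
    by (smt (verit) cuntz_seminormD(1) cstar_seminorm_def)
  then show ?case by blast
qed

lemma cuntz_seminorm_le: "cuntz_seminorm p \<Longrightarrow> p x \<le> cuntz_norm x"
proof -
  assume p: "cuntz_seminorm p"
  obtain B where "\<forall>p. cuntz_seminorm p \<longrightarrow> p x \<le> B"
    using cuntz_seminorm_bounded by blast
  then have "bdd_above ((\<lambda>p. p x) ` Collect cuntz_seminorm)"
    by (intro bdd_aboveI2) auto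
  then show ?thesis
    unfolding cuntz_norm_def using p by (intro cSUP_upper) auto
qed

lemma cuntz_seminorm_zero: "cuntz_seminorm (\<lambda>_. 0)"
  by (simp add: cuntz_seminorm_def cstar_seminorm_def)

lemma cuntz_norm_least: "(\<And>p. cuntz_seminorm p \<Longrightarrow> p x \<le> B) \<Longrightarrow> cuntz_norm x \<le> B"
  unfolding cuntz_norm_def using cuntz_seminorm_zero by (intro cSUP_least) auto

lemma cuntz_norm_nonneg: "0 \<le> cuntz_norm x"
  using cuntz_seminorm_le[OF cuntz_seminorm_zero] .

lemma cuntz_seminorm_cuntz_norm: "cuntz_seminorm cuntz_norm"
proof -
  note D = cuntz_seminormD(1)[unfolded cstar_seminorm_def]
  have nn: "0 \<le> p x" if "cuntz_seminorm p" for p :: "'a free_star \<Rightarrow> real" and x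
    using cstar_seminorm.nonneg[of p x] that by (simp add: cuntz_seminormD)
  have "cuntz_norm (x + y) \<le> cuntz_norm x + cuntz_norm y" for x y :: "'a free_star"
    by (rule cuntz_norm_least) (smt (verit) D cuntz_seminorm_le)
  moreover have sc: "cuntz_norm (free_scale c x) \<le> cmod c * cuntz_norm x" for c and x :: "'a free_star"
    by (rule cuntz_norm_least) (simp add: D cuntz_seminorm_le mult_left_mono)
  moreover have "cmod c * cuntz_norm x \<le> cuntz_norm (free_scale c x)" for c and x :: "'a free_star"
  proof (cases "c = 0")
    case False
    then have "x = free_scale (inverse c) (free_scale c x)"
      by (simp add: free_scale_free_scale)
    then have "cuntz_norm x \<le> cmod (inverse c) * cuntz_norm (free_scale c x)"
      using sc by metis
    then show ?thesis using False by (simp add: norm_inverse norm_divide field_simps)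
  qed (simp add: cuntz_norm_nonneg)
  moreover have "cuntz_norm (x * y) \<le> cuntz_norm x * cuntz_norm y" for x y :: "'a free_star"
  proof (rule cuntz_norm_least)
    fix p :: "'a free_star \<Rightarrow> real" assume p: "cuntz_seminorm p"
    then have "p (x * y) \<le> p x * p y" by (simp add: D)
    also have "\<dots> \<le> cuntz_norm x * cuntz_norm y"
      using p by (intro mult_mono) (auto simp: cuntz_seminorm_le cuntz_norm_nonneg nn)
    finally show "p (x * y) \<le> cuntz_norm x * cuntz_norm y" .
  qed
  moreover have "cuntz_norm (free_adj x * x) \<le> (cuntz_norm x)\<^sup>2" for x :: "'a free_star"
    by (rule cuntz_norm_least) (simp add: D nn cuntz_seminorm_le power_mono)
  moreover have "(cuntz_norm x)\<^sup>2 \<le> cuntz_norm (free_adj x * x)" for x :: "'a free_star"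
  proof -
    have "cuntz_norm x \<le> sqrt (cuntz_norm (free_adj x * x))"
    proof (rule cuntz_norm_least)
      fix p :: "'a free_star \<Rightarrow> real" assume p: "cuntz_seminorm p"
      have "(p x)\<^sup>2 \<le> cuntz_norm (free_adj x * x)"
        using cuntz_seminorm_le[OF p, of "free_adj x * x"] p by (simp add: D)
      then show "p x \<le> sqrt (cuntz_norm (free_adj x * x))" by (rule real_le_rsqrt)
    qed
    then show ?thesis by (metis cuntz_norm_nonneg power_mono real_sqrt_pow2)
  qed
  moreover have "cuntz_norm (free_adj (free_gen i) * free_gen i - 1) \<le> 0" for i :: 'a
    by (rule cuntz_norm_least) (simp add: cuntz_seminormD)
  moreover have "cuntz_norm ((\<Sum>i\<in>UNIV. free_gen i * free_adj (free_gen i)) - 1 :: 'a free_star) \<le> 0"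
    by (rule cuntz_norm_least) (simp add: cuntz_seminormD)
  ultimately show ?thesis
    unfolding cuntz_seminorm_def cstar_seminorm_def by (smt (verit) cuntz_norm_nonneg)
qed

interpretation cn: cstar_seminorm cuntz_norm
  by (rule cuntz_seminormD(1)[OF cuntz_seminorm_cuntz_norm])

section \<open>The Cuntz algebra\<close>

definition free_Cauchy :: "(nat \<Rightarrow> 'n::finite free_star) \<Rightarrow> bool"
  where "free_Cauchy X \<longleftrightarrow> (\<forall>e>0. \<exists>M. \<forall>j\<ge>M. \<forall>k\<ge>M. cuntz_norm (X j - X k) < e)"

definition cuntz_rel :: "(nat \<Rightarrow> 'n::finite free_star) \<Rightarrow> (nat \<Rightarrow> 'n free_star) \<Rightarrow> bool"
  where "cuntz_rel X Y \<longleftrightarrow>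
    free_Cauchy X \<and> free_Cauchy Y \<and> (\<lambda>k. cuntz_norm (X k - Y k)) \<longlonglongrightarrow> 0"

lemma tendsto_0_le:
  fixes f g :: "'a \<Rightarrow> real"
  assumes "(g \<longlongrightarrow> 0) F" "\<And>k. 0 \<le> f k" "\<And>k. f k \<le> g k"
  shows "(f \<longlongrightarrow> 0) F"
  by (rule tendsto_sandwich[of "\<lambda>_. 0" f F g]) (use assms in auto)

lemma free_Cauchy_iff_tendsto:
  "free_Cauchy X \<longleftrightarrow>
    ((\<lambda>(j, k). cuntz_norm (X j - X k)) \<longlongrightarrow> 0) (sequentially \<times>\<^sub>F sequentially)"
  unfolding free_Cauchy_def tendsto_iff eventually_prod_sequentially
  by (simp add: cn.minus_commute)

lemma free_Cauchy_comparison: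
  assumes "((\<lambda>(j, k). g j k) \<longlongrightarrow> (0::real)) (sequentially \<times>\<^sub>F sequentially)"
    and "\<And>j k. cuntz_norm (X j - X k) \<le> g j k"
  shows "free_Cauchy X"
  unfolding free_Cauchy_iff_tendsto
  by (rule tendsto_0_le[OF assms(1)]) (use assms(2) in auto)

lemma free_Cauchy_const [simp]: "free_Cauchy (\<lambda>_. x)"
  by (simp add: free_Cauchy_def)

lemma free_Cauchy_add:
  assumes "free_Cauchy X" "free_Cauchy Y"
  shows "free_Cauchy (\<lambda>k. X k + Y k)"
proof (rule free_Cauchy_comparison)
  show "((\<lambda>(j, k). cuntz_norm (X j - X k) + cuntz_norm (Y j - Y k)) \<longlongrightarrow> 0)
      (sequentially \<times>\<^sub>F sequentially)"
    using tendsto_add[OF assms[unfolded free_Cauchy_iff_tendsto]] by (simp add: case_prod_unfold)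
  show "cuntz_norm (X j + Y j - (X k + Y k)) \<le> cuntz_norm (X j - X k) + cuntz_norm (Y j - Y k)" for j k
    using cn.add[of "X j - X k" "Y j - Y k"] by (simp add: algebra_simps)
qed

lemma free_Cauchy_scale:
  assumes "free_Cauchy X"
  shows "free_Cauchy (\<lambda>k. free_scale c (X k))"
proof (rule free_Cauchy_comparison)
  show "((\<lambda>(j, k). cmod c * cuntz_norm (X j - X k)) \<longlongrightarrow> 0) (sequentially \<times>\<^sub>F sequentially)"
    using tendsto_mult_right_zero[OF assms[unfolded free_Cauchy_iff_tendsto], of "cmod c"]
    by (simp add: case_prod_unfold)
  show "cuntz_norm (free_scale c (X j) - free_scale c (X k)) \<le> cmod c * cuntz_norm (X j - X k)" for j k
    by (simp add: free_scale_diff[symmetric] cn.scale)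
qed

lemma free_Cauchy_uminus: "free_Cauchy X \<Longrightarrow> free_Cauchy (\<lambda>k. - X k)"
  using free_Cauchy_scale[of X "-1"] by (simp add: free_scale_minus_one)

lemma free_Cauchy_diff: "free_Cauchy X \<Longrightarrow> free_Cauchy Y \<Longrightarrow> free_Cauchy (\<lambda>k. X k - Y k)"
  using free_Cauchy_add[OF _ free_Cauchy_uminus, of X Y] by simp

lemma free_Cauchy_adj: "free_Cauchy X \<Longrightarrow> free_Cauchy (\<lambda>k. free_adj (X k))"
  by (simp add: free_Cauchy_def free_adj_diff[symmetric] cn.adj)

lemma free_Cauchy_norm_convergent:
  assumes "free_Cauchy X"
  shows "convergent (\<lambda>k. cuntz_norm (X k))"
proof -
  have "Cauchy (\<lambda>k. cuntz_norm (X k))"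
    unfolding Cauchy_def dist_real_def
    using assms cn.abs_diff unfolding free_Cauchy_def by (meson le_less_trans)
  then show ?thesis by (rule Cauchy_convergent)
qed

lemma free_Cauchy_norm_tendsto:
  "free_Cauchy X \<Longrightarrow> (\<lambda>k. cuntz_norm (X k)) \<longlonglongrightarrow> lim (\<lambda>k. cuntz_norm (X k))"
  using free_Cauchy_norm_convergent convergent_LIMSEQ_iff by blast

lemma free_Cauchy_bounded:
  assumes "free_Cauchy X"
  obtains B where "0 \<le> B" "\<And>k. cuntz_norm (X k) \<le> B"
proof -
  have "Bseq (\<lambda>k. cuntz_norm (X k))"
    using free_Cauchy_norm_convergent[OF assms] by (rule convergent_imp_Bseq)
  then obtain B where "B > 0" "\<And>k. norm (cuntz_norm (X k)) \<le> B"
    unfolding Bseq_def by blast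
  with that[of B] show ?thesis by (simp add: less_imp_le)
qed

lemma cuntz_norm_mult_diff:
  assumes "cuntz_norm x \<le> B" "cuntz_norm y' \<le> C"
  shows "cuntz_norm (x * y - x' * y') \<le> B * cuntz_norm (y - y') + C * cuntz_norm (x - x')"
proof -
  have "x * y - x' * y' = x * (y - y') + (x - x') * y'" by (simp add: algebra_simps)
  then have "cuntz_norm (x * y - x' * y') \<le>
      cuntz_norm x * cuntz_norm (y - y') + cuntz_norm (x - x') * cuntz_norm y'"
    using cn.add[of "x * (y - y')" "(x - x') * y'"] cn.mult[of x "y - y'"] cn.mult[of "x - x'" y']
    by simp
  also have "\<dots> \<le> B * cuntz_norm (y - y') + C * cuntz_norm (x - x')"
    using assms by (intro add_mono) (simp_all add: mult_right_mono mult.commute)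
  finally show ?thesis .
qed

lemma free_Cauchy_mult:
  assumes "free_Cauchy X" "free_Cauchy Y"
  shows "free_Cauchy (\<lambda>k. X k * Y k)"
proof -
  obtain B where B: "\<And>k. cuntz_norm (X k) \<le> B" using free_Cauchy_bounded[OF assms(1)] by blast
  obtain C where C: "\<And>k. cuntz_norm (Y k) \<le> C" using free_Cauchy_bounded[OF assms(2)] by blast
  show ?thesis
  proof (rule free_Cauchy_comparison)
    show "((\<lambda>(j, k). B * cuntz_norm (Y j - Y k) + C * cuntz_norm (X j - X k)) \<longlongrightarrow> 0)
        (sequentially \<times>\<^sub>F sequentially)"
      using tendsto_add[OF
          tendsto_mult_right_zero[OF assms(2)[unfolded free_Cauchy_iff_tendsto], of B]
          tendsto_mult_right_zero[OF assms(1)[unfolded free_Cauchy_iff_tendsto], of C]]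
      by (simp add: case_prod_unfold)
    show "cuntz_norm (X j * Y j - X k * Y k) \<le>
        B * cuntz_norm (Y j - Y k) + C * cuntz_norm (X j - X k)" for j k
      using B C by (rule cuntz_norm_mult_diff)
  qed
qed

lemmas free_Cauchy_intros = free_Cauchy_const free_Cauchy_add free_Cauchy_diff
  free_Cauchy_uminus free_Cauchy_scale free_Cauchy_adj free_Cauchy_mult

lemma cuntz_rel_refl_iff [simp]: "cuntz_rel X X \<longleftrightarrow> free_Cauchy X"
  by (simp add: cuntz_rel_def)

lemma cuntz_relI:
  assumes "free_Cauchy X" "free_Cauchy Y" "g \<longlonglongrightarrow> 0" "\<And>k. cuntz_norm (X k - Y k) \<le> g k"
  shows "cuntz_rel X Y"
  unfolding cuntz_rel_def using assms by (auto intro: tendsto_0_le)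

lemma cuntz_rel_eqI: "free_Cauchy X \<Longrightarrow> (\<And>k. X k = Y k) \<Longrightarrow> cuntz_rel X Y"
  by (metis cuntz_rel_refl_iff ext)

lemma part_equivp_cuntz_rel: "part_equivp (cuntz_rel :: (nat \<Rightarrow> 'a::finite free_star) \<Rightarrow> _)"
proof (rule part_equivpI)
  show "\<exists>X :: nat \<Rightarrow> 'a free_star. cuntz_rel X X" by (intro exI[of _ "\<lambda>_. 0"]) simp
  show "symp (cuntz_rel :: (nat \<Rightarrow> 'a free_star) \<Rightarrow> _)" by (auto simp: symp_def cuntz_rel_def cn.minus_commute)
  show "transp (cuntz_rel :: (nat \<Rightarrow> 'a free_star) \<Rightarrow> _)"
  proof (rule transpI)
    fix X Y Z :: "nat \<Rightarrow> 'a free_star"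
    assume XY: "cuntz_rel X Y" and YZ: "cuntz_rel Y Z"
    have "(\<lambda>k. cuntz_norm (X k - Y k) + cuntz_norm (Y k - Z k)) \<longlonglongrightarrow> 0"
      using XY YZ tendsto_add[of _ "0::real" _ _ "0::real"] unfolding cuntz_rel_def by fastforce
    then show "cuntz_rel X Z"
      using XY YZ by (intro cuntz_relI) (auto simp: cuntz_rel_def intro: cn.diff_triangle)
  qed
qed

text \<open>The completion of the free *-algebra modulo the null space of the universal seminorm,
  i.e. the universal C*-algebra given by generators and relations.\<close>

quotient_type 'n cuntz = "nat \<Rightarrow> 'n::finite free_star" / partial: cuntz_rel
  by (rule part_equivp_cuntz_rel)

instantiation cuntz :: (finite) "{real_normed_algebra, monoid_mult}"
begin

lift_definition zero_cuntz :: "'a cuntz" is "\<lambda>_. 0" by simp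

lift_definition one_cuntz :: "'a cuntz" is "\<lambda>_. 1" by simp

lift_definition plus_cuntz :: "'a cuntz \<Rightarrow> 'a cuntz \<Rightarrow> 'a cuntz" is "\<lambda>X Y k. X k + Y k"
proof -
  fix X X' Y Y' :: "nat \<Rightarrow> 'a free_star"
  assume X: "cuntz_rel X X'" and Y: "cuntz_rel Y Y'"
  have "(\<lambda>k. cuntz_norm (X k - X' k) + cuntz_norm (Y k - Y' k)) \<longlonglongrightarrow> 0"
    using X Y tendsto_add[of _ "0::real" _ _ "0::real"] unfolding cuntz_rel_def by fastforce
  moreover have "cuntz_norm (X k + Y k - (X' k + Y' k)) \<le>
      cuntz_norm (X k - X' k) + cuntz_norm (Y k - Y' k)" for k
    using cn.add[of "X k - X' k" "Y k - Y' k"] by (simp add: algebra_simps)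
  ultimately show "cuntz_rel (\<lambda>k. X k + Y k) (\<lambda>k. X' k + Y' k)"
    using X Y by (intro cuntz_relI free_Cauchy_add) (auto simp: cuntz_rel_def)
qed

lift_definition uminus_cuntz :: "'a cuntz \<Rightarrow> 'a cuntz" is "\<lambda>X k. - X k"
  by (simp add: cuntz_rel_def free_Cauchy_uminus cn.minus_commute)

definition minus_cuntz :: "'a cuntz \<Rightarrow> 'a cuntz \<Rightarrow> 'a cuntz"
  where "x - y = x + - (y :: 'a cuntz)"

lift_definition times_cuntz :: "'a cuntz \<Rightarrow> 'a cuntz \<Rightarrow> 'a cuntz" is "\<lambda>X Y k. X k * Y k"
proof -
  fix X X' Y Y' :: "nat \<Rightarrow> 'a free_star"
  assume X: "cuntz_rel X X'" and Y: "cuntz_rel Y Y'"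
  obtain B where B: "\<And>k. cuntz_norm (X k) \<le> B"
    using free_Cauchy_bounded X unfolding cuntz_rel_def by blast
  obtain C where C: "\<And>k. cuntz_norm (Y' k) \<le> C"
    using free_Cauchy_bounded Y unfolding cuntz_rel_def by blast
  have "(\<lambda>k. B * cuntz_norm (Y k - Y' k) + C * cuntz_norm (X k - X' k)) \<longlonglongrightarrow> B * 0 + C * 0"
    using X Y unfolding cuntz_rel_def by (intro tendsto_intros) auto
  then show "cuntz_rel (\<lambda>k. X k * Y k) (\<lambda>k. X' k * Y' k)"
    using X Y cuntz_norm_mult_diff[OF B C]
    by (intro cuntz_relI[where g = "\<lambda>k. B * cuntz_norm (Y k - Y' k) + C * cuntz_norm (X k - X' k)"]
        free_Cauchy_mult) (auto simp: cuntz_rel_def)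
qed

lift_definition scaleR_cuntz :: "real \<Rightarrow> 'a cuntz \<Rightarrow> 'a cuntz"
  is "\<lambda>r X k. free_scale (complex_of_real r) (X k)"
  by (auto simp: cuntz_rel_def free_Cauchy_scale free_scale_diff[symmetric] cn.scale
      intro: tendsto_mult_right_zero)

lift_definition norm_cuntz :: "'a cuntz \<Rightarrow> real" is "\<lambda>X. lim (\<lambda>k. cuntz_norm (X k))"
proof -
  fix X Y :: "nat \<Rightarrow> 'a free_star"
  assume XY: "cuntz_rel X Y"
  have "(\<lambda>k. cuntz_norm (X k) - cuntz_norm (Y k)) \<longlonglongrightarrow> 0"
    by (rule Lim_null_comparison[where g = "\<lambda>k. cuntz_norm (X k - Y k)", OF always_eventually])
       (use XY in \<open>auto simp: cuntz_rel_def cn.abs_diff\<close>)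
  moreover have "(\<lambda>k. cuntz_norm (X k) - cuntz_norm (Y k)) \<longlonglongrightarrow>
      lim (\<lambda>k. cuntz_norm (X k)) - lim (\<lambda>k. cuntz_norm (Y k))"
    using XY by (intro tendsto_diff free_Cauchy_norm_tendsto) (auto simp: cuntz_rel_def)
  ultimately show "lim (\<lambda>k. cuntz_norm (X k)) = lim (\<lambda>k. cuntz_norm (Y k))"
    using LIMSEQ_unique by fastforce
qed

definition dist_cuntz :: "'a cuntz \<Rightarrow> 'a cuntz \<Rightarrow> real"
  where "dist_cuntz x y = norm (x - y)"

definition sgn_cuntz :: "'a cuntz \<Rightarrow> 'a cuntz"
  where "sgn_cuntz x = inverse (norm x) *\<^sub>R x"

definition uniformity_cuntz :: "('a cuntz \<times> 'a cuntz) filter"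
  where "uniformity_cuntz = (INF e\<in>{0 <..}. principal {(x, y). dist x y < e})"

definition open_cuntz :: "'a cuntz set \<Rightarrow> bool"
  where "open_cuntz U \<longleftrightarrow> (\<forall>x\<in>U. eventually (\<lambda>(x', y). x' = x \<longrightarrow> y \<in> U) uniformity)"

instance
proof
  fix x y z :: "'a cuntz" and a b :: real and U :: "'a cuntz set"
  show "x - y = x + - y" by (rule minus_cuntz_def)
  show "x + y + z = x + (y + z)"
    by transfer (rule cuntz_rel_eqI; auto intro: free_Cauchy_intros simp: algebra_simps)
  show "x + y = y + x"
    by transfer (rule cuntz_rel_eqI; auto intro: free_Cauchy_intros simp: algebra_simps)
  show "0 + x = x"
    by transfer (rule cuntz_rel_eqI; auto intro: free_Cauchy_intros simp: algebra_simps)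
  show "- x + x = 0"
    by transfer (rule cuntz_rel_eqI; auto intro: free_Cauchy_intros simp: algebra_simps)
  show "x * y * z = x * (y * z)"
    by transfer (rule cuntz_rel_eqI; auto intro: free_Cauchy_intros simp: mult.assoc)
  show "(x + y) * z = x * z + y * z"
    by transfer (rule cuntz_rel_eqI; auto intro: free_Cauchy_intros simp: algebra_simps)
  show "x * (y + z) = x * y + x * z"
    by transfer (rule cuntz_rel_eqI; auto intro: free_Cauchy_intros simp: algebra_simps)
  show "1 * x = x"
    by transfer (rule cuntz_rel_eqI; auto intro: free_Cauchy_intros)
  show "x * 1 = x"
    by transfer (rule cuntz_rel_eqI; auto intro: free_Cauchy_intros)
  show "a *\<^sub>R (x + y) = a *\<^sub>R x + a *\<^sub>R y"
    by transfer (rule cuntz_rel_eqI; auto intro: free_Cauchy_intros simp: free_scale_add_right)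
  show "(a + b) *\<^sub>R x = a *\<^sub>R x + b *\<^sub>R x"
    by transfer (rule cuntz_rel_eqI; auto intro: free_Cauchy_intros simp: free_scale_add_left)
  show "a *\<^sub>R b *\<^sub>R x = (a * b) *\<^sub>R x"
    by transfer (rule cuntz_rel_eqI; auto intro: free_Cauchy_intros simp: free_scale_free_scale)
  show "1 *\<^sub>R x = x"
    by transfer (rule cuntz_rel_eqI; auto intro: free_Cauchy_intros)
  show "a *\<^sub>R x * y = a *\<^sub>R (x * y)"
    by transfer (rule cuntz_rel_eqI; auto intro: free_Cauchy_intros simp: free_scale_mult_left)
  show "x * a *\<^sub>R y = a *\<^sub>R (x * y)"
    by transfer (rule cuntz_rel_eqI; auto intro: free_Cauchy_intros simp: free_scale_mult_right)
  show "dist x y = norm (x - y)" by (rule dist_cuntz_def)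
  show "sgn x = inverse (norm x) *\<^sub>R x" by (rule sgn_cuntz_def)
  show "uniformity = (INF e\<in>{0 <..}. principal {(x, y :: 'a cuntz). dist x y < e})"
    by (rule uniformity_cuntz_def)
  show "open U \<longleftrightarrow> (\<forall>x\<in>U. eventually (\<lambda>(x', y). x' = x \<longrightarrow> y \<in> U) uniformity)"
    by (rule open_cuntz_def)
  show "norm x = 0 \<longleftrightarrow> x = 0"
  proof (transfer, safe)
    fix X :: "nat \<Rightarrow> 'a free_star"
    assume X: "cuntz_rel X X" and 0: "lim (\<lambda>k. cuntz_norm (X k)) = 0"
    then show "cuntz_rel X (\<lambda>_. 0)"
      using free_Cauchy_norm_tendsto[of X] by (simp add: cuntz_rel_def)
  next
    fix X :: "nat \<Rightarrow> 'a free_star"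
    assume "cuntz_rel X (\<lambda>_. 0)"
    then show "lim (\<lambda>k. cuntz_norm (X k)) = 0"
      by (simp add: cuntz_rel_def limI)
  qed
  show "norm (x + y) \<le> norm x + norm y"
  proof transfer
    fix X Y :: "nat \<Rightarrow> 'a free_star"
    assume "cuntz_rel X X" "cuntz_rel Y Y"
    then show "lim (\<lambda>k. cuntz_norm (X k + Y k)) \<le> lim (\<lambda>k. cuntz_norm (X k)) + lim (\<lambda>k. cuntz_norm (Y k))"
      by (intro LIMSEQ_le[OF free_Cauchy_norm_tendsto
            tendsto_add[OF free_Cauchy_norm_tendsto free_Cauchy_norm_tendsto]])
         (auto intro: free_Cauchy_intros cn.add)
  qed
  show "norm (x * y) \<le> norm x * norm y"
  proof transfer
    fix X Y :: "nat \<Rightarrow> 'a free_star"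
    assume "cuntz_rel X X" "cuntz_rel Y Y"
    then show "lim (\<lambda>k. cuntz_norm (X k * Y k)) \<le> lim (\<lambda>k. cuntz_norm (X k)) * lim (\<lambda>k. cuntz_norm (Y k))"
      by (intro LIMSEQ_le[OF free_Cauchy_norm_tendsto
            tendsto_mult[OF free_Cauchy_norm_tendsto free_Cauchy_norm_tendsto]])
         (auto intro: free_Cauchy_intros cn.mult)
  qed
  show "norm (a *\<^sub>R x) = \<bar>a\<bar> * norm x"
  proof transfer
    fix a and X :: "nat \<Rightarrow> 'a free_star"
    assume "cuntz_rel X X"
    then show "lim (\<lambda>k. cuntz_norm (free_scale (complex_of_real a) (X k))) = \<bar>a\<bar> * lim (\<lambda>k. cuntz_norm (X k))"
      by (intro limI) (simp add: cn.scale tendsto_mult_left free_Cauchy_norm_tendsto)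
  qed
qed

end

definition of_free :: "'n::finite free_star \<Rightarrow> 'n cuntz"
  where "of_free x = abs_cuntz (\<lambda>_. x)"

lemma of_free_add: "of_free (x + y) = of_free x + of_free y"
  by (simp add: of_free_def plus_cuntz.abs_eq)

lemma of_free_mult: "of_free (x * y) = of_free x * of_free y"
  by (simp add: of_free_def times_cuntz.abs_eq)

lemma of_free_uminus: "of_free (- x) = - of_free x"
  by (simp add: of_free_def uminus_cuntz.abs_eq)

lemma of_free_diff: "of_free (x - y) = of_free x - of_free y"
  using of_free_add[of x "- y"] by (simp add: of_free_uminus)

lemma of_free_0 [simp]: "of_free 0 = 0"
  by (simp add: of_free_def zero_cuntz.abs_eq)

lemma of_free_1 [simp]: "of_free 1 = 1"
  by (simp add: of_free_def one_cuntz.abs_eq)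

lemma norm_of_free: "norm (of_free x) = cuntz_norm x"
  by (simp add: of_free_def norm_cuntz.abs_eq)

lemma abs_cuntz_limit:
  assumes "free_Cauchy X"
  shows "(\<lambda>k. of_free (X k)) \<longlonglongrightarrow> abs_cuntz X"
proof (rule metric_LIMSEQ_I)
  fix e :: real assume "e > 0"
  then obtain M where M: "\<And>j k. j \<ge> M \<Longrightarrow> k \<ge> M \<Longrightarrow> cuntz_norm (X j - X k) < e / 2"
    using assms unfolding free_Cauchy_def by (metis half_gt_zero)
  have "dist (of_free (X j)) (abs_cuntz X) < e" if j: "j \<ge> M" for j
  proof -
    have C: "free_Cauchy (\<lambda>k. X j - X k)" using assms by (intro free_Cauchy_intros)
    have "of_free (X j) - abs_cuntz X = abs_cuntz (\<lambda>k. X j - X k)"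
      using assms by (simp add: minus_cuntz_def of_free_def uminus_cuntz.abs_eq
          plus_cuntz.abs_eq free_Cauchy_uminus)
    then have "dist (of_free (X j)) (abs_cuntz X) = lim (\<lambda>k. cuntz_norm (X j - X k))"
      using C by (simp add: dist_norm norm_cuntz.abs_eq)
    also have "\<dots> \<le> e / 2"
      by (rule LIMSEQ_le_const2[OF free_Cauchy_norm_tendsto[OF C]])
         (use M j in \<open>auto intro!: exI[of _ M] less_imp_le\<close>)
    finally show ?thesis using \<open>e > 0\<close> by simp
  qed
  then show "\<exists>M. \<forall>j\<ge>M. dist (of_free (X j)) (abs_cuntz X) < e" by blast
qed

lemma cuntz_cases:
  fixes x :: "'n::finite cuntz"
  obtains X where "free_Cauchy X" "x = abs_cuntz X"
  using Quotient3_cuntz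
  by (metis Quotient3_abs_rep Quotient3_rep_reflp cuntz_rel_refl_iff)

lemma of_free_dense: "closure (range of_free) = UNIV"
proof -
  have "x \<in> closure (range of_free)" for x :: "'a cuntz"
  proof (cases x rule: cuntz_cases)
    case (1 X)
    then show ?thesis
      unfolding closure_sequential
      by (intro exI[of _ "\<lambda>k. of_free (X k)"]) (auto intro: abs_cuntz_limit)
  qed
  then show ?thesis by blast
qed

instance cuntz :: (finite) complete_space
proof
  fix A :: "nat \<Rightarrow> 'a cuntz"
  assume A: "Cauchy A"
  have "\<exists>x. dist (of_free x) (A k) < inverse (real (Suc k))" for k
    using of_free_dense closure_approachable[of "A k" "range of_free"] by (auto simp: image_iff)
  then obtain X where X: "\<And>k. dist (of_free (X k)) (A k) < inverse (real (Suc k))" by metis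
  have lim: "(\<lambda>k. of_free (X k) - A k) \<longlonglongrightarrow> 0"
    by (rule Lim_null_comparison[OF always_eventually LIMSEQ_inverse_real_of_nat])
       (use X in \<open>auto simp: dist_norm intro: less_imp_le\<close>)
  have "Cauchy (\<lambda>k. of_free (X k))"
  proof (rule metric_CauchyI)
    fix e :: real assume "e > 0"
    then have "e / 2 > 0" by simp
    obtain M where M: "\<And>j k. j \<ge> M \<Longrightarrow> k \<ge> M \<Longrightarrow> dist (A j) (A k) < e / 2"
      using metric_CauchyD[OF A \<open>e / 2 > 0\<close>] by blast
    obtain L where L: "\<And>j k. j \<ge> L \<Longrightarrow> k \<ge> L \<Longrightarrow>
        dist (of_free (X j) - A j) (of_free (X k) - A k) < e / 2"
      using metric_CauchyD[OF LIMSEQ_imp_Cauchy[OF lim] \<open>e / 2 > 0\<close>] by blast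
    have "dist (of_free (X j)) (of_free (X k)) < e" if "j \<ge> max M L" "k \<ge> max M L" for j k
    proof -
      have "of_free (X j) - of_free (X k) =
          (A j - A k) + ((of_free (X j) - A j) - (of_free (X k) - A k))" by simp
      then have "dist (of_free (X j)) (of_free (X k)) \<le>
          dist (A j) (A k) + dist (of_free (X j) - A j) (of_free (X k) - A k)"
        unfolding dist_norm by (metis norm_triangle_ineq)
      then show ?thesis using M[of j k] L[of j k] that by simp
    qed
    then show "\<exists>M. \<forall>j\<ge>M. \<forall>k\<ge>M. dist (of_free (X j)) (of_free (X k)) < e" by blast
  qed
  then have "free_Cauchy X"
    unfolding Cauchy_def free_Cauchy_def by (simp add: dist_norm norm_of_free flip: of_free_diff)
  then have "(\<lambda>k. of_free (X k) - (of_free (X k) - A k)) \<longlonglongrightarrow> abs_cuntz X - 0"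
    by (intro tendsto_diff abs_cuntz_limit lim)
  then show "convergent A" by (auto simp: convergent_def)
qed

instantiation cuntz :: (finite) unital_cstar_algebra
begin

lift_definition scaleC_cuntz :: "complex \<Rightarrow> 'a cuntz \<Rightarrow> 'a cuntz" is "\<lambda>c X k. free_scale c (X k)"
  by (auto simp: cuntz_rel_def free_Cauchy_scale free_scale_diff[symmetric] cn.scale
      intro: tendsto_mult_right_zero)

lift_definition adj_cuntz :: "'a cuntz \<Rightarrow> 'a cuntz" is "\<lambda>X k. free_adj (X k)"
  by (auto simp: cuntz_rel_def free_Cauchy_adj free_adj_diff[symmetric] cn.adj)

instance
proof
  fix x y :: "'a cuntz" and c d :: complex and r :: real
  show "c *\<^sub>C (x + y) = c *\<^sub>C x + c *\<^sub>C y"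
    by transfer (rule cuntz_rel_eqI; auto intro: free_Cauchy_intros simp: free_scale_add_right)
  show "(c + d) *\<^sub>C x = c *\<^sub>C x + d *\<^sub>C x"
    by transfer (rule cuntz_rel_eqI; auto intro: free_Cauchy_intros simp: free_scale_add_left)
  show "c *\<^sub>C d *\<^sub>C x = (c * d) *\<^sub>C x"
    by transfer (rule cuntz_rel_eqI; auto intro: free_Cauchy_intros simp: free_scale_free_scale)
  show "complex_of_real r *\<^sub>C x = r *\<^sub>R x"
    by transfer (rule cuntz_rel_eqI; auto intro: free_Cauchy_intros)
  show "c *\<^sub>C x * y = c *\<^sub>C (x * y)"
    by transfer (rule cuntz_rel_eqI; auto intro: free_Cauchy_intros simp: free_scale_mult_left)
  show "x * c *\<^sub>C y = c *\<^sub>C (x * y)"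
    by transfer (rule cuntz_rel_eqI; auto intro: free_Cauchy_intros simp: free_scale_mult_right)
  show "adj (x + y) = adj x + adj y"
    by transfer (rule cuntz_rel_eqI; auto intro: free_Cauchy_intros simp: free_adj_add)
  show "adj (c *\<^sub>C x) = cnj c *\<^sub>C adj x"
    by transfer (rule cuntz_rel_eqI; auto intro: free_Cauchy_intros simp: free_adj_scale)
  show "adj (x * y) = adj y * adj x"
    by transfer (rule cuntz_rel_eqI; auto intro: free_Cauchy_intros simp: free_adj_mult)
  show "adj (adj x) = x"
    by transfer (rule cuntz_rel_eqI; auto intro: free_Cauchy_intros)
  show "norm (c *\<^sub>C x) = cmod c * norm x"
  proof transfer
    fix c and X :: "nat \<Rightarrow> 'a free_star"
    assume "cuntz_rel X X"
    then show "lim (\<lambda>k. cuntz_norm (free_scale c (X k))) = cmod c * lim (\<lambda>k. cuntz_norm (X k))"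
      by (intro limI) (simp add: cn.scale tendsto_mult_left free_Cauchy_norm_tendsto)
  qed
  show "norm (adj x * x) = (norm x)\<^sup>2"
  proof transfer
    fix X :: "nat \<Rightarrow> 'a free_star"
    assume "cuntz_rel X X"
    then show "lim (\<lambda>k. cuntz_norm (free_adj (X k) * X k)) = (lim (\<lambda>k. cuntz_norm (X k)))\<^sup>2"
      by (intro limI) (simp add: cn.adj_self tendsto_power free_Cauchy_norm_tendsto)
  qed
qed

end

lemma of_free_scale: "of_free (free_scale c x) = c *\<^sub>C of_free x"
  by (simp add: of_free_def scaleC_cuntz.abs_eq)

lemma of_free_adj: "of_free (free_adj x) = adj (of_free x)"
  by (simp add: of_free_def adj_cuntz.abs_eq)

definition cuntz_gen :: "'n::finite \<Rightarrow> 'n cuntz"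
  where "cuntz_gen i = of_free (free_gen i)"

lemma of_free_sum: "of_free (\<Sum>i\<in>A. f i) = (\<Sum>i\<in>A. of_free (f i))"
  by (induction A rule: infinite_finite_induct) (simp_all add: of_free_add)

theorem cuntz_gen_isometry: "adj (cuntz_gen i) * cuntz_gen i = 1"
proof -
  have "norm (of_free (free_adj (free_gen i) * free_gen i - 1)) = 0"
    using cuntz_seminormD(2)[OF cuntz_seminorm_cuntz_norm] by (simp add: norm_of_free)
  then show ?thesis by (simp add: cuntz_gen_def of_free_diff of_free_mult of_free_adj)
qed

theorem cuntz_gen_sum: "(\<Sum>i\<in>UNIV. cuntz_gen i * adj (cuntz_gen i)) = (1 :: 'n::finite cuntz)"
proof -
  have "norm (of_free ((\<Sum>i\<in>UNIV. free_gen i * free_adj (free_gen i)) - 1 :: 'n free_star)) = 0"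
    using cuntz_seminormD(3)[OF cuntz_seminorm_cuntz_norm] by (simp add: norm_of_free)
  then show ?thesis by (simp add: cuntz_gen_def of_free_diff of_free_sum of_free_mult of_free_adj)
qed

theorem cuntz_generated:
  fixes B :: "'n::finite cuntz set"
  assumes "closed B" "1 \<in> B" "\<And>i. cuntz_gen i \<in> B"
    and "\<And>x y. x \<in> B \<Longrightarrow> y \<in> B \<Longrightarrow> x + y \<in> B" "\<And>c x. x \<in> B \<Longrightarrow> c *\<^sub>C x \<in> B"
    and "\<And>x y. x \<in> B \<Longrightarrow> y \<in> B \<Longrightarrow> x * y \<in> B" "\<And>x. x \<in> B \<Longrightarrow> adj x \<in> B"
  shows "B = UNIV"
proof -
  have letter: "of_free (Poly_Mapping.single (Word [a]) 1) \<in> B" for a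
  proof (cases a)
    case (Pair i b)
    have "of_free (free_adj (free_gen i)) \<in> B"
      using assms(3)[of i] assms(7) by (simp add: of_free_adj cuntz_gen_def)
    then show ?thesis
      using assms(3)[of i] Pair
      by (cases b) (simp_all add: cuntz_gen_def free_gen_def word_adj_def)
  qed
  have word: "of_free (Poly_Mapping.single (Word l) 1) \<in> B" for l
  proof (induction l)
    case Nil
    then show ?case using assms(2) by (simp flip: zero_star_word_def)
  next
    case (Cons a l)
    have "Poly_Mapping.single (Word (a # l)) 1 =
        Poly_Mapping.single (Word [a]) 1 * (Poly_Mapping.single (Word l) 1 :: 'n free_star)"
      by (simp add: mult_single plus_star_word_def)
    then show ?case using assms(6)[OF letter Cons] by (simp add: of_free_mult)
  qed
  have "of_free x \<in> B" for x
  proof (induction x rule: free_star_induct)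
    case (single w c)
    have "of_free (Poly_Mapping.single w c) = c *\<^sub>C of_free (Poly_Mapping.single w 1)"
      by (simp add: free_scale_single flip: of_free_scale)
    then show ?case using assms(5) word[of "letters w"] by simp
  next
    case (add x y)
    then show ?case using assms(4) by (simp add: of_free_add)
  qed
  then have "closure (range of_free) \<subseteq> B" using assms(1) by (intro closure_minimal) auto
  then show ?thesis by (simp add: of_free_dense top.extremum_unique)
qed

context
  fixes T :: "'n::finite \<Rightarrow> 'b::unital_cstar_algebra"
begin

definition word_eval :: "'n star_word \<Rightarrow> 'b"
  where "word_eval w = prod_list (map (\<lambda>(i, b). if b then adj (T i) else T i) (letters w))"

definition free_eval :: "'n free_star \<Rightarrow> 'b"
  where "free_eval = extend_linear (\<lambda>w c. c *\<^sub>C word_eval w)"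

end

lemma adj_one: "adj 1 = (1 :: 'a::unital_cstar_algebra)"
  by (metis adj_adj adj_mult mult_1_left mult_1_right)

lemma word_eval_plus: "word_eval T (v + w) = word_eval T v * word_eval T w"
  by (simp add: word_eval_def plus_star_word_def)

lemma word_eval_adj: "word_eval T (word_adj w) = adj (word_eval T w)"
proof -
  have "word_eval T (word_adj (Word l)) = adj (word_eval T (Word l))" for l
    by (induction l) (auto simp: word_eval_def word_adj_def adj_one adj_mult adj_adj)
  then show ?thesis by (metis star_word.exhaust)
qed

lemma free_eval_single: "free_eval T (Poly_Mapping.single w c) = c *\<^sub>C word_eval T w"
  by (simp add: free_eval_def extend_linear_single)

lemma free_eval_add: "free_eval T (x + y) = free_eval T x + free_eval T y"
  unfolding free_eval_def by (rule extend_linear_add) (simp_all add: scaleC_add_left)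

lemma free_eval_mult: "free_eval T (x * y) = free_eval T x * free_eval T y"
proof (induction x rule: free_star_induct)
  case (single w c)
  show ?case
    by (induction y rule: free_star_induct)
       (simp_all add: mult_single free_eval_single free_eval_add word_eval_plus
         mult_scaleC_left mult_scaleC_right scaleC_scaleC mult.commute[of c] distrib_left)
qed (simp add: free_eval_add distrib_right)

lemma free_eval_one: "free_eval T 1 = 1"
proof -
  have "word_eval T 0 = 1" by (simp add: word_eval_def zero_star_word_def)
  then show ?thesis using free_eval_single[of T 0 1] by simp
qed

lemma free_eval_scale: "free_eval T (free_scale c x) = c *\<^sub>C free_eval T x"
  by (simp add: free_scale_def free_eval_mult free_eval_single word_eval_def
      zero_star_word_def mult_scaleC_left)

lemma free_eval_adj: "free_eval T (free_adj x) = adj (free_eval T x)"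
  by (induction x rule: free_star_induct)
     (simp_all add: free_eval_single free_eval_add free_adj_add adj_add adj_scaleC word_eval_adj)

lemma free_eval_diff: "free_eval T (x - y) = free_eval T x - free_eval T y"
  using free_eval_add[of T "x - y" y] by simp

lemma free_eval_sum: "free_eval T (\<Sum>i\<in>A. f i) = (\<Sum>i\<in>A. free_eval T (f i))"
  by (induction A rule: infinite_finite_induct)
     (simp_all add: free_eval_add, simp_all add: free_eval_def)

lemma free_eval_gen: "free_eval T (free_gen i) = T i"
  by (simp add: free_gen_def free_eval_single word_eval_def)

lemma norm_adj_le: "norm x \<le> norm (adj (x :: 'a::unital_cstar_algebra))"
proof (cases "x = 0")
  case False
  have "norm x * norm x \<le> norm (adj x) * norm x"
    using norm_mult_ineq[of "adj x" x] norm_adj_mult_self[of x] by (simp add: power2_eq_square)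
  then show ?thesis using False by simp
qed simp

lemma norm_adj: "norm (adj x) = norm (x :: 'a::unital_cstar_algebra)"
  using norm_adj_le[of x] norm_adj_le[of "adj x"] by (simp add: adj_adj)

lemma tendsto_adj:
  fixes x :: "'a::unital_cstar_algebra"
  assumes "(f \<longlongrightarrow> x) F"
  shows "((\<lambda>k. adj (f k)) \<longlongrightarrow> adj x) F"
proof -
  have d: "adj (a - b) = adj a - adj b" for a b :: 'a
    using adj_add[of "a - b" b] by simp
  show ?thesis
    using assms by (simp add: tendsto_iff dist_norm norm_adj flip: d)
qed

lemma tendsto_scaleC:
  fixes x :: "'a::unital_cstar_algebra"
  assumes "(f \<longlongrightarrow> x) F"
  shows "((\<lambda>k. c *\<^sub>C f k) \<longlongrightarrow> c *\<^sub>C x) F"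
proof (rule Lim_transform)
  show "((\<lambda>k. c *\<^sub>C x) \<longlongrightarrow> c *\<^sub>C x) F" by simp
  have "((\<lambda>k. cmod c * norm (f k - x)) \<longlongrightarrow> 0) F"
    by (intro tendsto_mult_right_zero tendsto_norm_zero LIM_zero assms)
  then show "((\<lambda>k. c *\<^sub>C f k - c *\<^sub>C x) \<longlongrightarrow> 0) F"
    by (rule tendsto_norm_zero_cancel[OF tendsto_0_le])
       (simp_all add: norm_scaleC flip: cvec.scale_right_diff_distrib)
qed

theorem cuntz_universal:
  fixes T :: "'n::finite \<Rightarrow> 'b::unital_cstar_algebra"
  assumes iso: "\<And>i. adj (T i) * T i = 1"
    and sum: "(\<Sum>i\<in>UNIV. T i * adj (T i)) = 1"
  shows "\<exists>f :: 'n cuntz \<Rightarrow> 'b. unital_star_hom f \<and> (\<forall>i. f (cuntz_gen i) = T i) \<and>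
    (\<forall>x. norm (f x) \<le> norm x)"
proof -
  let ?e = "free_eval T"
  have "cuntz_seminorm (\<lambda>x. norm (?e x))"
    unfolding cuntz_seminorm_def cstar_seminorm_def
    by (simp add: free_eval_add free_eval_scale free_eval_mult free_eval_adj free_eval_diff
        free_eval_sum free_eval_gen free_eval_one norm_triangle_ineq norm_mult_ineq norm_scaleC
        norm_adj_mult_self iso sum)
  then have le: "norm (?e x) \<le> norm (of_free x)" for x
    unfolding norm_of_free by (rule cuntz_seminorm_le)
  have ex: "\<exists>y. \<forall>X. (\<lambda>k. of_free (X k)) \<longlonglongrightarrow> x \<longrightarrow> (\<lambda>k. ?e (X k)) \<longlonglongrightarrow> y" for x
  proof (cases x rule: cuntz_cases)
    case (1 Z)
    have "Cauchy (\<lambda>k. ?e (Z k))"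
      using \<open>free_Cauchy Z\<close> le unfolding Cauchy_def free_Cauchy_def dist_norm norm_of_free
      by (metis free_eval_diff le_less_trans)
    then obtain y where y: "(\<lambda>k. ?e (Z k)) \<longlonglongrightarrow> y"
      using Cauchy_convergent convergent_def by blast
    have "(\<lambda>k. ?e (X k)) \<longlonglongrightarrow> y" if X: "(\<lambda>k. of_free (X k)) \<longlonglongrightarrow> x" for X
    proof (rule Lim_transform[OF y])
      have "(\<lambda>k. of_free (X k) - of_free (Z k)) \<longlonglongrightarrow> x - x"
        using 1 X abs_cuntz_limit by (intro tendsto_diff) auto
      then have "(\<lambda>k. norm (of_free (X k - Z k))) \<longlonglongrightarrow> 0"
        by (simp add: of_free_diff tendsto_norm_zero)
      then show "(\<lambda>k. ?e (X k) - ?e (Z k)) \<longlonglongrightarrow> 0"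
        by (rule Lim_null_comparison[OF always_eventually, rotated])
           (auto simp: le simp flip: free_eval_diff)
    qed
    then show ?thesis by blast
  qed
  then obtain f where f: "\<And>x X. (\<lambda>k. of_free (X k)) \<longlonglongrightarrow> x \<Longrightarrow> (\<lambda>k. ?e (X k)) \<longlonglongrightarrow> f x"
    by metis
  have f_free: "f (of_free x) = ?e x" for x
    using f[of "\<lambda>_. x" "of_free x"] by (simp add: LIMSEQ_const_iff)
  have ap: "\<exists>X. (\<lambda>k. of_free (X k)) \<longlonglongrightarrow> x" for x :: "'n cuntz"
    using abs_cuntz_limit cuntz_cases by metis
  have "f (x + y) = f x + f y" for x y
  proof -
    obtain X Y where XY: "(\<lambda>k. of_free (X k)) \<longlonglongrightarrow> x" "(\<lambda>k. of_free (Y k)) \<longlonglongrightarrow> y" using ap by metis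
    have "(\<lambda>k. ?e (X k + Y k)) \<longlonglongrightarrow> f (x + y)"
      by (rule f) (simp add: of_free_add tendsto_add XY)
    moreover have "(\<lambda>k. ?e (X k + Y k)) \<longlonglongrightarrow> f x + f y"
      by (simp add: free_eval_add tendsto_add f XY)
    ultimately show ?thesis by (rule LIMSEQ_unique)
  qed
  moreover have "f (x * y) = f x * f y" for x y
  proof -
    obtain X Y where XY: "(\<lambda>k. of_free (X k)) \<longlonglongrightarrow> x" "(\<lambda>k. of_free (Y k)) \<longlonglongrightarrow> y" using ap by metis
    have "(\<lambda>k. ?e (X k * Y k)) \<longlonglongrightarrow> f (x * y)"
      by (rule f) (simp add: of_free_mult tendsto_mult XY)
    moreover have "(\<lambda>k. ?e (X k * Y k)) \<longlonglongrightarrow> f x * f y"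
      by (simp add: free_eval_mult tendsto_mult f XY)
    ultimately show ?thesis by (rule LIMSEQ_unique)
  qed
  moreover have "f (c *\<^sub>C x) = c *\<^sub>C f x" for c x
  proof -
    obtain X where X: "(\<lambda>k. of_free (X k)) \<longlonglongrightarrow> x" using ap by metis
    have "(\<lambda>k. ?e (free_scale c (X k))) \<longlonglongrightarrow> f (c *\<^sub>C x)"
      by (rule f) (simp add: of_free_scale tendsto_scaleC X)
    moreover have "(\<lambda>k. ?e (free_scale c (X k))) \<longlonglongrightarrow> c *\<^sub>C f x"
      by (simp add: free_eval_scale tendsto_scaleC f X)
    ultimately show ?thesis by (rule LIMSEQ_unique)
  qed
  moreover have "f (adj x) = adj (f x)" for x
  proof -
    obtain X where X: "(\<lambda>k. of_free (X k)) \<longlonglongrightarrow> x" using ap by metis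
    have "(\<lambda>k. ?e (free_adj (X k))) \<longlonglongrightarrow> f (adj x)"
      by (rule f) (simp add: of_free_adj tendsto_adj X)
    moreover have "(\<lambda>k. ?e (free_adj (X k))) \<longlonglongrightarrow> adj (f x)"
      by (simp add: free_eval_adj tendsto_adj f X)
    ultimately show ?thesis by (rule LIMSEQ_unique)
  qed
  moreover have "norm (f x) \<le> norm x" for x
  proof -
    obtain X where X: "(\<lambda>k. of_free (X k)) \<longlonglongrightarrow> x" using ap by metis
    show ?thesis
      by (rule LIMSEQ_le[OF tendsto_norm[OF f[OF X]] tendsto_norm[OF X]]) (auto simp: le)
  qed
  ultimately show ?thesis
    using f_free[of 1] f_free[of "free_gen _"]
    by (intro exI[of _ f]) (simp add: unital_star_hom_def free_eval_one free_eval_gen cuntz_gen_def)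
qed

section \<open>Endomorphisms and the diagonal\<close>

definition cuntz_End :: "('n::finite cuntz \<Rightarrow> 'n cuntz) set"
  where "cuntz_End = Collect unital_star_hom"

definition cuntz_Aut :: "('n::finite cuntz \<Rightarrow> 'n cuntz) set"
  where "cuntz_Aut = {f \<in> cuntz_End. bij f}"

definition cuntz_proper_End :: "('n::finite cuntz \<Rightarrow> 'n cuntz) set"
  where "cuntz_proper_End = cuntz_End - cuntz_Aut"

definition cuntz_diag_level :: "nat \<Rightarrow> 'n::finite cuntz set"
  where "cuntz_diag_level k = cvec.span
    {prod_list (map cuntz_gen \<alpha>) * prod_list (map (\<lambda>i. adj (cuntz_gen i)) (rev \<alpha>)) | \<alpha>.
      length \<alpha> = k}"

definition cuntz_diag :: "'n::finite cuntz set"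
  where "cuntz_diag = closure (\<Union>k\<in>{1..}. cuntz_diag_level k)"

text \<open>Automorphisms of a *-subalgebra \<open>A\<close> are represented by functions that are
  \<^const>\<open>undefined\<close> outside \<open>A\<close>, so that equality is equality of maps on \<open>A\<close>.\<close>

definition star_Aut :: "'a::unital_cstar_algebra set \<Rightarrow> ('a \<Rightarrow> 'a) monoid"
  where "star_Aut A = \<lparr>
    carrier = {f \<in> extensional A. bij_betw f A A \<and>
      (\<forall>x\<in>A. \<forall>y\<in>A. f (x + y) = f x + f y) \<and>
      (\<forall>c. \<forall>x\<in>A. f (c *\<^sub>C x) = c *\<^sub>C f x) \<and>
      (\<forall>x\<in>A. \<forall>y\<in>A. f (x * y) = f x * f y) \<and>
      (\<forall>x\<in>A. f (adj x) = adj (f x))},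
    monoid.mult = compose A,
    one = (\<lambda>x\<in>A. x)\<rparr>"

definition diag_restrict :: "('n::finite cuntz \<Rightarrow> 'n cuntz) \<Rightarrow> 'n cuntz \<Rightarrow> 'n cuntz"
  where "diag_restrict f = restrict f cuntz_diag"

definition cuntz_EndAut :: "('n::finite cuntz \<Rightarrow> 'n cuntz) set"
  where "cuntz_EndAut = {f \<in> cuntz_End. diag_restrict f \<in> carrier (star_Aut cuntz_diag)}"

definition diag_extensible ::
    "('n::finite cuntz \<Rightarrow> 'n cuntz) set \<Rightarrow> ('n cuntz \<Rightarrow> 'n cuntz) set"
  where "diag_extensible E =
    {\<alpha> \<in> carrier (star_Aut cuntz_diag). \<exists>f\<in>E. \<forall>x\<in>cuntz_diag. f x = \<alpha> x}"

definition subsemigroup :: "'a set \<Rightarrow> 'a monoid \<Rightarrow> bool"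
  where "subsemigroup H G \<longleftrightarrow> H \<subseteq> carrier G \<and> (\<forall>x\<in>H. \<forall>y\<in>H. x \<otimes>\<^bsub>G\<^esub> y \<in> H)"

end

theory Submission
  imports Defs
begin

text \<open>Everything rests on two facts. First, the diagonal is maximal abelian: an element commuting with
  it is decomposed into its components for the gauge action, those of nonzero degree vanish because
  their off-diagonal compressions do, and the component of degree zero is a limit of diagonal
  elements; Fejer summation recombines the components. Consequently an endomorphism \<open>h\<close> fixing the
  diagonal pointwise has the form \<open>h S\<^sub>i = u S\<^sub>i\<close> with \<open>u\<close> a unitary of the diagonal, and is an
  automorphism. So two extensions of the same automorphism of the diagonal are both automorphisms or both
  proper, and the inverse of an automorphism of the diagonal that extends to a proper
  endomorphism does not extend at all. Second, such proper endomorphisms exist: identifying the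
  alphabet with the group of \<open>n\<close>-th roots of unity, the homeomorphism
  \<open>(w\<^sub>1, w\<^sub>2, w\<^sub>3, \<dots>) \<mapsto> (w\<^sub>1, w\<^sub>2 / w\<^sub>1, w\<^sub>3 / w\<^sub>2, \<dots>)\<close> of the Cantor space is induced by an endomorphism
  whose range is fixed by a nontrivial automorphism.\<close>

section \<open>Contractivity of *-homomorphisms\<close>

text \<open>An element of the commutant is only a norm limit of polynomials in the generators, and
  these need not commute with the diagonal; so what is known of the commutant has to survive a
  perturbation. The compressions x \<mapsto> S_\<alpha>^* x S_\<beta> achieve this: for distinct
  \<alpha>, \<beta> of equal length they annihilate the commutant, and applied to a nearby
  polynomial they bound its coefficients. The constants may depend on the degree only, as the
  lengths of the words are uncontrolled.

  The endomorphism is S_i \<mapsto> S_i P_i with P_i the unitary such that P_i S_j = S_{j/i}. That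
  its restriction should resist inversion is visible in the homeomorphism: each new coordinate
  depends on two neighbours, whereas the inverse forms running products and depends on all earlier
  coordinates. The terms S_i S_{j/i} S_j^* of S_i P_i have weight i (j/i) / j = 1, which is why the
  automorphism S_i \<mapsto> i S_i leaves the range alone.\<close>

instance unital_cstar_algebra \<subseteq> banach ..

lemma adj_zero [simp]: "adj 0 = (0 :: 'a::unital_cstar_algebra)"
  using adj_add[of 0 "0::'a"] by simp

lemma adj_uminus: "adj (- x) = - adj (x :: 'a::unital_cstar_algebra)"
  using adj_add[of x "- x"] by (simp add: eq_neg_iff_add_eq_0 add.commute)

lemma adj_diff: "adj (x - y) = adj x - adj (y :: 'a::unital_cstar_algebra)"
  using adj_add[of x "- y"] by (simp add: adj_uminus)

lemma adj_sum: "adj (\<Sum>i\<in>A. f i) = (\<Sum>i\<in>A. adj (f i :: 'a::unital_cstar_algebra))"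
  by (induction A rule: infinite_finite_induct) (simp_all add: adj_add)

lemma adj_power: "adj (x ^ k) = adj (x :: 'a::unital_cstar_algebra) ^ k"
  by (induction k) (simp_all add: adj_one adj_mult power_commutes)

lemma bounded_linear_adj: "bounded_linear (adj :: 'a::unital_cstar_algebra \<Rightarrow> 'a)"
proof (rule bounded_linear_intro[where K = 1])
  show "adj (r *\<^sub>R x) = r *\<^sub>R adj x" for r and x :: 'a
    using adj_scaleC[of "complex_of_real r" x] by (simp add: scaleC_of_real)
qed (simp_all add: adj_add norm_adj)

lemma norm_one_le: "norm (1 :: 'a::unital_cstar_algebra) \<le> 1"
proof -
  have "norm (1::'a) = (norm (1::'a))\<^sup>2"
    using norm_adj_mult_self[of "1::'a"] by (simp add: adj_one)
  then have "norm (1::'a) = 0 \<or> norm (1::'a) = 1" by (simp add: power2_eq_square)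
  then show ?thesis by auto
qed

lemma norm_mult3_le: "norm (x * y * z) \<le> norm x * norm y * norm (z :: 'a::real_normed_algebra)"
  by (rule order_trans[OF norm_mult_ineq mult_right_mono[OF norm_mult_ineq norm_ge_zero]])

lemma norm_power_le: "norm (x ^ k) \<le> norm (x :: 'a::unital_cstar_algebra) ^ k"
proof (induction k)
  case (Suc k)
  have "norm (x ^ Suc k) \<le> norm x * norm (x ^ k)" by (simp add: norm_mult_ineq)
  also have "\<dots> \<le> norm x * norm x ^ k" using Suc by (simp add: mult_left_mono)
  finally show ?case by simp
qed (simp add: norm_one_le)

lemma norm_isometry_le:
  fixes u :: "'a::unital_cstar_algebra"
  assumes "adj u * u = 1"
  shows "norm u \<le> 1"
proof -
  have "(norm u)\<^sup>2 \<le> 1\<^sup>2" using norm_adj_mult_self[of u] assms norm_one_le[where 'a = 'a] by simp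
  then show ?thesis by (rule power2_le_imp_le) simp
qed

section \<open>Square roots of 1 - a through the binomial series of sqrt (1 - t)\<close>

definition sqrt_coeff :: "nat \<Rightarrow> real"
  where "sqrt_coeff k = (- 1) ^ k * ((1/2) gchoose k)"

text \<open>Passing from k to k + 1 multiplies the modulus by |1/2 - k| / (k + 1), which is at most
  1. This crude bound already gives a geometric majorant for arguments of norm below 1.\<close>

lemma sqrt_coeff_bound: "\<bar>sqrt_coeff k\<bar> \<le> 1"
proof -
  have "\<bar>(1/2 :: real) gchoose k\<bar> \<le> 1"
  proof (induction k)
    case (Suc k)
    have "\<bar>(1/2 :: real) gchoose Suc k\<bar> = \<bar>(1/2) gchoose k\<bar> * (\<bar>1/2 - real k\<bar> / (real k + 1))"
      by (simp add: gbinomial_absorption' gbinomial_Suc_rec abs_mult)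
    also have "\<dots> \<le> 1 * 1"
      using Suc by (intro mult_mono) (auto simp: field_simps abs_if)
    finally show ?case by simp
  qed simp
  then show ?thesis by (simp add: sqrt_coeff_def abs_mult power_abs)
qed

text \<open>Vandermonde's identity with 1/2 + 1/2 = 1: the square of the series is the two-term
  series of 1 - t.\<close>

lemma sqrt_coeff_convolution:
  "(\<Sum>i\<le>k. sqrt_coeff i * sqrt_coeff (k - i)) = (if k = 0 then 1 else if k = 1 then -1 else 0)"
proof -
  have "(\<Sum>i\<le>k. sqrt_coeff i * sqrt_coeff (k - i)) =
      (\<Sum>i\<le>k. (- 1) ^ k * (((1/2) gchoose i) * ((1/2) gchoose (k - i))))"
    by (rule sum.cong) (auto simp: sqrt_coeff_def simp flip: power_add)
  also have "\<dots> = (- 1) ^ k * ((1 :: real) gchoose k)"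
    using gbinomial_Vandermonde[where a = "1/2 :: real" and b = "1/2" and n = k]
    by (simp add: atMost_atLeast0 flip: sum_distrib_left)
  also have "(1 :: real) gchoose k = of_nat (1 choose k)"
    by (simp add: binomial_gbinomial)
  finally show ?thesis
    by (cases k rule: nat.exhaust) (auto simp: binomial_eq_0)
qed

text \<open>The real coefficients make the sum of the series self-adjoint, and whatever commutes
  with \<open>a\<close> commutes with each term. The commutation clause is what later makes
  \<open>a\<close> commute with sqrt (1 - a^2).\<close>

lemma contraction_sqrt:
  fixes a :: "'a::unital_cstar_algebra"
  assumes "adj a = a" "norm a < 1"
  obtains b where "adj b = b" "b * b = 1 - a" "\<And>x. x * a = a * x \<Longrightarrow> x * b = b * x"
proof -
  let ?t = "\<lambda>k. sqrt_coeff k *\<^sub>R a ^ k"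
  define b where "b = suminf ?t"
  have sn: "summable (\<lambda>k. norm (?t k))"
  proof (rule summable_comparison_test')
    show "summable (\<lambda>k. norm a ^ k)" using assms by (simp add: summable_geometric)
    show "norm (norm (?t k)) \<le> norm a ^ k" for k
      using mult_mono[OF sqrt_coeff_bound[of k] norm_power_le[of a k]] by simp
  qed
  then have s: "?t sums b" unfolding b_def by (simp add: summable_norm_cancel summable_sums)
  have "(\<lambda>k. adj (?t k)) sums adj b"
    using bounded_linear.sums[OF bounded_linear_adj s] .
  moreover have "adj (?t k) = ?t k" for k
    by (simp add: linear_simps(5)[OF bounded_linear_adj] adj_power assms)
  ultimately have "?t sums adj b" by simp
  then have adj: "adj b = b" using s by (rule sums_unique2)
  have "(\<lambda>k. \<Sum>i\<le>k. ?t i * ?t (k - i)) sums (b * b)"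
    using Cauchy_product_sums[OF sn sn] by (simp add: b_def)
  moreover have "(\<Sum>i\<le>k. ?t i * ?t (k - i)) =
      (if k = 0 then 1 else if k = 1 then - a else 0)" for k
  proof -
    have "(\<Sum>i\<le>k. ?t i * ?t (k - i)) = (\<Sum>i\<le>k. sqrt_coeff i * sqrt_coeff (k - i)) *\<^sub>R a ^ k"
      unfolding scaleR_sum_left by (rule sum.cong) (auto simp flip: power_add)
    then show ?thesis by (simp add: sqrt_coeff_convolution)
  qed
  ultimately have "(\<lambda>k. if k = 0 then 1 else if k = 1 then - a else 0) sums (b * b)" by simp
  moreover have "(\<lambda>k. if k = 0 then 1 else if k = 1 then - a else 0) sums (1 - a)"
    using sums_finite[of "{0, 1 :: nat}" "\<lambda>k. if k = 0 then 1 else if k = 1 then - a else 0"]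
    by simp
  ultimately have sq: "b * b = 1 - a" by (rule sums_unique2)
  have "x * b = b * x" if "x * a = a * x" for x
  proof -
    have "x * a ^ k = a ^ k * x" for k using that by (simp add: power_commuting_commutes)
    then have "(\<lambda>k. x * ?t k) = (\<lambda>k. ?t k * x)" by simp
    then show ?thesis using sums_mult[OF s, of x] sums_mult2[OF s, of x] by (metis sums_unique2)
  qed
  with adj sq that show ?thesis by blast
qed

lemma unital_star_homD:
  assumes "unital_star_hom f"
  shows "f (x + y) = f x + f y" "f (c *\<^sub>C x) = c *\<^sub>C f x" "f (x * y) = f x * f y"
    "f (adj x) = adj (f x)" "f 1 = 1"
  using assms by (auto simp: unital_star_hom_def)

lemma unital_star_hom_zero: "unital_star_hom f \<Longrightarrow> f 0 = 0"
  using unital_star_homD(1)[of f 0 0] by simp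

lemma unital_star_hom_uminus: "unital_star_hom f \<Longrightarrow> f (- x) = - f x"
  using unital_star_homD(2)[of f "- 1" x] by simp

lemma unital_star_hom_diff: "unital_star_hom f \<Longrightarrow> f (x - y) = f x - f y"
  using unital_star_homD(1)[of f x "- y"] by (simp add: unital_star_hom_uminus)

lemma unital_star_hom_sum: "unital_star_hom f \<Longrightarrow> f (\<Sum>i\<in>A. g i) = (\<Sum>i\<in>A. f (g i))"
  by (induction A rule: infinite_finite_induct) (simp_all add: unital_star_homD unital_star_hom_zero)

text \<open>A self-adjoint \<open>a\<close> of norm below 1 is the real part of the unitary \<open>a + \<i> sqrt (1 - a\<^sup>2)\<close>,
  and *-homomorphisms map unitaries to unitaries. This replaces the usual spectral argument.\<close>

lemma unital_star_hom_self_adjoint_le: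
  fixes f :: "'a::unital_cstar_algebra \<Rightarrow> 'b::unital_cstar_algebra"
  assumes f: "unital_star_hom f" and a: "adj a = a" "norm a < 1"
  shows "norm (f a) \<le> 1"
proof -
  have "norm (a * a) < 1"
    using norm_mult_ineq[of a a] a mult_strict_mono'[of "norm a" 1 "norm a" 1] by simp
  then obtain b where b: "adj b = b" "b * b = 1 - a * a" "a * b = b * a"
    using contraction_sqrt[of "a * a"] a by (metis adj_mult mult.assoc)
  define u where "u = a + \<i> *\<^sub>C b"
  have au: "adj u = a - \<i> *\<^sub>C b" by (simp add: u_def adj_add adj_scaleC a b)
  have uu: "adj u * u = 1"
    using b unfolding au by (simp add: u_def algebra_simps mult_scaleC_left mult_scaleC_right scaleC_scaleC scaleC_one)
  have "2 *\<^sub>C a = u + adj u"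
    unfolding au by (simp add: u_def) (metis cvec.scale_left_distrib one_add_one scaleC_one)
  then have "2 *\<^sub>C f a = f u + adj (f u)" by (metis f unital_star_homD(1,2,4))
  then have "2 * norm (f a) \<le> norm (f u) + norm (adj (f u))"
    using norm_triangle_ineq[of "f u" "adj (f u)"] norm_scaleC[of 2 "f a"] by simp
  moreover have "norm (f u) \<le> 1"
    using uu f by (intro norm_isometry_le) (metis unital_star_homD(3,4,5))
  ultimately show ?thesis by (simp add: norm_adj)
qed

text \<open>Rescaling settles self-adjoint elements, and the C*-identity applied to
  \<open>adj x * x\<close> settles the rest.\<close>

lemma unital_star_hom_norm_le:
  fixes f :: "'a::unital_cstar_algebra \<Rightarrow> 'b::unital_cstar_algebra"
  assumes f: "unital_star_hom f"
  shows "norm (f x) \<le> norm x"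
proof -
  have sa: "norm (f a) \<le> norm a" if a: "adj a = a" for a
  proof (rule field_le_epsilon)
    fix e :: real assume "e > 0"
    \<comment> \<open>Dividing by \<open>r\<close> and not by \<open>norm a\<close> gives an element
      of norm strictly below 1, also when \<open>a\<close> is 0.\<close>
    define r where "r = norm a + e"
    have r: "r > 0" "norm a < r" using \<open>e > 0\<close> by (auto simp: r_def add_nonneg_pos)
    let ?a = "complex_of_real (inverse r) *\<^sub>C a"
    have "norm (f ?a) \<le> 1"
      using r a by (intro unital_star_hom_self_adjoint_le[OF f])
        (simp_all add: adj_scaleC norm_scaleC field_simps norm_divide)
    then have "norm (f a) \<le> r"
      using r by (simp add: unital_star_homD(2)[OF f] norm_scaleC field_simps norm_divide)
    then show "norm (f a) \<le> norm a + e" by (simp add: r_def)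
  qed
  have "(norm (f x))\<^sup>2 = norm (f (adj x * x))"
    by (simp add: unital_star_homD[OF f] norm_adj_mult_self)
  also have "\<dots> \<le> norm (adj x * x)" by (rule sa) (simp add: adj_mult adj_adj)
  finally show ?thesis unfolding norm_adj_mult_self by (rule power2_le_imp_le) simp
qed

lemma bounded_linear_unital_star_hom:
  assumes f: "unital_star_hom f"
  shows "bounded_linear f"
  by (rule bounded_linear_intro[where K = 1])
     (use f in \<open>simp_all add: unital_star_homD unital_star_hom_norm_le flip: scaleC_of_real\<close>)

lemma unital_star_hom_compose:
  "unital_star_hom f \<Longrightarrow> unital_star_hom g \<Longrightarrow> unital_star_hom (f \<circ> g)"
  by (simp add: unital_star_hom_def)

lemma unital_star_hom_inv:
  assumes f: "unital_star_hom f" and "bij f"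
  shows "unital_star_hom (inv_into UNIV f)"
proof -
  have *: "inv_into UNIV f y = x \<longleftrightarrow> y = f x" for x y
    using \<open>bij f\<close> by (metis bij_inv_eq_iff)
  have i: "f (inv_into UNIV f y) = y" for y using * by metis
  show ?thesis
    unfolding unital_star_hom_def by (simp add: * unital_star_homD[OF f] i)
qed

text \<open>The map y \<mapsto> sum_i V_i y_i V_i^* is multiplicative and respects adjoints, since
  the V_i are isometries with orthogonal ranges. The C*-identity can therefore be iterated inside
  the image of this map, and that brings the bound down from a sum of norms to their
  maximum.\<close>

lemma norm_orthogonal_sum_le:
  fixes y :: "'i \<Rightarrow> 'a::unital_cstar_algebra"
  assumes fin: "finite F"
    and orth: "\<And>i j. i \<in> F \<Longrightarrow> j \<in> F \<Longrightarrow> adj (V i) * V j = (if i = j then 1 else 0)"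
    and y: "\<And>i. i \<in> F \<Longrightarrow> norm (y i) \<le> C"
    and C: "0 \<le> C"
  shows "norm (\<Sum>i\<in>F. V i * y i * adj (V i)) \<le> C"
proof -
  let ?D = "\<lambda>y. \<Sum>i\<in>F. V i * y i * adj (V i)"
  have prod: "?D x * ?D z = ?D (\<lambda>i. x i * z i)" for x z
  proof -
    have "?D x * ?D z = (\<Sum>i\<in>F. \<Sum>j\<in>F. V i * x i * (adj (V i) * V j) * z j * adj (V j))"
      by (simp add: sum_product mult.assoc)
    also have "\<dots> = (\<Sum>i\<in>F. \<Sum>j\<in>F. if i = j then V i * x i * z j * adj (V j) else 0)"
      by (intro sum.cong) (auto simp: orth)
    finally show ?thesis using fin by (simp add: mult.assoc)
  qed
  have adj: "adj (?D x) = ?D (\<lambda>i. adj (x i))" for x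
    by (simp add: adj_sum adj_mult adj_adj mult.assoc)
  have crude: "norm (?D x) \<le> real (card F) * c" if "\<And>i. i \<in> F \<Longrightarrow> norm (x i) \<le> c" "0 \<le> c" for x c
  proof -
    have "norm (V i * x i * adj (V i)) \<le> c" if "i \<in> F" for i
    proof -
      have "norm (V i * x i * adj (V i)) \<le> norm (V i) * norm (x i) * norm (adj (V i))"
        by (meson mult_right_mono norm_ge_zero norm_mult_ineq order_trans)
      also have "\<dots> \<le> 1 * c * 1"
        using that \<open>\<And>i. i \<in> F \<Longrightarrow> norm (x i) \<le> c\<close> norm_isometry_le[of "V i"] orth[of i i] \<open>0 \<le> c\<close>
        by (intro mult_mono) (auto simp: norm_adj)
      finally show ?thesis by simp
    qed
    then show ?thesis by (rule sum_norm_bound)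
  qed
  \<comment> \<open>The crude bound loses a factor \<open>card F\<close>, which disappears on taking \<open>2\<^sup>m\<close>-th roots.\<close>
  have pow: "norm (?D x) ^ (2 ^ m) \<le> real (card F) * c ^ (2 ^ m)"
    if "\<And>i. i \<in> F \<Longrightarrow> norm (x i) \<le> c" "0 \<le> c" for x c m
    using that
  proof (induction m arbitrary: x c)
    case (Suc m)
    have "norm (?D x) ^ (2 ^ Suc m) = norm (adj (?D x) * ?D x) ^ (2 ^ m)"
      by (simp add: norm_adj_mult_self power_mult)
    also have "adj (?D x) * ?D x = ?D (\<lambda>i. adj (x i) * x i)" by (simp add: adj prod)
    also have "norm (\<dots>) ^ (2 ^ m) \<le> real (card F) * (c\<^sup>2) ^ (2 ^ m)"
      using Suc.prems by (intro Suc.IH) (auto simp: norm_adj_mult_self power_mono)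
    finally show ?case by (simp add: power_mult)
  qed (use crude in simp)
  show ?thesis
  proof (rule ccontr)
    assume "\<not> ?thesis"
    then have less: "C < norm (?D y)" by simp
    have p: "norm (?D y) ^ (2 ^ m) \<le> real (card F) * C ^ (2 ^ m)" for m using pow y C by blast
    show False
    proof (cases "C = 0")
      case True
      then show False using p[of 0] less by simp
    next
      case False
      define r where "r = norm (?D y) / C"
      have r: "1 < r" and rC: "norm (?D y) = r * C"
        using less C False by (simp_all add: r_def field_simps)
      \<comment> \<open>Estimates are at hand for the exponents 2^m only; since m < 2^m and r > 1,
        an \<open>m\<close> with r^m above \<open>card F\<close> is enough.\<close>
      obtain m where m: "real (card F) < r ^ m" using real_arch_pow[OF r] by blast
      have "r ^ (2 ^ m) * C ^ (2 ^ m) \<le> real (card F) * C ^ (2 ^ m)"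
        using p[of m] unfolding rC power_mult_distrib .
      then have "r ^ (2 ^ m) \<le> real (card F)"
        using C False by (simp add: mult_le_cancel_right)
      moreover have "r ^ m \<le> r ^ (2 ^ m)"
        using r by (intro power_increasing less_imp_le[OF less_exp]) simp
      ultimately show False using m by linarith
    qed
  qed
qed

section \<open>The Cuntz algebra is nonzero\<close>

text \<open>Finitely supported functions form an inner product space in which all sums are finite.
  Operators on it yield a C*-seminorm that satisfies the Cuntz relations and does not vanish at 1,
  so the universal algebra is nonzero.\<close>

definition finsupp :: "('x \<Rightarrow> complex) \<Rightarrow> bool"
  where "finsupp f \<longleftrightarrow> finite {w. f w \<noteq> 0}"

definition fs_inner :: "('x \<Rightarrow> complex) \<Rightarrow> ('x \<Rightarrow> complex) \<Rightarrow> complex"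
  where "fs_inner f g = (\<Sum>w | f w \<noteq> 0. f w * cnj (g w))"

definition fs_norm :: "('x \<Rightarrow> complex) \<Rightarrow> real"
  where "fs_norm f = L2_set (\<lambda>w. cmod (f w)) {w. f w \<noteq> 0}"

lemma fs_inner_superset:
  assumes "finite A" "{w. f w \<noteq> 0} \<subseteq> A"
  shows "fs_inner f g = (\<Sum>w\<in>A. f w * cnj (g w))"
  unfolding fs_inner_def by (rule sum.mono_neutral_left) (use assms in auto)

lemma fs_norm_superset:
  assumes "finite A" "{w. f w \<noteq> 0} \<subseteq> A"
  shows "fs_norm f = L2_set (\<lambda>w. cmod (f w)) A"
  unfolding fs_norm_def L2_set_def
  by (rule arg_cong[where f = sqrt], rule sum.mono_neutral_left) (use assms in auto)

lemma fs_norm_nonneg [simp]: "0 \<le> fs_norm f"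
  by (simp add: fs_norm_def)

lemma fs_inner_self: "fs_inner f f = complex_of_real ((fs_norm f)\<^sup>2)"
  by (simp add: fs_inner_def fs_norm_def L2_set_def sum_nonneg flip: complex_norm_square)

lemma fs_inner_le:
  assumes "finsupp f" "finsupp g"
  shows "cmod (fs_inner f g) \<le> fs_norm f * fs_norm g"
proof -
  let ?A = "{w. f w \<noteq> 0} \<union> {w. g w \<noteq> 0}"
  have fin: "finite ?A" using assms by (simp add: finsupp_def)
  then have "cmod (fs_inner f g) \<le> (\<Sum>w\<in>?A. \<bar>cmod (f w)\<bar> * \<bar>cmod (g w)\<bar>)"
    by (simp add: fs_inner_superset[of ?A] sum_norm_le norm_mult)
  also have "\<dots> \<le> L2_set (\<lambda>w. cmod (f w)) ?A * L2_set (\<lambda>w. cmod (g w)) ?A"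
    by (rule L2_set_mult_ineq)
  finally show ?thesis using fin by (simp add: fs_norm_superset[of ?A])
qed

lemma finsupp_add: "finsupp f \<Longrightarrow> finsupp g \<Longrightarrow> finsupp (\<lambda>w. f w + g w)"
  unfolding finsupp_def by (rule finite_subset[of _ "{w. f w \<noteq> 0} \<union> {w. g w \<noteq> 0}"]) auto

lemma finsupp_scale: "finsupp f \<Longrightarrow> finsupp (\<lambda>w. c * f w)"
  unfolding finsupp_def by (rule finite_subset[of _ "{w. f w \<noteq> 0}"]) auto

lemma fs_norm_add:
  assumes "finsupp f" "finsupp g"
  shows "fs_norm (\<lambda>w. f w + g w) \<le> fs_norm f + fs_norm g"
proof -
  let ?A = "{w. f w \<noteq> 0} \<union> {w. g w \<noteq> 0}"
  have fin: "finite ?A" using assms by (simp add: finsupp_def)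
  have "fs_norm (\<lambda>w. f w + g w) = L2_set (\<lambda>w. cmod (f w + g w)) ?A"
    using fin by (intro fs_norm_superset) auto
  also have "\<dots> \<le> L2_set (\<lambda>w. cmod (f w) + cmod (g w)) ?A"
    by (rule L2_set_mono) (auto intro: norm_triangle_ineq)
  also have "\<dots> \<le> L2_set (\<lambda>w. cmod (f w)) ?A + L2_set (\<lambda>w. cmod (g w)) ?A"
    by (rule L2_set_triangle_ineq)
  finally show ?thesis using fin by (simp add: fs_norm_superset[of ?A])
qed

lemma fs_norm_scale: "fs_norm (\<lambda>w. c * f w) = cmod c * fs_norm f"
  by (cases "c = 0") (simp_all add: fs_norm_def norm_mult L2_set_right_distrib)

text \<open>The generator \<open>i\<close> acts on functions on the Cantor space by prefixing \<open>i\<close> to the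
  point masses, its adjoint by removing it.\<close>

fun letter_act :: "'n \<times> bool \<Rightarrow> ((nat \<Rightarrow> 'n) \<Rightarrow> complex) \<Rightarrow> (nat \<Rightarrow> 'n) \<Rightarrow> complex"
  where "letter_act (i, False) f = (\<lambda>w. if w 0 = i then f (\<lambda>k. w (Suc k)) else 0)"
  | "letter_act (i, True) f = (\<lambda>w. f (case_nat i w))"

lemma case_nat_eta: "case_nat (w 0) (\<lambda>k. w (Suc k)) = w"
  by (rule ext) (simp split: nat.split)

lemma inj_case_nat: "inj (case_nat i)"
proof (rule injI)
  fix v w :: "nat \<Rightarrow> 'a" assume "case_nat i v = case_nat i w"
  then have "case_nat i v (Suc k) = case_nat i w (Suc k)" for k by simp
  then show "v = w" by auto
qed

lemma letter_act_support:
  "{w. letter_act (i, False) f w \<noteq> 0} = case_nat i ` {w. f w \<noteq> 0}"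
proof (intro Set.set_eqI iffI)
  fix w assume "w \<in> {w. letter_act (i, False) f w \<noteq> 0}"
  then have "w 0 = i" "f (\<lambda>k. w (Suc k)) \<noteq> 0" by (auto split: if_splits)
  then show "w \<in> case_nat i ` {w. f w \<noteq> 0}" using case_nat_eta[of w] by force
qed auto

lemma finsupp_letter_act:
  assumes "finsupp f"
  shows "finsupp (letter_act a f)"
proof (cases a)
  case (Pair i b)
  have "finite (case_nat i -` {w. f w \<noteq> 0})"
    using assms inj_case_nat[of i] by (intro finite_vimageI) (auto simp: finsupp_def)
  then show ?thesis
    using Pair assms
    by (cases b) (simp_all add: finsupp_def vimage_def letter_act_support del: letter_act.simps(1))
qed

lemma fs_inner_prefix:
  assumes "finsupp f"
  shows "fs_inner (letter_act (i, False) f) g = fs_inner f (letter_act (i, True) g)"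
  unfolding fs_inner_def letter_act_support
  by (subst sum.reindex) (auto intro: inj_on_subset[OF inj_case_nat])

lemma fs_inner_commute:
  assumes "finsupp f" "finsupp g"
  shows "fs_inner f g = cnj (fs_inner g f)"
proof -
  let ?A = "{w. f w \<noteq> 0} \<union> {w. g w \<noteq> 0}"
  have fin: "finite ?A" using assms by (simp add: finsupp_def)
  then show ?thesis by (simp add: fs_inner_superset[of ?A] mult.commute)
qed

lemma fs_inner_letter:
  assumes "finsupp f" "finsupp g"
  shows "fs_inner (letter_act (i, b) f) g = fs_inner f (letter_act (i, \<not> b) g)"
proof (cases b)
  case True
  have "fs_inner (letter_act (i, True) f) g = cnj (fs_inner g (letter_act (i, True) f))"
    by (rule fs_inner_commute) (use assms finsupp_letter_act in blast)+
  also have "\<dots> = cnj (fs_inner (letter_act (i, False) g) f)"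
    using assms by (simp add: fs_inner_prefix del: letter_act.simps)
  also have "\<dots> = fs_inner f (letter_act (i, False) g)"
    by (rule fs_inner_commute[symmetric]) (use assms finsupp_letter_act in blast)+
  finally show ?thesis using True by simp
qed (use assms in \<open>simp add: fs_inner_prefix del: letter_act.simps\<close>)

lemma fs_norm_letter:
  assumes "finsupp f"
  shows "fs_norm (letter_act a f) \<le> fs_norm f"
proof (cases a)
  case (Pair i b)
  show ?thesis
  proof (cases b)
    case True
    let ?A = "{w. f (case_nat i w) \<noteq> 0}"
    have "(\<Sum>w\<in>?A. (cmod (f (case_nat i w)))\<^sup>2) = (\<Sum>w\<in>case_nat i ` ?A. (cmod (f w))\<^sup>2)"
      by (subst sum.reindex) (auto intro: inj_on_subset[OF inj_case_nat])
    also have "\<dots> \<le> (\<Sum>w | f w \<noteq> 0. (cmod (f w))\<^sup>2)"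
      using assms by (intro sum_mono2) (auto simp: finsupp_def)
    finally show ?thesis using Pair True by (simp add: fs_norm_def L2_set_def)
  next
    case False
    have "(\<Sum>w\<in>case_nat i ` {w. f w \<noteq> 0}. (cmod (letter_act (i, False) f w))\<^sup>2) =
        (\<Sum>w | f w \<noteq> 0. (cmod (f w))\<^sup>2)"
      by (subst sum.reindex) (auto intro: inj_on_subset[OF inj_case_nat])
    then show ?thesis
      using Pair False
      by (simp add: fs_norm_def L2_set_def letter_act_support del: letter_act.simps)
  qed
qed

lemma letter_act_linear:
  "letter_act a (\<lambda>w. c * f w + d * g w) = (\<lambda>w. c * letter_act a f w + d * letter_act a g w)"
  by (cases "(a, f)" rule: letter_act.cases) (auto simp: fun_eq_iff)

definition word_act :: "('n \<times> bool) list \<Rightarrow> ((nat \<Rightarrow> 'n) \<Rightarrow> complex) \<Rightarrow> (nat \<Rightarrow> 'n) \<Rightarrow> complex"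
  where "word_act l f = foldr letter_act l f"

lemma word_act_simps [simp]:
  "word_act [] f = f" "word_act (a # l) f = letter_act a (word_act l f)"
  "word_act (l @ m) f = word_act l (word_act m f)"
  by (simp_all add: word_act_def)

lemma finsupp_word_act: "finsupp f \<Longrightarrow> finsupp (word_act l f)"
  by (induction l) (simp_all add: finsupp_letter_act)

lemma fs_norm_word: "finsupp f \<Longrightarrow> fs_norm (word_act l f) \<le> fs_norm f"
  by (induction l) (auto intro: order_trans[OF fs_norm_letter] finsupp_word_act)

lemma word_act_linear:
  "word_act l (\<lambda>w. c * f w + d * g w) = (\<lambda>w. c * word_act l f w + d * word_act l g w)"
  by (induction l arbitrary: f g) (simp_all add: letter_act_linear)

lemma fs_inner_word:
  "finsupp f \<Longrightarrow> finsupp g \<Longrightarrow>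
    fs_inner (word_act l f) g = fs_inner f (word_act (rev (map (\<lambda>(i, b). (i, \<not> b)) l)) g)"
  by (induction l arbitrary: g)
     (auto simp: fs_inner_letter finsupp_word_act finsupp_letter_act)

definition cantor_rep :: "'n free_star \<Rightarrow> ((nat \<Rightarrow> 'n) \<Rightarrow> complex) \<Rightarrow> (nat \<Rightarrow> 'n) \<Rightarrow> complex"
  where "cantor_rep x f = (\<lambda>w. extend_linear (\<lambda>u c. c * word_act (letters u) f w) x)"

lemma cantor_rep_single:
  "cantor_rep (Poly_Mapping.single u c) f = (\<lambda>w. c * word_act (letters u) f w)"
  by (simp add: cantor_rep_def extend_linear_single)

lemma cantor_rep_add: "cantor_rep (x + y) f = (\<lambda>w. cantor_rep x f w + cantor_rep y f w)"
  by (simp add: cantor_rep_def extend_linear_add distrib_right)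

lemma cantor_rep_one: "cantor_rep 1 f = f"
  using cantor_rep_single[of 0 1 f] by (simp, simp add: zero_star_word_def)

lemma finsupp_cantor_rep: "finsupp f \<Longrightarrow> finsupp (cantor_rep x f)"
  by (induction x rule: free_star_induct)
     (simp_all add: cantor_rep_single cantor_rep_add finsupp_add finsupp_scale finsupp_word_act)

lemma cantor_rep_mult: "cantor_rep (x * y) f = cantor_rep x (cantor_rep y f)"
proof (induction x rule: free_star_induct)
  case (single u c)
  show ?case
  proof (induction y rule: free_star_induct)
    case (single v d)
    show ?case
      using word_act_linear[of "letters u" d "word_act (letters v) f" 0 f]
      by (simp add: mult_single cantor_rep_single plus_star_word_def mult.assoc)
  next
    case (add x y)
    then show ?case
      using word_act_linear[of "letters u" 1 "cantor_rep x f" 1 "cantor_rep y f"]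
      by (simp add: distrib_left cantor_rep_add cantor_rep_single)
  qed
qed (simp add: distrib_right cantor_rep_add)

lemma fs_inner_scale_left: "fs_inner (\<lambda>w. c * f w) g = c * fs_inner f g"
  by (cases "c = 0") (simp_all add: fs_inner_def sum_distrib_left mult.assoc)

lemma fs_inner_scale_right: "fs_inner f (\<lambda>w. c * g w) = cnj c * fs_inner f g"
  by (simp add: fs_inner_def sum_distrib_left mult_ac)

lemma fs_inner_add_left:
  assumes "finsupp f" "finsupp g"
  shows "fs_inner (\<lambda>w. f w + g w) h = fs_inner f h + fs_inner g h"
proof -
  let ?A = "{w. f w \<noteq> 0} \<union> {w. g w \<noteq> 0}"
  have fin: "finite ?A" using assms by (simp add: finsupp_def)
  have "fs_inner (\<lambda>w. f w + g w) h = (\<Sum>w\<in>?A. (f w + g w) * cnj (h w))"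
    using fin by (intro fs_inner_superset) auto
  then show ?thesis
    using fin by (simp add: fs_inner_superset[of ?A] sum.distrib distrib_right)
qed

lemma fs_inner_add_right: "fs_inner f (\<lambda>w. g w + h w) = fs_inner f g + fs_inner f h"
  by (simp add: fs_inner_def sum.distrib algebra_simps)

lemma fs_inner_cantor_rep:
  assumes "finsupp f" "finsupp g"
  shows "fs_inner (cantor_rep x f) g = fs_inner f (cantor_rep (free_adj x) g)"
proof (induction x rule: free_star_induct)
  case (single u c)
  then show ?case
    using assms by (simp add: cantor_rep_single fs_inner_scale_left fs_inner_scale_right
        fs_inner_word word_adj_def)
next
  case (add x y)
  then show ?case
    using assms by (simp add: cantor_rep_add free_adj_add fs_inner_add_left fs_inner_add_right
        finsupp_cantor_rep)
qed

section \<open>The operator norm of the representation as a C*-seminorm\<close>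

definition rep_bounds :: "'n free_star \<Rightarrow> real set"
  where "rep_bounds x =
    {C. 0 \<le> C \<and> (\<forall>f. finsupp f \<longrightarrow> fs_norm (cantor_rep x f) \<le> C * fs_norm f)}"

definition rep_norm :: "'n free_star \<Rightarrow> real"
  where "rep_norm x = Inf (rep_bounds x)"

lemma rep_bounds_nonempty: "rep_bounds x \<noteq> {}"
proof (induction x rule: free_star_induct)
  case (single u c)
  have "cmod c \<in> rep_bounds (Poly_Mapping.single u c)"
    by (auto simp: rep_bounds_def cantor_rep_single fs_norm_scale fs_norm_word mult_left_mono)
  then show ?case by blast
next
  case (add x y)
  then obtain C D where "C \<in> rep_bounds x" "D \<in> rep_bounds y" by blast
  then have "C + D \<in> rep_bounds (x + y)"
    by (auto simp: rep_bounds_def cantor_rep_add distrib_right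
        intro!: order_trans[OF fs_norm_add] finsupp_cantor_rep add_mono)
  then show ?case by blast
qed

lemma rep_norm_least: "C \<in> rep_bounds x \<Longrightarrow> rep_norm x \<le> C"
  unfolding rep_norm_def by (rule cInf_lower) (auto simp: rep_bounds_def intro: bdd_belowI[of _ 0])

lemma rep_norm_nonneg: "0 \<le> rep_norm x"
  unfolding rep_norm_def
  by (rule cInf_greatest[OF rep_bounds_nonempty]) (auto simp: rep_bounds_def)

lemma rep_norm_bound:
  assumes "finsupp f"
  shows "fs_norm (cantor_rep x f) \<le> rep_norm x * fs_norm f"
proof (cases "fs_norm f = 0")
  case True
  obtain C where "C \<in> rep_bounds x" using rep_bounds_nonempty by blast
  then show ?thesis using True assms by (force simp: rep_bounds_def)
next
  case False
  then have pos: "0 < fs_norm f" using fs_norm_nonneg[of f] by linarith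
  have "fs_norm (cantor_rep x f) / fs_norm f \<le> rep_norm x"
    unfolding rep_norm_def
    by (rule cInf_greatest[OF rep_bounds_nonempty]) (use assms pos in \<open>auto simp: rep_bounds_def field_simps\<close>)
  then show ?thesis using pos by (simp add: field_simps)
qed

lemma rep_norm_leI:
  assumes "0 \<le> C" "\<And>f. finsupp f \<Longrightarrow> fs_norm (cantor_rep x f) \<le> C * fs_norm f"
  shows "rep_norm x \<le> C"
  using assms by (intro rep_norm_least) (simp add: rep_bounds_def)

lemma rep_norm_mult: "rep_norm (x * y) \<le> rep_norm x * rep_norm y"
proof (rule rep_norm_leI)
  fix f :: "(nat \<Rightarrow> 'a) \<Rightarrow> complex" assume f: "finsupp f"
  have "fs_norm (cantor_rep x (cantor_rep y f)) \<le> rep_norm x * fs_norm (cantor_rep y f)"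
    using f by (intro rep_norm_bound finsupp_cantor_rep)
  also have "\<dots> \<le> rep_norm x * (rep_norm y * fs_norm f)"
    using f by (intro mult_left_mono rep_norm_bound rep_norm_nonneg)
  finally show "fs_norm (cantor_rep (x * y) f) \<le> rep_norm x * rep_norm y * fs_norm f"
    by (simp add: cantor_rep_mult mult.assoc)
qed (simp add: rep_norm_nonneg)

text \<open>Moving \<open>x\<close> across the inner product turns the left side into <f, x^* x f>,
  where Cauchy-Schwarz applies. This supplies the half of the C*-identity that submultiplicativity
  does not give.\<close>

lemma fs_norm_cantor_rep_square:
  assumes "finsupp f"
  shows "(fs_norm (cantor_rep x f))\<^sup>2 \<le> rep_norm (free_adj x * x) * (fs_norm f)\<^sup>2"
proof -
  have "(fs_norm (cantor_rep x f))\<^sup>2 = cmod (fs_inner (cantor_rep x f) (cantor_rep x f))"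
    by (simp add: fs_inner_self norm_power)
  also have "\<dots> = cmod (fs_inner f (cantor_rep (free_adj x * x) f))"
    using assms by (simp add: fs_inner_cantor_rep cantor_rep_mult finsupp_cantor_rep)
  also have "\<dots> \<le> fs_norm f * fs_norm (cantor_rep (free_adj x * x) f)"
    using assms by (intro fs_inner_le finsupp_cantor_rep)
  also have "\<dots> \<le> fs_norm f * (rep_norm (free_adj x * x) * fs_norm f)"
    using assms by (intro mult_left_mono rep_norm_bound) auto
  finally show ?thesis by (simp add: power2_eq_square mult_ac)
qed

lemma rep_norm_square_le: "(rep_norm x)\<^sup>2 \<le> rep_norm (free_adj x * x)"
proof -
  have "rep_norm x \<le> sqrt (rep_norm (free_adj x * x))"
  proof (rule rep_norm_leI)
    fix f :: "(nat \<Rightarrow> 'a) \<Rightarrow> complex" assume "finsupp f"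
    from real_le_rsqrt[OF fs_norm_cantor_rep_square[OF this, of x]]
    show "fs_norm (cantor_rep x f) \<le> sqrt (rep_norm (free_adj x * x)) * fs_norm f"
      by (simp add: real_sqrt_mult)
  qed (simp add: rep_norm_nonneg)
  then have "(rep_norm x)\<^sup>2 \<le> (sqrt (rep_norm (free_adj x * x)))\<^sup>2"
    by (intro power_mono rep_norm_nonneg)
  then show ?thesis by (simp add: rep_norm_nonneg)
qed

lemma rep_norm_adj_le: "rep_norm x \<le> rep_norm (free_adj x)"
proof (cases "rep_norm x = 0")
  case False
  then have "0 < rep_norm x" using rep_norm_nonneg[of x] by linarith
  moreover have "rep_norm x * rep_norm x \<le> rep_norm (free_adj x) * rep_norm x"
    using rep_norm_square_le[of x] rep_norm_mult[of "free_adj x" x] by (simp add: power2_eq_square)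
  ultimately show ?thesis by simp
qed (simp add: rep_norm_nonneg)

lemma cantor_rep_scale: "cantor_rep (free_scale c x) f = (\<lambda>w. c * cantor_rep x f w)"
  by (simp add: free_scale_def cantor_rep_mult cantor_rep_single zero_star_word_def)

lemma cstar_seminorm_rep_norm: "cstar_seminorm (rep_norm :: 'n free_star \<Rightarrow> real)"
proof
  fix x y :: "'n free_star" and c :: complex
  show "rep_norm (x + y) \<le> rep_norm x + rep_norm y"
  proof (rule rep_norm_leI)
    fix f :: "(nat \<Rightarrow> 'n) \<Rightarrow> complex" assume f: "finsupp f"
    have "fs_norm (cantor_rep (x + y) f) \<le> fs_norm (cantor_rep x f) + fs_norm (cantor_rep y f)"
      unfolding cantor_rep_add using f by (intro fs_norm_add finsupp_cantor_rep)
    then show "fs_norm (cantor_rep (x + y) f) \<le> (rep_norm x + rep_norm y) * fs_norm f"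
      using rep_norm_bound[OF f, of x] rep_norm_bound[OF f, of y] by (simp add: distrib_right)
  qed (simp add: rep_norm_nonneg)
  have sc: "rep_norm (free_scale c x) \<le> cmod c * rep_norm x" for c and x :: "'n free_star"
    by (rule rep_norm_leI)
       (auto simp: rep_norm_nonneg cantor_rep_scale fs_norm_scale mult.assoc intro!: mult_left_mono rep_norm_bound)
  have "cmod c * rep_norm x \<le> rep_norm (free_scale c x)"
  proof (cases "c = 0")
    case False
    have "rep_norm x \<le> cmod (inverse c) * rep_norm (free_scale c x)"
      using sc[of "inverse c" "free_scale c x"] False by (simp add: free_scale_free_scale)
    then show ?thesis using False by (simp add: norm_inverse field_simps norm_divide)
  qed (simp add: rep_norm_nonneg)
  with sc show "rep_norm (free_scale c x) = cmod c * rep_norm x" by (rule antisym)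
  show "rep_norm (x * y) \<le> rep_norm x * rep_norm y" by (rule rep_norm_mult)
  have "rep_norm (free_adj x) = rep_norm x"
    using rep_norm_adj_le[of x] rep_norm_adj_le[of "free_adj x"] by simp
  then have "rep_norm (free_adj x * x) \<le> (rep_norm x)\<^sup>2"
    using rep_norm_mult[of "free_adj x" x] by (simp add: power2_eq_square)
  then show "rep_norm (free_adj x * x) = (rep_norm x)\<^sup>2"
    using rep_norm_square_le by (rule antisym)
qed

lemma cuntz_seminorm_rep_norm: "cuntz_seminorm (rep_norm :: 'n::finite free_star \<Rightarrow> real)"
proof -
  have z: "rep_norm (x - 1) = 0" if "\<And>f. cantor_rep x f = f" for x :: "'n free_star"
  proof (rule antisym)
    have "cantor_rep (x - 1) f = (\<lambda>_. 0)" for f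
    proof -
      have "cantor_rep x f = (\<lambda>w. cantor_rep (x - 1) f w + f w)"
        using cantor_rep_add[of "x - 1" 1 f] by (simp add: cantor_rep_one)
      then show ?thesis using that[of f] by (auto simp: fun_eq_iff)
    qed
    then show "rep_norm (x - 1) \<le> 0" by (intro rep_norm_leI) (auto simp: fs_norm_def)
  qed (rule rep_norm_nonneg)
  have gen: "cantor_rep (free_gen i) f = letter_act (i, False) f"
    "cantor_rep (free_adj (free_gen i)) f = letter_act (i, True) f" for i :: 'n and f
    by (simp_all add: free_gen_def cantor_rep_single word_adj_def)
  have "rep_norm (free_adj (free_gen i) * free_gen i - 1) = 0" for i :: 'n
    by (rule z) (simp add: cantor_rep_mult gen)
  moreover have "rep_norm ((\<Sum>i\<in>UNIV. free_gen i * free_adj (free_gen i)) - 1 :: 'n free_star) = 0"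
  proof (rule z)
    fix f :: "(nat \<Rightarrow> 'n) \<Rightarrow> complex"
    \<comment> \<open>S_i S_i^* acts as restriction to the sequences with first letter
      \<open>i\<close>. The subset \<open>A\<close> makes an induction possible.\<close>
    have "cantor_rep (\<Sum>i\<in>A. free_gen i * free_adj (free_gen i)) f =
        (\<lambda>w. \<Sum>i\<in>A. if w 0 = i then f w else 0)" for A :: "'n set"
      using finite[of A]
    proof (induction A)
      case (insert i A)
      have "f (case_nat i (\<lambda>k. w (Suc k))) = f w" if "w 0 = i" for w
        using case_nat_eta[of w] that by simp
      with insert show ?case by (auto simp: cantor_rep_add cantor_rep_mult gen fun_eq_iff)
    qed (simp add: cantor_rep_def)
    then show "cantor_rep (\<Sum>i\<in>UNIV. free_gen i * free_adj (free_gen i)) f = f" by simp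
  qed
  ultimately show ?thesis using cstar_seminorm_rep_norm by (simp add: cuntz_seminorm_def)
qed

lemma cuntz_one_neq_zero: "(1 :: 'n::finite cuntz) \<noteq> 0"
proof
  assume "(1 :: 'n cuntz) = 0"
  then have "rep_norm (1 :: 'n free_star) \<le> 0"
    using cuntz_seminorm_le[OF cuntz_seminorm_rep_norm, of "1 :: 'n free_star"]
    by (simp flip: norm_of_free)
  \<comment> \<open>A point mass: \<open>undefined\<close> stands for an arbitrary letter, the
    constant sequence for an arbitrary point of the Cantor space.\<close>
  moreover define f :: "(nat \<Rightarrow> 'n) \<Rightarrow> complex"
    where "f = (\<lambda>w. if w = (\<lambda>_. undefined) then 1 else 0)"
  have s: "{w. f w \<noteq> 0} = {\<lambda>_. undefined}" by (auto simp: f_def)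
  have "finsupp f" "fs_norm f = 1" by (simp_all add: finsupp_def fs_norm_def s L2_set_def f_def)
  ultimately show False using rep_norm_bound[of f 1] by (simp add: cantor_rep_one)
qed

lemma norm_cuntz_one [simp]: "norm (1 :: 'n::finite cuntz) = 1"
proof -
  have "norm (1 :: 'n cuntz) = (norm (1 :: 'n cuntz))\<^sup>2"
    using norm_adj_mult_self[of "1 :: 'n cuntz"] by (simp add: adj_one)
  then show ?thesis using cuntz_one_neq_zero[where 'n = 'n] by (simp add: power2_eq_square)
qed

section \<open>Orthogonality of the generators\<close>

text \<open>By commutation z = x + i y satisfies z^* z = x^2 + y^2, and the real part x of z has
  norm at most that of z. This plays the role of monotonicity of the norm on positive
  elements.\<close>

lemma norm_commuting_square_le:
  fixes x y :: "'a::unital_cstar_algebra"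
  assumes "adj x = x" "adj y = y" "x * y = y * x"
  shows "(norm x)\<^sup>2 \<le> norm (x * x + y * y)"
proof -
  define z where "z = x + \<i> *\<^sub>C y"
  have az: "adj z = x - \<i> *\<^sub>C y" by (simp add: z_def adj_add adj_scaleC assms)
  have zz: "adj z * z = x * x + y * y"
    using assms unfolding az
    by (simp add: z_def algebra_simps mult_scaleC_left mult_scaleC_right scaleC_scaleC scaleC_one)
  have "2 *\<^sub>C x = z + adj z"
    unfolding az by (simp add: z_def) (metis cvec.scale_left_distrib one_add_one scaleC_one)
  then have "2 * norm x \<le> norm z + norm (adj z)"
    using norm_triangle_ineq[of z "adj z"] norm_scaleC[of 2 x] by simp
  then have "norm x \<le> norm z" by (simp add: norm_adj)
  then have "(norm x)\<^sup>2 \<le> (norm z)\<^sup>2" by (rule power_mono) simp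
  then show ?thesis by (simp add: norm_adj_mult_self flip: zz)
qed

text \<open>If \<open>norm (1 + h\<^sup>2) \<le> 1\<close> then \<open>(1 + h\<^sup>2)\<^sup>2 = 1 + k\<^sup>2\<close> where \<open>k = h sqrt (2 + h\<^sup>2)\<close> has the same
  property and \<open>norm k\<^sup>2 \<ge> 2 norm h\<^sup>2\<close>. Iterating this contradicts \<open>norm h \<le> 1\<close> unless \<open>h = 0\<close>.\<close>

lemma self_adjoint_eq_zero:
  fixes h :: "'a::unital_cstar_algebra"
  assumes h: "adj h = h" "norm (1 + h * h) \<le> 1"
  shows "h = 0"
proof -
  have le: "(norm k)\<^sup>2 \<le> 1" if "adj k = k" "norm (1 + k * k) \<le> 1" for k :: 'a
    using norm_commuting_square_le[of k 1] that by (simp add: adj_one add.commute)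
  have step: "\<exists>k :: 'a. adj k = k \<and> norm (1 + k * k) \<le> 1 \<and> 2 * (norm h)\<^sup>2 \<le> (norm k)\<^sup>2"
    if h: "adj h = h" "norm (1 + h * h) \<le> 1" for h :: 'a
  proof -
    \<comment> \<open>Here \<open>b\<close> becomes sqrt (1 + h^2 / 2), so that \<open>k\<close> is
      h sqrt (2 + h^2); the halving keeps the norm of \<open>?a\<close> at 1/2 or less, within reach
      of \<open>contraction_sqrt\<close>.\<close>
    let ?a = "- ((1/2) *\<^sub>R (h * h))"
    have ah: "adj (h * h) = h * h" using h by (simp add: adj_mult)
    have nh: "norm (h * h) \<le> 1"
      using le[OF h] norm_adj_mult_self[of h] h by simp
    have "adj ?a = ?a"
      by (simp add: adj_uminus linear_simps(5)[OF bounded_linear_adj] ah)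
    moreover have "norm ?a < 1" using nh by simp
    ultimately obtain b where b: "adj b = b" "b * b = 1 - ?a"
      "\<And>x. x * ?a = ?a * x \<Longrightarrow> x * b = b * x" using contraction_sqrt[of ?a] by blast
    have hb: "h * b = b * h" by (rule b(3)) (simp add: mult.assoc)
    define k where "k = sqrt 2 *\<^sub>R (h * b)"
    have kk: "k * k = 2 *\<^sub>R (h * h) + (h * h) * (h * h)"
    proof -
      have "k * k = 2 *\<^sub>R (h * (b * h) * b)" by (simp add: k_def mult.assoc)
      also have "h * (b * h) * b = h * h * (b * b)" by (simp add: mult.assoc flip: hb)
      also have "2 *\<^sub>R (h * h * (b * b)) = 2 *\<^sub>R (h * h) + (h * h) * (h * h)"
        unfolding b(2) by (simp add: distrib_left scaleR_add_right mult.assoc)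
      finally show ?thesis .
    qed
    have ak: "adj k = k"
      by (simp add: k_def linear_simps(5)[OF bounded_linear_adj] adj_mult h b hb)
    have "1 + k * k = (1 + h * h) * (1 + h * h)"
      unfolding kk by (simp add: algebra_simps scaleR_2)
    then have "norm (1 + k * k) \<le> norm (1 + h * h) * norm (1 + h * h)"
      by (simp add: norm_mult_ineq)
    also have "\<dots> \<le> 1" using h by (simp add: mult_le_one)
    finally have k1: "norm (1 + k * k) \<le> 1" .
    \<comment> \<open>k^2 is the sum of the squares of the commuting elements \<open>?s\<close> and
      h^2, so the norm of \<open>k\<close> is at least that of \<open>?s\<close>.\<close>
    let ?s = "sqrt 2 *\<^sub>R h"
    have "(norm ?s)\<^sup>2 \<le> norm (?s * ?s + (h * h) * (h * h))"
      by (rule norm_commuting_square_le)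
         (simp_all add: linear_simps(5)[OF bounded_linear_adj] h ah mult.assoc)
    also have "?s * ?s + (h * h) * (h * h) = k * k" by (simp add: kk)
    also have "norm (k * k) = (norm k)\<^sup>2" using norm_adj_mult_self[of k] ak by simp
    finally have "2 * (norm h)\<^sup>2 \<le> (norm k)\<^sup>2" by (simp add: power_mult_distrib)
    with ak k1 show ?thesis by blast
  qed
  have "\<exists>k :: 'a. adj k = k \<and> norm (1 + k * k) \<le> 1 \<and> 2 ^ m * (norm h)\<^sup>2 \<le> (norm k)\<^sup>2" for m
  proof (induction m)
    case 0
    then show ?case using h by auto
  next
    case (Suc m)
    then obtain k :: 'a where k: "adj k = k" "norm (1 + k * k) \<le> 1" "2 ^ m * (norm h)\<^sup>2 \<le> (norm k)\<^sup>2"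
      by blast
    from step[OF k(1,2)] obtain l :: 'a where "adj l = l" "norm (1 + l * l) \<le> 1" "2 * (norm k)\<^sup>2 \<le> (norm l)\<^sup>2"
      by blast
    then show ?case using k(3) by (intro exI[of _ l]) auto
  qed
  then have bound: "2 ^ m * (norm h)\<^sup>2 \<le> 1" for m using le order_trans by blast
  show ?thesis
  proof (rule ccontr)
    assume "h \<noteq> 0"
    then obtain m where "1 / (norm h)\<^sup>2 < 2 ^ m" using real_arch_pow[of 2 "1 / (norm h)\<^sup>2"] by auto
    then show False using bound[of m] \<open>h \<noteq> 0\<close> by (simp add: field_simps)
  qed
qed

lemma norm_complement_projection_le:
  fixes p :: "'a::unital_cstar_algebra"
  assumes "adj p = p" "p * p = p"
  shows "norm (1 - p) \<le> 1"
proof -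
  have "adj (1 - p) * (1 - p) = 1 - p"
    by (simp add: adj_diff adj_one assms algebra_simps)
  then have "norm (1 - p) = (norm (1 - p))\<^sup>2" using norm_adj_mult_self[of "1 - p"] by simp
  then have "norm (1 - p) = 0 \<or> norm (1 - p) = 1" by (simp add: power2_eq_square)
  then show ?thesis by auto
qed

text \<open>Compressing sum_k S_k S_k^* = 1 by S_j gives 1, and the term k = j alone contributes 1;
  so the a_k with k \<noteq> j sum to 0. Being positive they all vanish. Positivity enters in the
  form norm (1 - a_k) \<le> 1, which yields norm (1 + h) \<le> 1 and norm (1 - h) \<le> 1 for a
  multiple h of a_i.\<close>

theorem cuntz_gen_orthogonal:
  fixes i j :: "'n::finite"
  shows "adj (cuntz_gen i) * cuntz_gen j = (if i = j then 1 else 0)"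
proof (cases "i = j")
  case False
  define a where "a k = adj (cuntz_gen j) * (cuntz_gen k * adj (cuntz_gen k)) * cuntz_gen j" for k :: 'n
  define m where "m = card (UNIV - {i, j})"
  have "(\<Sum>k\<in>UNIV. a k) = adj (cuntz_gen j) * (\<Sum>k\<in>UNIV. cuntz_gen k * adj (cuntz_gen k)) * cuntz_gen j"
    by (simp add: a_def sum_distrib_left sum_distrib_right)
  then have "(\<Sum>k\<in>UNIV. a k) = 1" by (simp add: cuntz_gen_sum cuntz_gen_isometry)
  moreover have "a j = 1"
    by (simp add: a_def mult.assoc cuntz_gen_isometry)
  moreover have "(\<Sum>k\<in>UNIV. a k) = a i + a j + (\<Sum>k\<in>UNIV - {i, j}. a k)"
    using False by (subst sum.subset_diff[of "{i, j}"]) auto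
  ultimately have s: "a i = - (\<Sum>k\<in>UNIV - {i, j}. a k)" by (simp add: algebra_simps eq_neg_iff_add_eq_0)
  have aa: "adj (a k) = a k" for k by (simp add: a_def adj_mult adj_adj mult.assoc)
  have n1: "norm (1 - a k) \<le> 1" for k
  proof -
    let ?p = "cuntz_gen k * adj (cuntz_gen k)"
    have "?p * ?p = cuntz_gen k * (adj (cuntz_gen k) * cuntz_gen k) * adj (cuntz_gen k)"
      by (simp only: mult.assoc)
    then have p: "norm (1 - ?p) \<le> 1"
      by (intro norm_complement_projection_le) (simp_all add: adj_mult adj_adj cuntz_gen_isometry)
    have g: "norm (cuntz_gen j) \<le> 1" "norm (adj (cuntz_gen j)) \<le> 1"
      using norm_isometry_le[OF cuntz_gen_isometry[of j]] by (simp_all add: norm_adj)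
    have "1 - a k = adj (cuntz_gen j) * (1 - ?p) * cuntz_gen j"
      by (simp add: a_def algebra_simps cuntz_gen_isometry)
    also have "norm \<dots> \<le> norm (adj (cuntz_gen j)) * norm (1 - ?p) * norm (cuntz_gen j)"
      by (rule norm_mult3_le)
    also have "\<dots> \<le> 1" using p g by (simp add: mult_le_one)
    finally show ?thesis .
  qed
  \<comment> \<open>With the divisor m + 1, 1 + h is the average of 1 and the m elements 1 - a_k for
    k outside {i, j}, while 1 - h is the average of 1 - a_i and m copies of 1.\<close>
  define h where "h = (1 / (real m + 1)) *\<^sub>R a i"
  have ah: "adj h = h" by (simp add: h_def linear_simps(5)[OF bounded_linear_adj] aa)
  have norm_scale: "(real m + 1) * norm x = norm ((real m + 1) *\<^sub>R x)" for x :: "'n cuntz" by simp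
  have "(real m + 1) *\<^sub>R (1 + h) = (real m + 1) *\<^sub>R 1 + a i"
    by (simp add: h_def scaleR_add_right)
  also have "\<dots> = (\<Sum>k\<in>UNIV - {i, j}. 1 - a k) + 1"
    unfolding s by (simp add: sum_subtractf m_def sum_constant_scaleR scaleR_add_left)
  finally have "(real m + 1) * norm (1 + h) = norm ((\<Sum>k\<in>UNIV - {i, j}. 1 - a k) + 1)"
    by (simp only: norm_scale)
  also have "\<dots> \<le> norm (\<Sum>k\<in>UNIV - {i, j}. 1 - a k) + norm (1 :: 'n cuntz)"
    by (rule norm_triangle_ineq)
  also have "\<dots> \<le> real m * 1 + 1"
    unfolding m_def by (intro add_mono sum_norm_bound n1 norm_one_le)
  finally have h1: "norm (1 + h) \<le> 1" by simp
  have "(real m + 1) *\<^sub>R (1 - h) = (1 - a i) + real m *\<^sub>R 1"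
    by (simp add: h_def scaleR_diff_right scaleR_add_left)
  then have "(real m + 1) * norm (1 - h) = norm ((1 - a i) + real m *\<^sub>R 1)"
    by (simp only: norm_scale)
  also have "\<dots> \<le> norm (1 - a i) + norm (real m *\<^sub>R (1 :: 'n cuntz))"
    by (rule norm_triangle_ineq)
  also have "\<dots> \<le> 1 + real m" using n1[of i] by simp
  finally have h2: "norm (1 - h) \<le> 1" by (simp add: add.commute)
  \<comment> \<open>This identity merges both estimates into one for 1 + h^2, as
    \<open>self_adjoint_eq_zero\<close> expects.\<close>
  have "2 *\<^sub>R (1 + h * h) = (1 + h) * (1 + h) + (1 - h) * (1 - h)"
    by (simp add: algebra_simps scaleR_2)
  then have "2 * norm (1 + h * h) \<le> norm ((1 + h) * (1 + h)) + norm ((1 - h) * (1 - h))"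
    using norm_triangle_ineq[of "(1 + h) * (1 + h)" "(1 - h) * (1 - h)"] norm_scaleR[of 2 "1 + h * h"] by simp
  also have "\<dots> \<le> norm (1 + h) * norm (1 + h) + norm (1 - h) * norm (1 - h)"
    by (intro add_mono norm_mult_ineq)
  also have "\<dots> \<le> 1 + 1"
    using h1 h2 by (intro add_mono mult_le_one) auto
  finally have "h = 0" using ah by (intro self_adjoint_eq_zero) auto
  then have "a i = 0" by (simp add: h_def)
  then have "adj (adj (cuntz_gen i) * cuntz_gen j) * (adj (cuntz_gen i) * cuntz_gen j) = 0"
    by (simp add: a_def adj_mult adj_adj mult.assoc)
  then have "norm (adj (cuntz_gen i) * cuntz_gen j) = 0"
    using norm_adj_mult_self[of "adj (cuntz_gen i) * cuntz_gen j"] by simp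
  then show ?thesis using False by simp
qed (simp add: cuntz_gen_isometry)

section \<open>Words in the generators and the diagonal\<close>

definition cuntz_word :: "'n::finite list \<Rightarrow> 'n cuntz"
  where "cuntz_word \<alpha> = prod_list (map cuntz_gen \<alpha>)"

definition cuntz_proj :: "'n::finite list \<Rightarrow> 'n cuntz"
  where "cuntz_proj \<alpha> = cuntz_word \<alpha> * adj (cuntz_word \<alpha>)"

definition words :: "nat \<Rightarrow> 'n::finite list set"
  where "words k = {\<alpha>. length \<alpha> = k}"

lemma finite_words [simp]: "finite (words k :: 'n::finite list set)"
  using finite_lists_length_eq[of "UNIV :: 'n set" k] by (simp add: words_def)

lemma words_0 [simp]: "words 0 = {[]}"
  by (auto simp: words_def)

lemma words_Suc: "words (Suc k) = (\<lambda>(i, \<alpha>). i # \<alpha>) ` (UNIV \<times> words k)"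
  by (force simp: words_def length_Suc_conv)

lemma cuntz_word_simps [simp]:
  "cuntz_word [] = 1" "cuntz_word (i # \<alpha>) = cuntz_gen i * cuntz_word \<alpha>"
  by (simp_all add: cuntz_word_def)

lemma cuntz_word_append: "cuntz_word (\<alpha> @ \<beta>) = cuntz_word \<alpha> * cuntz_word \<beta>"
  by (simp add: cuntz_word_def)

lemma prod_list_adj_gen: "prod_list (map (\<lambda>i. adj (cuntz_gen i)) (rev \<alpha>)) = adj (cuntz_word \<alpha>)"
  by (induction \<alpha>) (simp_all add: adj_one adj_mult)

lemma cuntz_word_orthogonal:
  "length \<alpha> = length \<beta> \<Longrightarrow> adj (cuntz_word \<alpha>) * cuntz_word \<beta> = (if \<alpha> = \<beta> then 1 else 0)"
proof (induction rule: list_induct2)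
  case (Cons i \<alpha> j \<beta>)
  have "adj (cuntz_word (i # \<alpha>)) * cuntz_word (j # \<beta>) =
      adj (cuntz_word \<alpha>) * (adj (cuntz_gen i) * cuntz_gen j) * cuntz_word \<beta>"
    by (simp add: adj_mult mult.assoc)
  also have "\<dots> = (if i = j then adj (cuntz_word \<alpha>) * cuntz_word \<beta> else 0)"
    by (simp add: cuntz_gen_orthogonal)
  finally show ?case unfolding Cons.IH by simp
qed (simp add: adj_one)

lemma cuntz_word_isometry: "adj (cuntz_word \<alpha>) * cuntz_word \<alpha> = 1"
  using cuntz_word_orthogonal[of \<alpha> \<alpha>] by simp

lemma cuntz_proj_Cons: "cuntz_proj (i # \<alpha>) = cuntz_gen i * cuntz_proj \<alpha> * adj (cuntz_gen i)"
  by (simp add: cuntz_proj_def adj_mult mult.assoc)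

lemma sum_words_Suc: "(\<Sum>\<alpha>\<in>words (Suc k). f \<alpha>) = (\<Sum>i\<in>UNIV. \<Sum>\<alpha>\<in>words k. f (i # \<alpha>))"
  unfolding words_Suc
  by (subst sum.reindex) (auto simp: inj_on_def sum.cartesian_product intro!: sum.cong)

lemma sum_cuntz_proj: "(\<Sum>\<alpha>\<in>words k. cuntz_proj \<alpha>) = (1 :: 'n::finite cuntz)"
proof (induction k)
  case (Suc k)
  have "(\<Sum>\<alpha>\<in>words (Suc k). cuntz_proj \<alpha>) =
      (\<Sum>i\<in>UNIV. cuntz_gen i * (\<Sum>\<alpha>\<in>words k. cuntz_proj \<alpha>) * adj (cuntz_gen (i :: 'n)))"
    by (simp add: sum_words_Suc cuntz_proj_Cons sum_distrib_left sum_distrib_right)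
  then show ?case by (simp add: Suc cuntz_gen_sum)
qed (simp add: cuntz_proj_def adj_one)

lemma norm_cuntz_word_le: "norm (cuntz_word \<alpha>) \<le> 1"
  by (rule norm_isometry_le) (rule cuntz_word_isometry)

lemma norm_word_compress_le: "norm (adj (cuntz_word \<alpha>) * x * cuntz_word \<beta>) \<le> norm x"
proof -
  have "norm (adj (cuntz_word \<alpha>) * x * cuntz_word \<beta>) \<le>
      norm (adj (cuntz_word \<alpha>)) * norm x * norm (cuntz_word \<beta>)"
    by (rule norm_mult3_le)
  also have "\<dots> \<le> 1 * norm x * 1"
    by (intro mult_mono) (simp_all add: norm_adj norm_cuntz_word_le)
  finally show ?thesis by simp
qed

section \<open>Matrix coefficients with respect to words\<close>

definition scalars :: "'a::unital_cstar_algebra set"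
  where "scalars = range (\<lambda>c. c *\<^sub>C 1)"

lemma scalars_intros [intro, simp]:
  "0 \<in> scalars" "1 \<in> scalars"
  "x \<in> scalars \<Longrightarrow> y \<in> scalars \<Longrightarrow> x + y \<in> scalars"
  "x \<in> scalars \<Longrightarrow> y \<in> scalars \<Longrightarrow> x * y \<in> scalars"
  "x \<in> scalars \<Longrightarrow> c *\<^sub>C x \<in> scalars"
  "x \<in> scalars \<Longrightarrow> adj x \<in> scalars"
proof -
  show "0 \<in> scalars" unfolding scalars_def by (rule image_eqI[of _ _ 0]) simp_all
  show "1 \<in> scalars" unfolding scalars_def by (rule image_eqI[of _ _ 1]) simp_all
qed (auto simp: scalars_def scaleC_scaleC mult_scaleC_left mult_scaleC_right adj_scaleC adj_one
    simp flip: scaleC_add_left)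

lemma scalars_sum [intro]: "(\<And>i. i \<in> A \<Longrightarrow> f i \<in> scalars) \<Longrightarrow> sum f A \<in> scalars"
  by (induction A rule: infinite_finite_induct) auto

text \<open>\<open>cuntz_block a b\<close> is the linear span of the \<open>S\<^sub>\<alpha> S\<^sub>\<beta>\<^sup>*\<close> with \<open>\<alpha>\<close> of length \<open>a\<close> and \<open>\<beta>\<close> of
  length \<open>b\<close>, described by matrix coefficients.\<close>

definition cuntz_block :: "nat \<Rightarrow> nat \<Rightarrow> 'n::finite cuntz set"
  where "cuntz_block a b = {x. \<forall>\<alpha>\<in>words a. \<forall>\<beta>\<in>words b. adj (cuntz_word \<alpha>) * x * cuntz_word \<beta> \<in> scalars}"

lemma cuntz_blockD:
  "x \<in> cuntz_block a b \<Longrightarrow> length \<alpha> = a \<Longrightarrow> length \<beta> = b \<Longrightarrow>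
    adj (cuntz_word \<alpha>) * x * cuntz_word \<beta> \<in> scalars"
  by (auto simp: cuntz_block_def words_def)

lemma cuntz_block_add: "x \<in> cuntz_block a b \<Longrightarrow> y \<in> cuntz_block a b \<Longrightarrow> x + y \<in> cuntz_block a b"
  by (auto simp: cuntz_block_def distrib_left distrib_right)

lemma cuntz_block_scaleC: "x \<in> cuntz_block a b \<Longrightarrow> c *\<^sub>C x \<in> cuntz_block a b"
  by (auto simp: cuntz_block_def mult_scaleC_left mult_scaleC_right)

lemma cuntz_block_zero: "0 \<in> cuntz_block a b"
  by (auto simp: cuntz_block_def)

lemma cuntz_block_adj: "x \<in> cuntz_block a b \<Longrightarrow> adj x \<in> cuntz_block b a"
proof -
  assume x: "x \<in> cuntz_block a b"
  have "adj (cuntz_word \<alpha>) * adj x * cuntz_word \<beta> = adj (adj (cuntz_word \<beta>) * x * cuntz_word \<alpha>)" for \<alpha> \<beta>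
    by (simp add: adj_mult adj_adj mult.assoc)
  then show ?thesis using x by (simp add: cuntz_block_def)
qed

lemma words_Suc_snoc: "\<alpha> \<in> words (Suc k) \<Longrightarrow> \<exists>\<beta>\<in>words k. \<exists>i. \<alpha> = \<beta> @ [i]"
  by (cases \<alpha> rule: rev_cases) (auto simp: words_def)

lemma compress_snoc:
  "adj (cuntz_word (\<alpha> @ [i])) * x * cuntz_word (\<beta> @ [j]) =
    adj (cuntz_gen i) * (adj (cuntz_word \<alpha>) * x * cuntz_word \<beta>) * cuntz_gen j"
  by (simp add: cuntz_word_append adj_mult mult.assoc)

text \<open>Coefficient form of S_\<alpha> S_\<beta>^* = sum_i S_{\<alpha> i} S_{\<beta> i}^*: a
  scalar c compressed by S_i and S_j becomes c or 0.\<close>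

lemma cuntz_block_Suc:
  assumes "x \<in> cuntz_block a b"
  shows "x \<in> cuntz_block (Suc a) (Suc b)"
proof -
  have "adj (cuntz_word (\<alpha> @ [i])) * x * cuntz_word (\<beta> @ [j]) \<in> scalars"
    if \<alpha>\<beta>: "\<alpha> \<in> words a" "\<beta> \<in> words b" for \<alpha> \<beta> i j
  proof -
    obtain c where "adj (cuntz_word \<alpha>) * x * cuntz_word \<beta> = c *\<^sub>C 1"
      using assms \<alpha>\<beta> by (auto simp: cuntz_block_def scalars_def)
    then show ?thesis
      unfolding compress_snoc by (simp add: mult_scaleC_left mult_scaleC_right cuntz_gen_orthogonal)
  qed
  then show ?thesis
    unfolding cuntz_block_def using words_Suc_snoc by blast
qed

lemma cuntz_block_add_right: "x \<in> cuntz_block a b \<Longrightarrow> x \<in> cuntz_block (a + m) (b + m)"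
  by (induction m) (simp_all add: cuntz_block_Suc)

lemma insert_proj_sum: "x * y = (\<Sum>\<gamma>\<in>words k. x * cuntz_word \<gamma> * (adj (cuntz_word \<gamma>) * y))"
proof -
  have "x * y = x * (\<Sum>\<gamma>\<in>words k. cuntz_proj \<gamma>) * y" by (simp add: sum_cuntz_proj)
  then show ?thesis
    by (simp add: sum_distrib_left sum_distrib_right cuntz_proj_def mult.assoc)
qed

lemma cuntz_block_mult:
  assumes "x \<in> cuntz_block a b" "y \<in> cuntz_block b c"
  shows "x * y \<in> cuntz_block a c"
proof -
  have "adj (cuntz_word \<alpha>) * (x * y) * cuntz_word \<beta> =
      (\<Sum>\<gamma>\<in>words b. (adj (cuntz_word \<alpha>) * x * cuntz_word \<gamma>) * (adj (cuntz_word \<gamma>) * y * cuntz_word \<beta>))"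
    for \<alpha> \<beta>
    using insert_proj_sum[of "adj (cuntz_word \<alpha>) * x" "y * cuntz_word \<beta>" b] by (simp add: mult.assoc)
  then show ?thesis using assms by (auto simp: cuntz_block_def)
qed

lemma cuntz_block_one: "1 \<in> cuntz_block 0 0"
  by (simp add: cuntz_block_def adj_one)

lemma cuntz_block_gen: "cuntz_gen i \<in> cuntz_block 1 0"
  by (auto simp: cuntz_block_def words_Suc adj_one cuntz_gen_orthogonal)

lemma cuntz_block_expand:
  "x = (\<Sum>\<alpha>\<in>words a. \<Sum>\<beta>\<in>words b.
      cuntz_word \<alpha> * (adj (cuntz_word \<alpha>) * x * cuntz_word \<beta>) * adj (cuntz_word \<beta>))"
proof -
  have "x = (\<Sum>\<alpha>\<in>words a. cuntz_proj \<alpha>) * (x * (\<Sum>\<beta>\<in>words b. cuntz_proj \<beta>))"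
    by (simp add: sum_cuntz_proj)
  also have "\<dots> = (\<Sum>\<alpha>\<in>words a. cuntz_proj \<alpha> * (x * (\<Sum>\<beta>\<in>words b. cuntz_proj \<beta>)))"
    by (rule sum_distrib_right)
  finally show ?thesis
    by (simp add: sum_distrib_left cuntz_proj_def mult.assoc)
qed

text \<open>Coefficients instead of a span: compressing by a generator and passing to the next level
  become computations with coefficients. Agreement with \<open>cuntz_diag_level\<close> is
  \<open>cuntz_diag_level_eq\<close>.\<close>

definition diag_block :: "nat \<Rightarrow> 'n::finite cuntz set"
  where "diag_block k = {x \<in> cuntz_block k k.
    \<forall>\<alpha>\<in>words k. \<forall>\<beta>\<in>words k. \<alpha> \<noteq> \<beta> \<longrightarrow> adj (cuntz_word \<alpha>) * x * cuntz_word \<beta> = 0}"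

lemma diag_block_expand:
  assumes "x \<in> diag_block k"
  obtains c where "x = (\<Sum>\<alpha>\<in>words k. c \<alpha> *\<^sub>C cuntz_proj \<alpha>)"
proof -
  have "\<forall>\<alpha>\<in>words k. \<exists>c. adj (cuntz_word \<alpha>) * x * cuntz_word \<alpha> = c *\<^sub>C 1"
    using assms unfolding diag_block_def cuntz_block_def scalars_def by blast
  then obtain c where c: "\<And>\<alpha>. \<alpha> \<in> words k \<Longrightarrow> adj (cuntz_word \<alpha>) * x * cuntz_word \<alpha> = c \<alpha> *\<^sub>C 1"
    by metis
  have "x = (\<Sum>\<alpha>\<in>words k. \<Sum>\<beta>\<in>words k.
      cuntz_word \<alpha> * (adj (cuntz_word \<alpha>) * x * cuntz_word \<beta>) * adj (cuntz_word \<beta>))"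
    by (rule cuntz_block_expand)
  also have "\<dots> = (\<Sum>\<alpha>\<in>words k. \<Sum>\<beta>\<in>words k. if \<alpha> = \<beta> then c \<alpha> *\<^sub>C cuntz_proj \<alpha> else 0)"
    using assms c by (intro sum.cong refl)
      (auto simp: diag_block_def cuntz_proj_def mult_scaleC_left mult_scaleC_right)
  finally show ?thesis using that[of c] by simp
qed

lemma cuntz_proj_compress:
  assumes "length \<alpha> = length \<gamma>" "length \<beta> = length \<gamma>"
  shows "adj (cuntz_word \<alpha>) * cuntz_proj \<gamma> * cuntz_word \<beta> = (if \<alpha> = \<gamma> \<and> \<beta> = \<gamma> then 1 else 0)"
proof -
  have "adj (cuntz_word \<alpha>) * cuntz_proj \<gamma> * cuntz_word \<beta> =
      (adj (cuntz_word \<alpha>) * cuntz_word \<gamma>) * (adj (cuntz_word \<gamma>) * cuntz_word \<beta>)"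
    by (simp add: cuntz_proj_def mult.assoc)
  then show ?thesis using assms by (simp add: cuntz_word_orthogonal)
qed

lemma subspace_diag_block: "cvec.subspace (diag_block k)"
  by (rule cvec.subspaceI)
     (auto simp: diag_block_def cuntz_block_zero cuntz_block_add cuntz_block_scaleC
       distrib_left distrib_right mult_scaleC_left mult_scaleC_right)

lemma cuntz_proj_in_diag_block: "length \<gamma> = k \<Longrightarrow> cuntz_proj \<gamma> \<in> diag_block k"
  by (auto simp: diag_block_def cuntz_block_def words_def cuntz_proj_compress)

lemma cuntz_diag_level_eq: "cuntz_diag_level k = (diag_block k :: 'n::finite cuntz set)"
proof -
  have gen: "{prod_list (map cuntz_gen \<alpha>) * prod_list (map (\<lambda>i. adj (cuntz_gen i)) (rev \<alpha>)) | \<alpha>.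
      length \<alpha> = k} = cuntz_proj ` (words k :: 'n list set)"
    by (auto simp: prod_list_adj_gen cuntz_proj_def words_def simp flip: cuntz_word_def)
  show ?thesis
    unfolding cuntz_diag_level_def gen
  proof (rule antisym)
    show "cvec.span (cuntz_proj ` words k) \<subseteq> (diag_block k :: 'n cuntz set)"
      by (rule cvec.span_minimal) (auto simp: subspace_diag_block cuntz_proj_in_diag_block words_def)
    show "(diag_block k :: 'n cuntz set) \<subseteq> cvec.span (cuntz_proj ` words k)"
    proof
      fix x :: "'n cuntz" assume "x \<in> diag_block k"
      then obtain c where "x = (\<Sum>\<alpha>\<in>words k. c \<alpha> *\<^sub>C cuntz_proj \<alpha>)" by (rule diag_block_expand)
      then show "x \<in> cvec.span (cuntz_proj ` words k)"
        by (simp add: cvec.span_sum cvec.span_scale cvec.span_base)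
    qed
  qed
qed

lemma diag_block_Suc:
  assumes "x \<in> diag_block k"
  shows "x \<in> diag_block (Suc k)"
proof -
  have "adj (cuntz_word (\<alpha> @ [i])) * x * cuntz_word (\<beta> @ [j]) = 0"
    if \<alpha>\<beta>: "\<alpha> \<in> words k" "\<beta> \<in> words k" "\<alpha> @ [i] \<noteq> \<beta> @ [j]" for \<alpha> \<beta> i j
  proof (cases "\<alpha> = \<beta>")
    case True
    then have "i \<noteq> j" using \<alpha>\<beta> by simp
    obtain c where "adj (cuntz_word \<alpha>) * x * cuntz_word \<beta> = c *\<^sub>C 1"
      using assms \<alpha>\<beta> unfolding diag_block_def cuntz_block_def scalars_def by blast
    then show ?thesis
      unfolding compress_snoc using \<open>i \<noteq> j\<close>
      by (simp add: mult_scaleC_left mult_scaleC_right cuntz_gen_orthogonal)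
  next
    case False
    then have "adj (cuntz_word \<alpha>) * x * cuntz_word \<beta> = 0"
      using assms \<alpha>\<beta> by (auto simp: diag_block_def)
    then show ?thesis unfolding compress_snoc by simp
  qed
  then have "adj (cuntz_word \<alpha>) * x * cuntz_word \<beta> = 0"
    if "\<alpha> \<in> words (Suc k)" "\<beta> \<in> words (Suc k)" "\<alpha> \<noteq> \<beta>" for \<alpha> \<beta>
    using words_Suc_snoc[OF that(1)] words_Suc_snoc[OF that(2)] that(3) by blast
  then show ?thesis using assms by (simp add: diag_block_def cuntz_block_Suc)
qed

lemma diag_block_mono: "k \<le> l \<Longrightarrow> diag_block k \<subseteq> diag_block l"
  by (rule lift_Suc_mono_le[of diag_block]) (auto intro: diag_block_Suc)

definition diag_alg :: "'n::finite cuntz set"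
  where "diag_alg = (\<Union>k. diag_block k)"

text \<open>\<open>cuntz_diag\<close> starts at level 1; the levels increase, so level 0 adds
  nothing.\<close>

lemma cuntz_diag_eq: "cuntz_diag = closure diag_alg"
proof -
  have "(\<Union>k\<in>{1..}. diag_block k) = (diag_alg :: 'a cuntz set)"
    unfolding diag_alg_def using diag_block_Suc by (auto intro: Suc_le_mono[THEN iffD2])
  then show ?thesis by (simp add: cuntz_diag_def cuntz_diag_level_eq)
qed

lemma diag_block_mult:
  assumes "x \<in> diag_block k" "y \<in> diag_block k"
  shows "x * y \<in> diag_block k" "x * y = y * x"
proof -
  obtain c where c: "x = (\<Sum>\<alpha>\<in>words k. c \<alpha> *\<^sub>C cuntz_proj \<alpha>)"
    using assms(1) by (rule diag_block_expand)
  obtain d where d: "y = (\<Sum>\<alpha>\<in>words k. d \<alpha> *\<^sub>C cuntz_proj \<alpha>)"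
    using assms(2) by (rule diag_block_expand)
  have pp: "cuntz_proj \<alpha> * cuntz_proj \<beta> = (if \<alpha> = \<beta> then cuntz_proj \<alpha> else 0)"
    if "\<alpha> \<in> words k" "\<beta> \<in> words k" for \<alpha> \<beta> :: "'a list"
  proof -
    have "cuntz_proj \<alpha> * cuntz_proj \<beta> = cuntz_word \<alpha> * (adj (cuntz_word \<alpha>) * cuntz_word \<beta>) * adj (cuntz_word \<beta>)"
      by (simp add: cuntz_proj_def mult.assoc)
    then show ?thesis using that by (simp add: words_def cuntz_word_orthogonal cuntz_proj_def)
  qed
  have prod: "(\<Sum>\<alpha>\<in>words k. c \<alpha> *\<^sub>C cuntz_proj \<alpha>) * (\<Sum>\<alpha>\<in>words k. d \<alpha> *\<^sub>C cuntz_proj \<alpha>) =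
      (\<Sum>\<alpha>\<in>words k. (c \<alpha> * d \<alpha>) *\<^sub>C cuntz_proj (\<alpha> :: 'a list))" for c d
  proof -
    have "(\<Sum>\<alpha>\<in>words k. c \<alpha> *\<^sub>C cuntz_proj \<alpha>) * (\<Sum>\<alpha>\<in>words k. d \<alpha> *\<^sub>C cuntz_proj \<alpha>) =
        (\<Sum>\<alpha>\<in>words k. \<Sum>\<beta>\<in>words k. if \<alpha> = \<beta> then (c \<alpha> * d \<beta>) *\<^sub>C cuntz_proj (\<alpha> :: 'a list) else 0)"
      unfolding sum_product
      by (intro sum.cong refl) (auto simp: mult_scaleC_left mult_scaleC_right scaleC_scaleC pp)
    then show ?thesis by simp
  qed
  show "x * y = y * x" by (simp add: c d prod mult.commute)
  show "x * y \<in> diag_block k"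
    unfolding c d prod
    by (intro cvec.subspace_sum[OF subspace_diag_block] cvec.subspace_scale[OF subspace_diag_block]
        cuntz_proj_in_diag_block) (simp add: words_def)
qed

lemma diag_block_adj: "x \<in> diag_block k \<Longrightarrow> adj x \<in> diag_block k"
proof -
  assume x: "x \<in> diag_block k"
  have "adj (cuntz_word \<alpha>) * adj x * cuntz_word \<beta> = adj (adj (cuntz_word \<beta>) * x * cuntz_word \<alpha>)" for \<alpha> \<beta>
    by (simp add: adj_mult adj_adj mult.assoc)
  then show ?thesis using x by (auto simp: diag_block_def cuntz_block_adj)
qed

lemma diag_block_shift: "x \<in> diag_block (Suc k) \<Longrightarrow> adj (cuntz_gen i) * x * cuntz_gen i \<in> diag_block k"
proof -
  assume x: "x \<in> diag_block (Suc k)"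
  have "adj (cuntz_word \<alpha>) * (adj (cuntz_gen i) * x * cuntz_gen i) * cuntz_word \<beta> =
      adj (cuntz_word (i # \<alpha>)) * x * cuntz_word (i # \<beta>)" for \<alpha> \<beta>
    by (simp add: adj_mult mult.assoc)
  moreover have "i # \<alpha> \<in> words (Suc k)" if "\<alpha> \<in> words k" for \<alpha> using that by (simp add: words_def)
  ultimately show ?thesis
    using x by (simp add: diag_block_def cuntz_block_def del: cuntz_word_simps)
qed

lemma diag_block_lift:
  assumes "x \<in> diag_block k"
  shows "cuntz_gen i * x * adj (cuntz_gen i) \<in> diag_block (Suc k)"
proof -
  obtain c where "x = (\<Sum>\<alpha>\<in>words k. c \<alpha> *\<^sub>C cuntz_proj \<alpha>)"
    using assms by (rule diag_block_expand)
  then have "cuntz_gen i * x * adj (cuntz_gen i) = (\<Sum>\<alpha>\<in>words k. c \<alpha> *\<^sub>C cuntz_proj (i # \<alpha>))"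
    by (simp add: sum_distrib_left sum_distrib_right mult_scaleC_left mult_scaleC_right cuntz_proj_Cons)
  also have "\<dots> \<in> diag_block (Suc k)"
    by (intro cvec.subspace_sum[OF subspace_diag_block] cvec.subspace_scale[OF subspace_diag_block]
        cuntz_proj_in_diag_block) (simp add: words_def)
  finally show ?thesis .
qed

lemma diag_alg_common:
  assumes "x \<in> diag_alg" "y \<in> diag_alg"
  obtains k where "x \<in> diag_block k" "y \<in> diag_block k"
proof -
  obtain k l where "x \<in> diag_block k" "y \<in> diag_block l" using assms by (auto simp: diag_alg_def)
  then show ?thesis using that[of "max k l"] diag_block_mono[of k "max k l"] diag_block_mono[of l "max k l"]
    by auto
qed

lemma diag_alg_closed:
  assumes "x \<in> diag_alg" "y \<in> diag_alg"
  shows "x + y \<in> diag_alg" "x * y \<in> diag_alg" "x * y = y * x" "c *\<^sub>C x \<in> diag_alg" "adj x \<in> diag_alg"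
    "adj (cuntz_gen i) * x * cuntz_gen i \<in> diag_alg" "cuntz_gen i * x * adj (cuntz_gen i) \<in> diag_alg"
proof -
  obtain k where k: "x \<in> diag_block k" "y \<in> diag_block k" using assms by (rule diag_alg_common)
  have inc: "z \<in> diag_block m \<Longrightarrow> z \<in> diag_alg" for z m by (auto simp: diag_alg_def)
  show "x + y \<in> diag_alg" by (rule inc[OF cvec.subspace_add[OF subspace_diag_block k]])
  show "x * y \<in> diag_alg" by (rule inc[OF diag_block_mult(1)[OF k]])
  show "x * y = y * x" by (rule diag_block_mult(2)[OF k])
  show "c *\<^sub>C x \<in> diag_alg" by (rule inc[OF cvec.subspace_scale[OF subspace_diag_block k(1)]])
  show "adj x \<in> diag_alg" by (rule inc[OF diag_block_adj[OF k(1)]])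
  show "adj (cuntz_gen i) * x * cuntz_gen i \<in> diag_alg"
    by (rule inc[OF diag_block_shift[OF diag_block_Suc[OF k(1)]]])
  show "cuntz_gen i * x * adj (cuntz_gen i) \<in> diag_alg" by (rule inc[OF diag_block_lift[OF k(1)]])
qed

lemma cuntz_diag_limit:
  assumes "x \<in> cuntz_diag"
  obtains X where "\<And>k. X k \<in> diag_alg" "X \<longlonglongrightarrow> x"
  using assms unfolding cuntz_diag_eq closure_sequential by blast

lemma cuntz_diagI: "(\<And>k. X k \<in> diag_alg) \<Longrightarrow> X \<longlonglongrightarrow> x \<Longrightarrow> x \<in> cuntz_diag"
  unfolding cuntz_diag_eq closure_sequential by blast

lemma cuntz_diag_closed:
  assumes "x \<in> cuntz_diag" "y \<in> cuntz_diag"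
  shows "x + y \<in> cuntz_diag" "x * y \<in> cuntz_diag" "x * y = y * x" "c *\<^sub>C x \<in> cuntz_diag" "adj x \<in> cuntz_diag"
    "adj (cuntz_gen i) * x * cuntz_gen i \<in> cuntz_diag" "cuntz_gen i * x * adj (cuntz_gen i) \<in> cuntz_diag"
proof -
  obtain X where X: "\<And>k. X k \<in> diag_alg" "X \<longlonglongrightarrow> x" using cuntz_diag_limit[OF assms(1)] by blast
  obtain Y where Y: "\<And>k. Y k \<in> diag_alg" "Y \<longlonglongrightarrow> y" using cuntz_diag_limit[OF assms(2)] by blast
  note cl = diag_alg_closed[OF X(1) Y(1)]
  show "x + y \<in> cuntz_diag" by (rule cuntz_diagI[OF cl(1) tendsto_add[OF X(2) Y(2)]])
  show "x * y \<in> cuntz_diag" by (rule cuntz_diagI[OF cl(2) tendsto_mult[OF X(2) Y(2)]])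
  show "c *\<^sub>C x \<in> cuntz_diag" by (rule cuntz_diagI[OF cl(4) tendsto_scaleC[OF X(2)]])
  show "adj x \<in> cuntz_diag" by (rule cuntz_diagI[OF cl(5) tendsto_adj[OF X(2)]])
  show "adj (cuntz_gen i) * x * cuntz_gen i \<in> cuntz_diag"
    by (rule cuntz_diagI[where X = "\<lambda>k. adj (cuntz_gen i) * X k * cuntz_gen i"])
       (auto intro!: cl(6) tendsto_intros X(2))
  show "cuntz_gen i * x * adj (cuntz_gen i) \<in> cuntz_diag"
    by (rule cuntz_diagI[where X = "\<lambda>k. cuntz_gen i * X k * adj (cuntz_gen i)"])
       (auto intro!: cl(7) tendsto_intros X(2))
  have "(\<lambda>k. X k * Y k) = (\<lambda>k. Y k * X k)" using cl(3) by (rule ext)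
  then have "(\<lambda>k. X k * Y k) \<longlonglongrightarrow> y * x" using tendsto_mult[OF Y(2) X(2)] by (simp only:)
  with tendsto_mult[OF X(2) Y(2)] show "x * y = y * x" by (rule LIMSEQ_unique)
qed

lemma cuntz_proj_in_diag: "cuntz_proj \<alpha> \<in> cuntz_diag"
  unfolding cuntz_diag_eq
  by (rule subsetD[OF closure_subset]) (auto simp: diag_alg_def intro!: exI[of _ "length \<alpha>"] cuntz_proj_in_diag_block)

lemma closed_cuntz_diag: "closed (cuntz_diag :: 'n::finite cuntz set)"
  by (simp add: cuntz_diag_eq)

section \<open>The commutant of the diagonal\<close>

definition diag_commutant :: "'n::finite cuntz set"
  where "diag_commutant = {x. \<forall>d\<in>cuntz_diag. x * d = d * x}"

lemma subspace_diag_commutant: "cvec.subspace diag_commutant"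
  by (rule cvec.subspaceI)
     (auto simp: diag_commutant_def distrib_left distrib_right mult_scaleC_left mult_scaleC_right)

lemma diag_commutant_adj:
  assumes "x \<in> diag_commutant"
  shows "adj x \<in> diag_commutant"
proof -
  have "adj x * d = d * adj x" if "d \<in> cuntz_diag" for d
  proof -
    have "x * adj d = adj d * x"
      using assms cuntz_diag_closed(5)[OF that that] by (simp add: diag_commutant_def)
    then have "adj (x * adj d) = adj (adj d * x)" by (rule arg_cong)
    then show ?thesis by (simp add: adj_mult adj_adj)
  qed
  then show ?thesis by (simp add: diag_commutant_def)
qed

text \<open>For diagonal \<open>d\<close> the element S_i d S_i^* is diagonal too; its commutation
  with \<open>x\<close>, compressed by S_i, is the commutation of the compressed \<open>x\<close>
  with \<open>d\<close>.\<close>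

lemma diag_commutant_shift:
  assumes "x \<in> diag_commutant"
  shows "adj (cuntz_gen i) * x * cuntz_gen i \<in> diag_commutant"
proof -
  have "adj (cuntz_gen i) * x * cuntz_gen i * d = d * (adj (cuntz_gen i) * x * cuntz_gen i)"
    if "d \<in> cuntz_diag" for d
  proof -
    let ?e = "cuntz_gen i * d * adj (cuntz_gen i)"
    have l: "?e * cuntz_gen i = cuntz_gen i * d" and r: "adj (cuntz_gen i) * ?e = d * adj (cuntz_gen i)"
      by (simp_all add: mult.assoc cuntz_gen_isometry)
         (simp add: cuntz_gen_isometry flip: mult.assoc)
    have e: "x * ?e = ?e * x"
      using assms cuntz_diag_closed(7)[OF that that] by (simp add: diag_commutant_def)
    have "adj (cuntz_gen i) * x * cuntz_gen i * d = adj (cuntz_gen i) * x * (?e * cuntz_gen i)"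
      unfolding l by (simp only: mult.assoc)
    also have "\<dots> = adj (cuntz_gen i) * (x * ?e) * cuntz_gen i" by (simp only: mult.assoc)
    also have "\<dots> = (adj (cuntz_gen i) * ?e) * x * cuntz_gen i" unfolding e by (simp only: mult.assoc)
    also have "\<dots> = d * (adj (cuntz_gen i) * x * cuntz_gen i)" unfolding r by (simp only: mult.assoc)
    finally show ?thesis .
  qed
  then show ?thesis by (simp add: diag_commutant_def)
qed

lemma diag_commutant_compress:
  "x \<in> diag_commutant \<Longrightarrow> adj (cuntz_word \<beta>) * x * cuntz_word \<beta> \<in> diag_commutant"
proof (induction \<beta> arbitrary: x)
  case (Cons i \<beta>)
  have "adj (cuntz_word (i # \<beta>)) * x * cuntz_word (i # \<beta>) =
      adj (cuntz_word \<beta>) * (adj (cuntz_gen i) * x * cuntz_gen i) * cuntz_word \<beta>"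
    by (simp add: adj_mult mult.assoc)
  then show ?case using Cons.IH[OF diag_commutant_shift[OF Cons.prems]] by simp
qed (simp add: adj_one)

text \<open>The projection of \<beta> may be inserted in front of S_\<beta> and moved across
  \<open>x\<close>; there it meets S_\<alpha>^* and gives 0.\<close>

lemma diag_commutant_off_diagonal:
  assumes "x \<in> diag_commutant" "length \<alpha> = length \<beta>" "\<alpha> \<noteq> \<beta>"
  shows "adj (cuntz_word \<alpha>) * x * cuntz_word \<beta> = 0"
proof -
  have "cuntz_proj \<beta> * cuntz_word \<beta> = cuntz_word \<beta>"
    by (simp add: cuntz_proj_def mult.assoc cuntz_word_isometry)
  then have "adj (cuntz_word \<alpha>) * x * cuntz_word \<beta> = adj (cuntz_word \<alpha>) * (x * cuntz_proj \<beta>) * cuntz_word \<beta>"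
    by (simp add: mult.assoc)
  also have "x * cuntz_proj \<beta> = cuntz_proj \<beta> * x"
    using assms(1) cuntz_proj_in_diag unfolding diag_commutant_def by blast
  also have "adj (cuntz_word \<alpha>) * (cuntz_proj \<beta> * x) * cuntz_word \<beta> =
      (adj (cuntz_word \<alpha>) * cuntz_word \<beta>) * (adj (cuntz_word \<beta>) * x * cuntz_word \<beta>)"
    by (simp add: cuntz_proj_def mult.assoc)
  finally show ?thesis using assms by (simp add: cuntz_word_orthogonal)
qed

text \<open>Only the diagonal terms of the matrix expansion survive. Block-diagonality at every
  level is what lets \<open>norm_word_sum_le\<close> control the commutant by compressions.\<close>

lemma diag_commutant_expand:
  assumes "x \<in> diag_commutant"
  shows "x = (\<Sum>\<beta>\<in>words k. cuntz_word \<beta> * (adj (cuntz_word \<beta>) * x * cuntz_word \<beta>) * adj (cuntz_word \<beta>))"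
proof -
  have "x = (\<Sum>\<alpha>\<in>words k. \<Sum>\<beta>\<in>words k.
      cuntz_word \<alpha> * (adj (cuntz_word \<alpha>) * x * cuntz_word \<beta>) * adj (cuntz_word \<beta>))"
    by (rule cuntz_block_expand)
  also have "\<dots> = (\<Sum>\<alpha>\<in>words k. \<Sum>\<beta>\<in>words k. if \<alpha> = \<beta> then
      cuntz_word \<alpha> * (adj (cuntz_word \<alpha>) * x * cuntz_word \<alpha>) * adj (cuntz_word \<alpha>) else 0)"
    by (intro sum.cong refl) (auto simp: diag_commutant_off_diagonal[OF assms] words_def)
  finally show ?thesis by simp
qed

lemma norm_word_sum_le:
  assumes "\<And>\<beta>. \<beta> \<in> words k \<Longrightarrow> norm (y \<beta>) \<le> C" "0 \<le> C"
  shows "norm (\<Sum>\<beta>\<in>words k. cuntz_word \<beta> * y \<beta> * adj (cuntz_word \<beta>)) \<le> C"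
  by (rule norm_orthogonal_sum_le) (use assms finite_words in \<open>auto simp: words_def cuntz_word_orthogonal\<close>)

text \<open>The witness is the diagonal part of \<open>q\<close>. Since \<open>y\<close> is its own
  block-diagonal part at level \<open>k\<close>, the difference is the block-diagonal part of
  \<open>y - q\<close>, and taking that part is contractive.\<close>

lemma diag_commutant_near_core:
  assumes y: "y \<in> diag_commutant" and q: "q \<in> cuntz_block k k" and e: "norm (y - q) \<le> e"
  shows "\<exists>d\<in>cuntz_diag. norm (y - d) \<le> e"
proof -
  define d where "d = (\<Sum>\<beta>\<in>words k. cuntz_word \<beta> * (adj (cuntz_word \<beta>) * q * cuntz_word \<beta>) * adj (cuntz_word \<beta>))"
  have "cuntz_word \<beta> * (adj (cuntz_word \<beta>) * q * cuntz_word \<beta>) * adj (cuntz_word \<beta>) \<in> diag_block k"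
    if \<beta>: "\<beta> \<in> words k" for \<beta>
  proof -
    obtain c where "adj (cuntz_word \<beta>) * q * cuntz_word \<beta> = c *\<^sub>C 1"
      using cuntz_blockD[OF q, of \<beta> \<beta>] \<beta> by (auto simp: scalars_def words_def)
    then have "cuntz_word \<beta> * (adj (cuntz_word \<beta>) * q * cuntz_word \<beta>) * adj (cuntz_word \<beta>) = c *\<^sub>C cuntz_proj \<beta>"
      by (simp add: cuntz_proj_def mult_scaleC_left mult_scaleC_right)
    then show ?thesis
      using \<beta> cvec.subspace_scale[OF subspace_diag_block cuntz_proj_in_diag_block] by (simp add: words_def)
  qed
  then have "d \<in> diag_block k" unfolding d_def by (intro cvec.subspace_sum[OF subspace_diag_block])
  then have d: "d \<in> cuntz_diag"
    unfolding cuntz_diag_eq by (intro subsetD[OF closure_subset]) (auto simp: diag_alg_def)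
  have "y - d = (\<Sum>\<beta>\<in>words k. cuntz_word \<beta> * (adj (cuntz_word \<beta>) * (y - q) * cuntz_word \<beta>) * adj (cuntz_word \<beta>))"
    by (subst diag_commutant_expand[OF y, of k])
       (simp add: d_def left_diff_distrib right_diff_distrib sum_subtractf)
  also have "norm \<dots> \<le> e"
  proof (rule norm_word_sum_le)
    show "norm (adj (cuntz_word \<beta>) * (y - q) * cuntz_word \<beta>) \<le> e" for \<beta>
      using norm_word_compress_le e by (rule order_trans)
    show "0 \<le> e" using norm_ge_zero e by (rule order_trans)
  qed
  finally show ?thesis using d by blast
qed

lemma norm_cuntz_word: "norm (cuntz_word \<alpha>) = 1"
proof -
  have "(norm (cuntz_word \<alpha>))\<^sup>2 = 1\<^sup>2"
    using norm_adj_mult_self[of "cuntz_word \<alpha>"] by (simp add: cuntz_word_isometry)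
  then show ?thesis by (rule power2_eq_imp_eq) simp_all
qed

text \<open>Here n \<ge> 2 enters the maximality of the diagonal. With a single letter the algebra
  is generated by one unitary, hence commutative, and the diagonal consists of scalars.\<close>

lemma words_distinct:
  assumes "CARD('n::finite) \<ge> 2" "0 < k"
  shows "\<exists>\<delta>\<in>words k. \<delta> \<noteq> (\<rho> :: 'n list)"
proof -
  obtain a b :: 'n where "a \<noteq> b"
    using assms(1) card_le_Suc0_iff_eq[of "UNIV :: 'n set"] by auto
  then have "replicate k a \<noteq> replicate k b" using assms(2) by (cases k) auto
  moreover have "replicate k a \<in> words k" "replicate k b \<in> words k" by (simp_all add: words_def)
  ultimately show ?thesis by metis
qed

text \<open>Write s = sum c_\<rho> S_\<rho>. Compressing y - s by S_\<rho> on the left and by some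
  S_\<delta> with \<delta> \<noteq> \<rho> on the right annihilates \<open>y\<close> and leaves -
  c_\<rho> S_\<delta>, so |c_\<rho>| \<le> e. Thus \<open>s\<close> is small, and \<open>y\<close>
  with it.\<close>

lemma diag_commutant_near_isometries:
  fixes y :: "'n::finite cuntz"
  assumes n: "CARD('n) \<ge> 2" and k: "0 < k"
    and y: "y \<in> diag_commutant" and s: "s \<in> cuntz_block k 0" and e: "norm (y - s) \<le> e"
  shows "norm y \<le> (real (card (words k :: 'n list set)) + 1) * e"
proof -
  have s_eq: "s = (\<Sum>\<rho>\<in>words k. cuntz_word \<rho> * (adj (cuntz_word \<rho>) * s))"
    using insert_proj_sum[of 1 s k] by simp
  have "norm (cuntz_word \<rho> * (adj (cuntz_word \<rho>) * s)) \<le> e" if \<rho>: "\<rho> \<in> words k" for \<rho>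
  proof -
    obtain c where c: "adj (cuntz_word \<rho>) * s = c *\<^sub>C 1"
      using cuntz_blockD[OF s, of \<rho> "[]"] \<rho> by (auto simp: scalars_def words_def)
    obtain \<delta> where \<delta>: "\<delta> \<in> words k" "\<delta> \<noteq> \<rho>" using words_distinct[OF n k] by blast
    have "adj (cuntz_word \<rho>) * y * cuntz_word \<delta> = 0"
      using \<rho> \<delta> by (intro diag_commutant_off_diagonal[OF y]) (auto simp: words_def)
    then have "adj (cuntz_word \<rho>) * (y - s) * cuntz_word \<delta> = - (c *\<^sub>C cuntz_word \<delta>)"
      by (simp add: left_diff_distrib right_diff_distrib c mult_scaleC_left)
    then have "norm (c *\<^sub>C cuntz_word \<delta>) \<le> norm (y - s)"
      using norm_word_compress_le[of \<rho> "y - s" \<delta>] by simp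
    then have "cmod c \<le> e" using e by (simp add: norm_scaleC norm_cuntz_word)
    then show ?thesis by (simp add: c mult_scaleC_right norm_scaleC norm_cuntz_word)
  qed
  then have "norm s \<le> real (card (words k :: 'n list set)) * e"
    by (subst s_eq) (rule sum_norm_bound)
  moreover have "norm y \<le> norm s + norm (y - s)" using norm_triangle_ineq[of s "y - s"] by simp
  ultimately show ?thesis using e by (simp add: distrib_right)
qed

text \<open>Compressing by words of length \<open>b\<close> reduces to the block with indices k and
  0. The block-diagonal norm estimate keeps the constant independent of \<open>b\<close>, which is
  essential: \<open>b\<close> is uncontrolled as approximations improve.\<close>

lemma diag_commutant_near_block:
  fixes y :: "'n::finite cuntz"
  assumes n: "CARD('n) \<ge> 2" and k: "0 < k"
    and y: "y \<in> diag_commutant" and q: "q \<in> cuntz_block (b + k) b" and e: "norm (y - q) \<le> e"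
  shows "norm y \<le> (real (card (words k :: 'n list set)) + 1) * e"
proof -
  let ?c = "\<lambda>\<beta> x. adj (cuntz_word \<beta>) * x * cuntz_word \<beta>"
  have "norm (?c \<beta> y) \<le> (real (card (words k :: 'n list set)) + 1) * e" if \<beta>: "\<beta> \<in> words b" for \<beta>
  proof (rule diag_commutant_near_isometries[OF n k])
    show "?c \<beta> y \<in> diag_commutant" by (rule diag_commutant_compress[OF y])
    have "adj (cuntz_word \<rho>) * ?c \<beta> q * cuntz_word [] = adj (cuntz_word (\<beta> @ \<rho>)) * q * cuntz_word \<beta>" for \<rho>
      by (simp add: cuntz_word_append adj_mult mult.assoc)
    then show "?c \<beta> q \<in> cuntz_block k 0"
      using cuntz_blockD[OF q] \<beta> by (simp add: cuntz_block_def words_def)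
    have "?c \<beta> y - ?c \<beta> q = ?c \<beta> (y - q)" by (simp add: left_diff_distrib right_diff_distrib)
    then show "norm (?c \<beta> y - ?c \<beta> q) \<le> e" using norm_word_compress_le[of \<beta> "y - q" \<beta>] e by simp
  qed
  moreover have "0 \<le> (real (card (words k :: 'n list set)) + 1) * e"
    using e norm_ge_zero[of "y - q"] by (simp del: norm_ge_zero)
  ultimately show ?thesis
    by (subst diag_commutant_expand[OF y, of b]) (rule norm_word_sum_le)
qed

section \<open>The gauge action\<close>

text \<open>The angle may vary with the letter. A constant angle gives the gauge action; varying
  angles give the automorphism that detects a proper endomorphism.\<close>

lemma cuntz_gauge_exists:
  "\<exists>f :: 'n::finite cuntz \<Rightarrow> 'n cuntz. unital_star_hom f \<and> (\<forall>i. f (cuntz_gen i) = cis (\<theta> i) *\<^sub>C cuntz_gen i)"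
proof -
  have cc: "cnj (cis t) * cis t = 1" "cis t * cnj (cis t) = 1" for t by (simp_all add: cis_cnj cis_mult)
  have "\<exists>f :: 'n cuntz \<Rightarrow> 'n cuntz. unital_star_hom f \<and> (\<forall>i. f (cuntz_gen i) = cis (\<theta> i) *\<^sub>C cuntz_gen i) \<and>
    (\<forall>x. norm (f x) \<le> norm x)"
    by (rule cuntz_universal)
       (simp_all add: adj_scaleC mult_scaleC_left mult_scaleC_right scaleC_scaleC cc scaleC_one
         cuntz_gen_isometry cuntz_gen_sum)
  then show ?thesis by blast
qed

definition cuntz_gauge :: "real \<Rightarrow> 'n::finite cuntz \<Rightarrow> 'n cuntz"
  where "cuntz_gauge \<theta> = (SOME f. unital_star_hom f \<and> (\<forall>i. f (cuntz_gen i) = cis \<theta> *\<^sub>C cuntz_gen i))"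

lemma cuntz_gauge: "unital_star_hom (cuntz_gauge \<theta>)" "cuntz_gauge \<theta> (cuntz_gen i) = cis \<theta> *\<^sub>C cuntz_gen i"
  using someI_ex[OF cuntz_gauge_exists[of "\<lambda>_. \<theta>"]] by (auto simp: cuntz_gauge_def)

lemma cuntz_gauge_word: "cuntz_gauge \<theta> (cuntz_word \<alpha>) = cis (real (length \<alpha>) * \<theta>) *\<^sub>C cuntz_word \<alpha>"
  by (induction \<alpha>)
     (simp_all add: unital_star_homD[OF cuntz_gauge(1)] cuntz_gauge(2) scaleC_one mult_scaleC_left
       mult_scaleC_right scaleC_scaleC cis_mult distrib_right add.commute)

lemma cuntz_gauge_block:
  assumes "x \<in> cuntz_block a b"
  shows "cuntz_gauge \<theta> x = cis ((real a - real b) * \<theta>) *\<^sub>C x"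
proof -
  let ?t = "\<lambda>\<alpha> \<beta>. cuntz_word \<alpha> * (adj (cuntz_word \<alpha>) * x * cuntz_word \<beta>) * adj (cuntz_word \<beta>)"
  have t: "cuntz_gauge \<theta> (?t \<alpha> \<beta>) = cis ((real a - real b) * \<theta>) *\<^sub>C ?t \<alpha> \<beta>"
    if \<alpha>\<beta>: "\<alpha> \<in> words a" "\<beta> \<in> words b" for \<alpha> \<beta>
  proof -
    obtain c where "adj (cuntz_word \<alpha>) * x * cuntz_word \<beta> = c *\<^sub>C 1"
      using cuntz_blockD[OF assms, of \<alpha> \<beta>] \<alpha>\<beta> by (auto simp: scalars_def words_def)
    then have "?t \<alpha> \<beta> = c *\<^sub>C (cuntz_word \<alpha> * adj (cuntz_word \<beta>))"
      by (simp add: mult_scaleC_left mult_scaleC_right)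
    moreover have "cuntz_gauge \<theta> (cuntz_word \<alpha> * adj (cuntz_word \<beta>)) =
        (cis (real a * \<theta>) * cnj (cis (real b * \<theta>))) *\<^sub>C (cuntz_word \<alpha> * adj (cuntz_word \<beta>))"
      using \<alpha>\<beta> by (simp add: unital_star_homD[OF cuntz_gauge(1)] cuntz_gauge_word words_def adj_scaleC
          mult_scaleC_left mult_scaleC_right scaleC_scaleC)
    moreover have "cis (real a * \<theta>) * cnj (cis (real b * \<theta>)) = cis ((real a - real b) * \<theta>)"
      by (simp add: cis_cnj cis_mult left_diff_distrib)
    ultimately show ?thesis
      by (simp only: unital_star_homD(2)[OF cuntz_gauge(1)] cvec.scale_left_commute)
  qed
  have x: "x = (\<Sum>\<alpha>\<in>words a. \<Sum>\<beta>\<in>words b. ?t \<alpha> \<beta>)" by (rule cuntz_block_expand)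
  have "cuntz_gauge \<theta> x = (\<Sum>\<alpha>\<in>words a. \<Sum>\<beta>\<in>words b. cuntz_gauge \<theta> (?t \<alpha> \<beta>))"
    by (subst x) (simp only: unital_star_hom_sum[OF cuntz_gauge(1)])
  also have "\<dots> = (\<Sum>\<alpha>\<in>words a. \<Sum>\<beta>\<in>words b. cis ((real a - real b) * \<theta>) *\<^sub>C ?t \<alpha> \<beta>)"
    by (intro sum.cong refl t)
  also have "\<dots> = cis ((real a - real b) * \<theta>) *\<^sub>C x"
    by (subst (2) x) (simp only: cvec.scale_sum_right)
  finally show ?thesis .
qed

lemma cuntz_gauge_diag:
  assumes "d \<in> cuntz_diag"
  shows "cuntz_gauge \<theta> d = d"
proof -
  obtain X where X: "\<And>k. X k \<in> diag_alg" "X \<longlonglongrightarrow> d" using cuntz_diag_limit[OF assms] by blast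
  have "cuntz_gauge \<theta> (X k) = X k" for k
    using X(1)[of k] cuntz_gauge_block[of "X k"] by (force simp: diag_alg_def diag_block_def scaleC_one)
  then have "X \<longlonglongrightarrow> cuntz_gauge \<theta> d"
    using bounded_linear.tendsto[OF bounded_linear_unital_star_hom[OF cuntz_gauge(1)] X(2), of \<theta>] by simp
  then show ?thesis using X(2) by (rule LIMSEQ_unique)
qed

lemma cuntz_gauge_diag_commutant:
  assumes "x \<in> diag_commutant"
  shows "cuntz_gauge \<theta> x \<in> diag_commutant"
proof -
  have "cuntz_gauge \<theta> x * d = d * cuntz_gauge \<theta> x" if d: "d \<in> cuntz_diag" for d
  proof -
    have "cuntz_gauge \<theta> (x * d) = cuntz_gauge \<theta> (d * x)" using assms d by (simp add: diag_commutant_def)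
    then show ?thesis by (simp add: unital_star_homD[OF cuntz_gauge(1)] cuntz_gauge_diag[OF d])
  qed
  then show ?thesis by (simp add: diag_commutant_def)
qed

section \<open>Homogeneous elements and the grading by degree\<close>

definition homogeneous :: "int \<Rightarrow> 'n::finite cuntz set"
  where "homogeneous k = {x. \<exists>a b. x \<in> cuntz_block a b \<and> int a - int b = k}"

lemma cuntz_gauge_homogeneous:
  assumes "x \<in> homogeneous k"
  shows "cuntz_gauge \<theta> x = cis (real_of_int k * \<theta>) *\<^sub>C x"
proof -
  obtain a b where ab: "x \<in> cuntz_block a b" "int a - int b = k"
    using assms by (auto simp: homogeneous_def)
  have "real a - real b = real_of_int k" using ab(2) by (metis of_int_diff of_int_of_nat_eq)
  then show ?thesis using cuntz_gauge_block[OF ab(1)] by simp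
qed

lemma homogeneous_zero [simp]: "0 \<in> homogeneous k"
proof -
  have "0 \<in> cuntz_block (nat k) (nat (- k)) \<and> int (nat k) - int (nat (- k)) = k"
    by (simp add: cuntz_block_zero)
  then show ?thesis unfolding homogeneous_def by blast
qed

lemma homogeneous_scaleC: "x \<in> homogeneous k \<Longrightarrow> c *\<^sub>C x \<in> homogeneous k"
  unfolding homogeneous_def using cuntz_block_scaleC by blast

lemma homogeneous_add:
  assumes "x \<in> homogeneous k" "y \<in> homogeneous k"
  shows "x + y \<in> homogeneous k"
proof -
  obtain a b where ab: "x \<in> cuntz_block a b" "int a - int b = k"
    using assms(1) by (auto simp: homogeneous_def)
  obtain a' b' where ab': "y \<in> cuntz_block a' b'" "int a' - int b' = k"
    using assms(2) by (auto simp: homogeneous_def)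
  \<comment> \<open>A common block: the first is enlarged by a' and the second by a, and a - b = a'
    - b' makes the right indices agree as well.\<close>
  have eq: "a' + a = a + a'" "b' + a = b + a'" using ab(2) ab'(2) by linarith+
  have "y \<in> cuntz_block (a + a') (b + a')" using cuntz_block_add_right[OF ab'(1), of a] by (simp only: eq)
  then have "x + y \<in> cuntz_block (a + a') (b + a')"
    using cuntz_block_add_right[OF ab(1), of a'] by (intro cuntz_block_add)
  moreover have "int (a + a') - int (b + a') = k" using ab(2) by simp
  ultimately show ?thesis unfolding homogeneous_def by blast
qed

lemma homogeneous_mult:
  assumes "x \<in> homogeneous k" "y \<in> homogeneous l"
  shows "x * y \<in> homogeneous (k + l)"
proof -
  obtain a b where ab: "x \<in> cuntz_block a b" "int a - int b = k"
    using assms(1) by (auto simp: homogeneous_def)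
  obtain a' b' where ab': "y \<in> cuntz_block a' b'" "int a' - int b' = l"
    using assms(2) by (auto simp: homogeneous_def)
  have "x * y \<in> cuntz_block (a + a') (b' + b)"
    using cuntz_block_mult[OF cuntz_block_add_right[OF ab(1), of a']] cuntz_block_add_right[OF ab'(1), of b]
    by (simp add: add.commute)
  moreover have "int (a + a') - int (b' + b) = k + l" using ab(2) ab'(2) by simp
  ultimately show ?thesis unfolding homogeneous_def by blast
qed

definition graded :: "'n::finite cuntz \<Rightarrow> int \<Rightarrow> (int \<Rightarrow> 'n cuntz) \<Rightarrow> bool"
  where "graded x N q \<longleftrightarrow>
    (\<forall>k. q k \<in> homogeneous k) \<and> (\<forall>k. \<bar>k\<bar> > N \<longrightarrow> q k = 0) \<and> x = (\<Sum>k\<in>{-N..N}. q k)"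

lemma graded_mono:
  assumes "graded x N q" "N \<le> M"
  shows "graded x M q"
proof -
  have "(\<Sum>k\<in>{-N..N}. q k) = (\<Sum>k\<in>{-M..M}. q k)"
    by (rule sum.mono_neutral_left) (use assms in \<open>auto simp: graded_def\<close>)
  then show ?thesis using assms by (auto simp: graded_def)
qed

lemma graded_add:
  assumes "graded x N q" "graded y M r"
  shows "graded (x + y) (max N M) (\<lambda>k. q k + r k)"
  using graded_mono[OF assms(1), of "max N M"] graded_mono[OF assms(2), of "max N M"]
  by (simp add: graded_def homogeneous_add sum.distrib)

lemma graded_homogeneous:
  assumes "x \<in> homogeneous k"
  shows "graded x \<bar>k\<bar> (\<lambda>l. if l = k then x else 0)"
  using assms by (auto simp: graded_def)

lemma of_free_word_homogeneous: "\<exists>k. of_free (Poly_Mapping.single (Word l) 1) \<in> homogeneous k"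
proof (induction l)
  case Nil
  have "of_free (Poly_Mapping.single (Word []) 1) = (1 :: 'a cuntz)"
    by (simp flip: zero_star_word_def)
  then have "of_free (Poly_Mapping.single (Word []) 1) \<in> (homogeneous 0 :: 'a cuntz set)"
    using cuntz_block_one by (auto simp: homogeneous_def)
  then show ?case ..
next
  case (Cons a l)
  then obtain k where k: "of_free (Poly_Mapping.single (Word l) 1) \<in> homogeneous k" ..
  obtain i b where a: "a = (i, b)" by (cases a)
  have g: "cuntz_gen i \<in> homogeneous 1" "adj (cuntz_gen i) \<in> homogeneous (- 1)"
    using cuntz_block_gen[of i] cuntz_block_adj[OF cuntz_block_gen[of i]]
    unfolding homogeneous_def by fastforce+
  have ad: "adj (cuntz_gen i) = of_free (Poly_Mapping.single (Word [(i, True)]) 1)"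
    by (simp add: cuntz_gen_def free_gen_def word_adj_def flip: of_free_adj)
  have "of_free (Poly_Mapping.single (Word [a]) 1) \<in> homogeneous (if b then - 1 else 1)"
    using g by (cases b) (simp_all add: a ad, simp add: cuntz_gen_def free_gen_def)
  moreover have "of_free (Poly_Mapping.single (Word (a # l)) 1) =
      of_free (Poly_Mapping.single (Word [a]) 1) * of_free (Poly_Mapping.single (Word l) 1)"
    by (simp add: mult_single plus_star_word_def flip: of_free_mult)
  ultimately show ?case using homogeneous_mult[OF _ k] by metis
qed

lemma of_free_graded: "\<exists>N q. graded (of_free x) N q"
proof (induction x rule: free_star_induct)
  case (single w c)
  obtain k where "of_free (Poly_Mapping.single (Word (letters w)) 1) \<in> homogeneous k"
    using of_free_word_homogeneous by blast
  then have "c *\<^sub>C of_free (Poly_Mapping.single w 1) \<in> homogeneous k" by (simp add: homogeneous_scaleC)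
  moreover have "c *\<^sub>C of_free (Poly_Mapping.single w 1) = of_free (Poly_Mapping.single w c)"
    by (simp add: free_scale_single flip: of_free_scale)
  ultimately show ?case using graded_homogeneous by metis
next
  case (add x y)
  then obtain N q M r where "graded (of_free x) N q" "graded (of_free y) M r" by blast
  from graded_add[OF this] show ?case unfolding of_free_add by blast
qed

lemma graded_approx:
  assumes "0 < e"
  obtains p N q where "graded p N q" "norm (x - p) < e"
proof -
  have "x \<in> closure (range of_free)" by (simp add: of_free_dense)
  then obtain z where "dist (of_free z) x < e"
    using assms unfolding closure_approachable by blast
  then have "norm (x - of_free z) < e" by (simp add: dist_norm norm_minus_commute)
  then show ?thesis using of_free_graded[of z] that by blast
qed

section \<open>The diagonal is maximal abelian\<close>

text \<open>A geometric sum with ratio w = cis (2 pi l / M), where w^M = 1; the bound on |l|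
  excludes w = 1 for l \<noteq> 0.\<close>

lemma sum_roots_of_unity:
  fixes l :: int
  assumes "\<bar>l\<bar> < int M"
  shows "(\<Sum>j<M. cis (real_of_int l * (2 * pi * real j / real M))) = (if l = 0 then of_nat M else 0)"
proof (cases "l = 0")
  case False
  define w where "w = cis (real_of_int l * (2 * pi / real M))"
  have M: "real M > 0" using assms by simp
  have pw: "cis (real_of_int l * (2 * pi * real j / real M)) = w ^ j" for j
    by (simp add: w_def Complex.DeMoivre mult_ac)
  have "w \<noteq> 1"
  proof
    assume "w = 1"
    then have "cos (real_of_int l * (2 * pi / real M)) = 1" by (simp add: w_def complex_eq_iff)
    then obtain m :: int where "real_of_int l * (2 * pi / real M) = of_int m * 2 * pi"
      unfolding cos_one_2pi_int by blast
    then have "real_of_int l = real_of_int (m * int M)" using M by (simp add: field_simps)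
    then have "l = m * int M" by (simp only: of_int_eq_iff)
    then have "\<bar>l\<bar> = \<bar>m\<bar> * int M" by (simp add: abs_mult)
    moreover have "1 \<le> \<bar>m\<bar>" using False \<open>l = m * int M\<close> by auto
    then have "1 * int M \<le> \<bar>m\<bar> * int M" by (rule mult_right_mono) simp
    ultimately show False using assms by simp
  qed
  moreover have "w ^ M = 1"
  proof -
    have "w ^ M = cis (2 * pi * real_of_int l)" using M by (simp add: w_def Complex.DeMoivre mult_ac)
    then show ?thesis by simp
  qed
  ultimately have "(\<Sum>j<M. w ^ j) = 0" by (simp add: geometric_sum)
  then show ?thesis using False by (simp only: pw if_False)
qed simp

text \<open>Averaging over the \<open>M\<close>-th roots of unity instead of the circle: this extracts the component of
  degree \<open>k\<close> of a polynomial as soon as \<open>M\<close> is large.\<close>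

definition degree_part :: "nat \<Rightarrow> int \<Rightarrow> 'n::finite cuntz \<Rightarrow> 'n cuntz"
  where "degree_part M k x = (1 / of_nat M) *\<^sub>C
    (\<Sum>j<M. cis (- real_of_int k * (2 * pi * real j / real M)) *\<^sub>C cuntz_gauge (2 * pi * real j / real M) x)"

lemma degree_part_diff: "degree_part M k (x - y) = degree_part M k x - degree_part M k y"
  by (simp add: degree_part_def unital_star_hom_diff[OF cuntz_gauge(1)] cvec.scale_right_diff_distrib
      sum_subtractf)

lemma degree_part_sum:
  fixes f :: "'i \<Rightarrow> 'n::finite cuntz"
  shows "degree_part M k (\<Sum>i\<in>A. f i) = (\<Sum>i\<in>A. degree_part M k (f i))"
proof (induction A rule: infinite_finite_induct)
  case (insert i A)
  have "degree_part M k (x + y) = degree_part M k x + degree_part M k y" for x y :: "'n cuntz"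
    by (simp add: degree_part_def unital_star_homD[OF cuntz_gauge(1)] scaleC_add_right sum.distrib)
  with insert show ?case by simp
qed (simp_all add: degree_part_def unital_star_hom_zero[OF cuntz_gauge(1)])

lemma norm_degree_part_le: "norm (degree_part M k x) \<le> norm x"
proof (cases "M = 0")
  case False
  have "norm (\<Sum>j<M. cis (- real_of_int k * (2 * pi * real j / real M)) *\<^sub>C
      cuntz_gauge (2 * pi * real j / real M) x) \<le> real (card {..<M}) * norm x"
    by (rule sum_norm_bound) (simp add: norm_scaleC unital_star_hom_norm_le[OF cuntz_gauge(1)])
  then show ?thesis using False by (simp add: degree_part_def norm_scaleC norm_divide field_simps)
qed (simp add: degree_part_def)

lemma degree_part_diag_commutant: "x \<in> diag_commutant \<Longrightarrow> degree_part M k x \<in> diag_commutant"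
  unfolding degree_part_def
  by (intro cvec.subspace_scale[OF subspace_diag_commutant] cvec.subspace_sum[OF subspace_diag_commutant]
      cuntz_gauge_diag_commutant)

text \<open>Averaging over M-th roots of unity cannot separate degrees congruent modulo
  \<open>M\<close>; the bound on |l - k| leaves l = k as the only coincidence.\<close>

lemma degree_part_homogeneous:
  assumes "x \<in> homogeneous l" "\<bar>l - k\<bar> < int M"
  shows "degree_part M k x = (if l = k then x else 0)"
proof -
  have M: "M > 0" using assms(2) by linarith
  have "cis (- real_of_int k * (2 * pi * real j / real M)) *\<^sub>C cuntz_gauge (2 * pi * real j / real M) x =
      cis (real_of_int (l - k) * (2 * pi * real j / real M)) *\<^sub>C x" for j
    by (simp add: cuntz_gauge_homogeneous[OF assms(1)] scaleC_scaleC cis_mult left_diff_distrib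
        diff_divide_distrib)
  then have "degree_part M k x = (1 / of_nat M) *\<^sub>C
      ((\<Sum>j<M. cis (real_of_int (l - k) * (2 * pi * real j / real M))) *\<^sub>C x)"
    by (simp only: degree_part_def cvec.scale_sum_left)
  then show ?thesis
    unfolding sum_roots_of_unity[OF assms(2)] using M by (simp add: scaleC_scaleC scaleC_one)
qed

lemma degree_part_graded:
  assumes p: "graded p N q" and M: "N + \<bar>k\<bar> < int M"
  shows "degree_part M k p = q k"
proof -
  have p_eq: "p = (\<Sum>l\<in>{-N..N}. q l)" and hom: "\<And>l. q l \<in> homogeneous l" and
    z: "\<And>l. \<bar>l\<bar> > N \<Longrightarrow> q l = 0" using p by (auto simp: graded_def)
  have "degree_part M k p = (\<Sum>l\<in>{-N..N}. degree_part M k (q l))"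
    unfolding p_eq by (rule degree_part_sum)
  also have "\<dots> = (\<Sum>l\<in>{-N..N}. if l = k then q l else 0)"
    by (intro sum.cong refl degree_part_homogeneous hom) (use M in auto)
  also have "\<dots> = q k" using z[of k] by auto
  finally show ?thesis .
qed

lemma degree_part_tendsto_zero:
  fixes x :: "'n::finite cuntz"
  assumes n: "CARD('n) \<ge> 2" and x: "x \<in> diag_commutant" and k: "k \<noteq> 0"
  shows "(\<lambda>M. degree_part M k x) \<longlonglongrightarrow> 0"
proof (rule metric_LIMSEQ_I)
  fix e :: real assume e: "0 < e"
  \<comment> \<open>The constant of \<open>diag_commutant_near_block\<close>. It depends on |k|
    only, so the approximation may be chosen after it, and e / 2 remains.\<close>
  define C where "C = real (card (words (nat \<bar>k\<bar>) :: 'n list set)) + 1"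
  have C: "C > 0" by (simp add: C_def add_nonneg_pos)
  then obtain p N q where p: "graded p N q" "norm (x - p) < e / (2 * C)"
    using graded_approx[of "e / (2 * C)" x] e by auto
  have "norm (degree_part M k x) < e" if M: "M \<ge> nat (N + \<bar>k\<bar>) + 1" for M
  proof -
    let ?y = "degree_part M k x"
    have "N + \<bar>k\<bar> < int M" using M by linarith
    then have "?y - q k = degree_part M k (x - p)"
      by (simp add: degree_part_diff degree_part_graded[OF p(1)])
    then have le: "norm (?y - q k) \<le> e / (2 * C)"
      using norm_degree_part_le[of M k "x - p"] p(2) by simp
    have y: "?y \<in> diag_commutant" by (rule degree_part_diag_commutant[OF x])
    obtain a b where ab: "q k \<in> cuntz_block a b" "int a - int b = k"
      using p(1) unfolding graded_def homogeneous_def by blast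
    have "norm ?y \<le> C * (e / (2 * C))"
    proof (cases "k > 0")
      case True
      then have "a = b + nat \<bar>k\<bar>" using ab(2) by linarith
      then have "q k \<in> cuntz_block (b + nat \<bar>k\<bar>) b" using ab(1) by simp
      from diag_commutant_near_block[OF n _ y this le] show ?thesis using k by (simp add: C_def)
    next
      case False
      \<comment> \<open>Adjoints turn negative degree into positive degree and preserve the
        commutant and the norm.\<close>
      then have "b = a + nat \<bar>k\<bar>" using ab(2) by linarith
      then have "adj (q k) \<in> cuntz_block (a + nat \<bar>k\<bar>) a" using cuntz_block_adj[OF ab(1)] by simp
      moreover have "norm (adj ?y - adj (q k)) \<le> e / (2 * C)" using le by (simp add: norm_adj flip: adj_diff)
      ultimately have "norm (adj ?y) \<le> (real (card (words (nat \<bar>k\<bar>) :: 'n list set)) + 1) * (e / (2 * C))"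
        using k by (intro diag_commutant_near_block[OF n _ diag_commutant_adj[OF y]]) auto
      then show ?thesis by (simp only: C_def norm_adj)
    qed
    also have "\<dots> < e" using C e by simp
    finally show ?thesis .
  qed
  then show "\<exists>M0. \<forall>M\<ge>M0. dist (degree_part M k x) 0 < e" by auto
qed

text \<open>The degree-zero component of a nearby polynomial lies in a block with equal indices,
  where \<open>diag_commutant_near_core\<close> applies. The witness may depend on \<open>M\<close>;
  in the end a single large \<open>M\<close> is used.\<close>

lemma degree_part_near_diag:
  fixes x :: "'n::finite cuntz"
  assumes x: "x \<in> diag_commutant" and e: "0 < e"
  shows "\<exists>M0. \<forall>M\<ge>M0. \<exists>d\<in>cuntz_diag. norm (degree_part M 0 x - d) \<le> e"
proof -
  obtain p N q where p: "graded p N q" "norm (x - p) < e" using graded_approx[OF e] by blast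
  have "\<exists>d\<in>cuntz_diag. norm (degree_part M 0 x - d) \<le> e" if M: "M \<ge> nat N + 1" for M
  proof -
    have "N + \<bar>0\<bar> < int M" using M by linarith
    then have "degree_part M 0 x - q 0 = degree_part M 0 (x - p)"
      by (simp add: degree_part_diff degree_part_graded[OF p(1)])
    then have le: "norm (degree_part M 0 x - q 0) \<le> e"
      using norm_degree_part_le[of M 0 "x - p"] p(2) by simp
    obtain a b where ab: "q 0 \<in> cuntz_block a b" "int a - int b = 0"
      using p(1) unfolding graded_def homogeneous_def by blast
    then have "q 0 \<in> cuntz_block a a" by simp
    then show ?thesis using diag_commutant_near_core[OF degree_part_diag_commutant[OF x] _ le] by blast
  qed
  then show ?thesis by blast
qed

text \<open>The Cesaro mean sum_k (1 - |k| / N) x_k over |k| < N, with x_k the part of degree k. The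
  double sum counts the degree a - b exactly N - |a - b| times and shows the kernel as a
  square.\<close>

definition fejer :: "nat \<Rightarrow> nat \<Rightarrow> 'n::finite cuntz \<Rightarrow> 'n cuntz"
  where "fejer N M x = (1 / of_nat N) *\<^sub>C (\<Sum>a<N. \<Sum>b<N. degree_part M (int a - int b) x)"

lemma fejer_diff: "fejer N M (x - y) = fejer N M x - fejer N M y"
  by (simp add: fejer_def degree_part_diff sum_subtractf cvec.scale_right_diff_distrib)

text \<open>The Fejer kernel is a square, so that \<open>fejer N M x\<close> is a convex combination of the \<open>cuntz_gauge \<theta> x\<close>.\<close>

lemma norm_fejer_le:
  assumes N: "0 < N" and NM: "N \<le> M"
  shows "norm (fejer N M x) \<le> norm x"
proof -
  define th where "th j = 2 * pi * real j / real M" for j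
  define w where "w j = (cmod (\<Sum>a<N. cis (- real a * th j)))\<^sup>2" for j
  \<comment> \<open>Up to normalisation \<open>w j\<close> is the value of the Fejer kernel at the
    angle \<open>th j\<close>, nonnegative as a squared modulus.\<close>
  have kernel: "(\<Sum>a<N. \<Sum>b<N. cis (- real_of_int (int a - int b) * th j)) = complex_of_real (w j)" for j
  proof -
    have "cis (- real_of_int (int a - int b) * th j) = cis (- real a * th j) * cnj (cis (- real b * th j))" for a b
      by (simp add: cis_cnj cis_mult left_diff_distrib)
    then have "(\<Sum>a<N. \<Sum>b<N. cis (- real_of_int (int a - int b) * th j)) =
        (\<Sum>a<N. cis (- real a * th j)) * cnj (\<Sum>b<N. cis (- real b * th j))"
      by (simp add: sum_product del: of_int_diff)
    then show ?thesis by (simp only: w_def complex_norm_square)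
  qed
  \<comment> \<open>The total weight is N M: as N \<le> M keeps |a - b| below M, orthogonality of
    the roots of unity leaves the N pairs with a = b.\<close>
  have "complex_of_real (\<Sum>j<M. w j) = (\<Sum>j<M. \<Sum>a<N. \<Sum>b<N. cis (- real_of_int (int a - int b) * th j))"
    by (simp only: kernel of_real_sum)
  also have "\<dots> = (\<Sum>a<N. \<Sum>b<N. \<Sum>j<M. cis (- real_of_int (int a - int b) * th j))"
    by (subst sum.swap, rule sum.cong[OF refl], rule sum.swap)
  also have "\<dots> = (\<Sum>a<N. \<Sum>b<N. if a = b then of_nat M else 0)"
  proof (intro sum.cong refl)
    fix a b assume "a \<in> {..<N}" "b \<in> {..<N}"
    then have "\<bar>int b - int a\<bar> < int M" using NM by auto
    from sum_roots_of_unity[OF this]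
    show "(\<Sum>j<M. cis (- real_of_int (int a - int b) * th j)) = (if a = b then of_nat M else 0)"
      by (simp add: th_def)
  qed
  also have "\<dots> = complex_of_real (real N * real M)" by simp
  finally have total: "(\<Sum>j<M. w j) = real N * real M" by (simp only: of_real_eq_iff)
  have "(\<Sum>a<N. \<Sum>b<N. degree_part M (int a - int b) x) =
      (1 / of_nat M) *\<^sub>C (\<Sum>a<N. \<Sum>b<N. \<Sum>j<M. cis (- real_of_int (int a - int b) * th j) *\<^sub>C cuntz_gauge (th j) x)"
    by (simp only: degree_part_def cvec.scale_sum_right th_def)
  also have "(\<Sum>a<N. \<Sum>b<N. \<Sum>j<M. cis (- real_of_int (int a - int b) * th j) *\<^sub>C cuntz_gauge (th j) x) =
      (\<Sum>a<N. \<Sum>j<M. \<Sum>b<N. cis (- real_of_int (int a - int b) * th j) *\<^sub>C cuntz_gauge (th j) x)"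
    by (rule sum.cong[OF refl], rule sum.swap)
  also have "\<dots> = (\<Sum>j<M. \<Sum>a<N. \<Sum>b<N. cis (- real_of_int (int a - int b) * th j) *\<^sub>C cuntz_gauge (th j) x)"
    by (rule sum.swap)
  also have "\<dots> = (\<Sum>j<M. complex_of_real (w j) *\<^sub>C cuntz_gauge (th j) x)"
    by (simp only: kernel flip: cvec.scale_sum_left)
  finally have eq: "fejer N M x = (1 / of_nat N) *\<^sub>C (1 / of_nat M) *\<^sub>C
      (\<Sum>j<M. complex_of_real (w j) *\<^sub>C cuntz_gauge (th j) x)"
    by (simp only: fejer_def)
  have "norm (\<Sum>j<M. complex_of_real (w j) *\<^sub>C cuntz_gauge (th j) x) \<le> (\<Sum>j<M. w j * norm x)"
    by (rule sum_norm_le)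
       (simp add: norm_scaleC w_def mult_left_mono unital_star_hom_norm_le[OF cuntz_gauge(1)] norm_power)
  also have "\<dots> = real N * real M * norm x" by (simp add: total flip: sum_distrib_right)
  finally show ?thesis
    unfolding eq using N NM by (simp add: norm_scaleC norm_divide norm_mult field_simps)
qed

text \<open>Row a of the double sum collects the degrees a - N + 1, ..., a. Once these cover -K,
  ..., K the row equals \<open>p\<close>, so only rows near the two ends contribute an
  error.\<close>

lemma fejer_graded_approx:
  assumes p: "graded p K q" and e: "0 < e"
  obtains N where "0 < N" "\<And>M. K + int N < int M \<Longrightarrow> norm (fejer N M p - p) \<le> e"
proof -
  define C where "C = (\<Sum>l\<in>{-K..K}. norm (q l))"
  have C: "0 \<le> C" by (simp add: C_def sum_nonneg)
  define k where "k = nat K"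
  have p_eq: "p = (\<Sum>l\<in>{-K..K}. q l)" and z: "\<And>l. \<bar>l\<bar> > K \<Longrightarrow> q l = 0"
    using p by (auto simp: graded_def)
  \<comment> \<open>At most 2 k rows are incomplete, each with error at most C; taking N above 2 k C
    / e makes the mean error at most e.\<close>
  obtain m where "2 * real k * C / e < real m" using reals_Archimedean2 by blast
  moreover define N where "N = Suc m"
  ultimately have N: "2 * real k * C / e < real N" "0 < N" by simp_all
  have row: "norm (p - (\<Sum>b<N. q (int a - int b))) \<le> (if a < k \<or> N - k \<le> a then C else 0)"
    if a: "a < N" for a
  proof -
    let ?I = "{int a - int N + 1..int a}"
    have "(\<Sum>b<N. q (int a - int b)) = (\<Sum>l\<in>?I. q l)"
      by (rule sum.reindex_bij_witness[where i = "\<lambda>l. nat (int a - l)" and j = "\<lambda>b. int a - int b"]) auto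
    also have "\<dots> = (\<Sum>l\<in>?I \<inter> {-K..K}. q l)"
      by (rule sum.mono_neutral_right) (auto intro!: z)
    finally have "(\<Sum>b<N. q (int a - int b)) = (\<Sum>l\<in>?I \<inter> {-K..K}. q l)" .
    moreover have "p = (\<Sum>l\<in>?I \<inter> {-K..K}. q l) + (\<Sum>l\<in>{-K..K} - ?I. q l)"
      unfolding p_eq by (subst sum.union_disjoint[symmetric]) (auto intro!: sum.cong)
    ultimately have eq: "p - (\<Sum>b<N. q (int a - int b)) = (\<Sum>l\<in>{-K..K} - ?I. q l)" by simp
    show ?thesis
    proof (cases "a < k \<or> N - k \<le> a")
      case True
      have "norm (\<Sum>l\<in>{-K..K} - ?I. q l) \<le> (\<Sum>l\<in>{-K..K} - ?I. norm (q l))" by (rule norm_sum)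
      also have "\<dots> \<le> C" unfolding C_def by (rule sum_mono2) auto
      finally show ?thesis using True by (simp add: eq)
    next
      case False
      then have empty: "{-K..K} - ?I = {}" by (auto simp: k_def)
      show ?thesis unfolding eq empty using False by simp
    qed
  qed
  have "norm (fejer N M p - p) \<le> e" if "K + int N < int M" for M
  proof -
    have "degree_part M (int a - int b) p = q (int a - int b)" if "a < N" "b < N" for a b
      by (rule degree_part_graded[OF p]) (use that \<open>K + int N < int M\<close> in linarith)
    then have fej: "fejer N M p = (1 / of_nat N) *\<^sub>C (\<Sum>a<N. \<Sum>b<N. q (int a - int b))"
      by (simp add: fejer_def)
    have avg: "(1 / of_nat N) *\<^sub>C (\<Sum>a<N. p) = p"
    proof -
      have "(\<Sum>a<N. p) = of_nat N *\<^sub>C p" using scaleC_of_real[of "real N" p] by (simp add: sum_constant_scaleR)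
      then show ?thesis using N(2) by (simp add: scaleC_scaleC scaleC_one)
    qed
    have "p - fejer N M p = (1 / of_nat N) *\<^sub>C (\<Sum>a<N. p - (\<Sum>b<N. q (int a - int b)))"
      by (simp only: fej sum_subtractf cvec.scale_right_diff_distrib avg)
    then have "norm (fejer N M p - p) = (1 / real N) * norm (\<Sum>a<N. p - (\<Sum>b<N. q (int a - int b)))"
      by (simp add: norm_minus_commute[of "fejer N M p"] norm_scaleC norm_divide)
    also have "norm (\<Sum>a<N. p - (\<Sum>b<N. q (int a - int b))) \<le> (\<Sum>a<N. if a < k \<or> N - k \<le> a then C else 0)"
      by (rule sum_norm_le) (use row in auto)
    also have "\<dots> = real (card {a \<in> {..<N}. a < k \<or> N - k \<le> a}) * C"
      by (simp add: sum.If_cases Int_def)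
    also have "\<dots> \<le> (2 * real k) * C"
    proof -
      have "{a \<in> {..<N}. a < k \<or> N - k \<le> a} \<subseteq> {..<k} \<union> {N - k..<N}" by auto
      then have "card {a \<in> {..<N}. a < k \<or> N - k \<le> a} \<le> card ({..<k} \<union> {N - k..<N})"
        by (intro card_mono) auto
      also have "\<dots> \<le> card {..<k} + card {N - k..<N}" by (rule card_Un_le)
      also have "\<dots> \<le> 2 * k" by simp
      finally have "real (card {a \<in> {..<N}. a < k \<or> N - k \<le> a}) \<le> 2 * real k" by linarith
      then show ?thesis using C by (rule mult_right_mono)
    qed
    finally have "norm (fejer N M p - p) \<le> 1 / real N * (2 * real k * C)"
      using N(2) by (simp add: divide_right_mono)
    also have "\<dots> \<le> e" using N e by (simp add: field_simps)
    finally show ?thesis .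
  qed
  then show ?thesis using that[OF N(2)] by blast
qed

text \<open>For fixed N the nonzero degrees fade out of the Fejer mean as M grows, so it approaches
  the degree-zero part, which is near the diagonal. Hence the order of choices: \<open>p\<close>
  near \<open>x\<close>, then \<open>N\<close> from \<open>p\<close>, then a large
  \<open>M\<close>.\<close>

theorem diag_commutant_eq:
  assumes n: "CARD('n::finite) \<ge> 2"
  shows "diag_commutant = (cuntz_diag :: 'n cuntz set)"
proof
  show "cuntz_diag \<subseteq> (diag_commutant :: 'n cuntz set)"
    by (auto simp: diag_commutant_def cuntz_diag_closed(3))
  show "diag_commutant \<subseteq> (cuntz_diag :: 'n cuntz set)"
  proof
    fix x :: "'n cuntz" assume x: "x \<in> diag_commutant"
    have "\<exists>d\<in>cuntz_diag. dist d x < e" if e: "0 < e" for e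
    proof -
      \<comment> \<open>Five errors of at most r make 5 e / 6: from x to p, to the Fejer mean of p,
        to that of x, to the part of degree 0, to d.\<close>
      define r where "r = e / 6"
      have r: "0 < r" using e by (simp add: r_def)
      obtain p K q where p: "graded p K q" "norm (x - p) < r" using graded_approx[OF r] by blast
      obtain N where N: "0 < N"
        and fp: "\<And>M. K + int N < int M \<Longrightarrow> norm (fejer N M p - p) \<le> r"
        using fejer_graded_approx[OF p(1) r] by blast
      have "(\<lambda>M. if a = b then 0 else degree_part M (int a - int b) x) \<longlonglongrightarrow> 0" for a b
        using degree_part_tendsto_zero[OF n x, of "int a - int b"] by (cases "a = b") auto
      then have "(\<lambda>M. \<Sum>a<N. \<Sum>b<N. if a = b then 0 else degree_part M (int a - int b) x) \<longlonglongrightarrow>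
          (\<Sum>a<N. \<Sum>b<N. 0)"
        by (intro tendsto_sum)
      then obtain M1 where M1: "\<And>M. M \<ge> M1 \<Longrightarrow>
          norm (\<Sum>a<N. \<Sum>b<N. if a = b then 0 else degree_part M (int a - int b) x) < r"
        using r unfolding LIMSEQ_iff by fastforce
      obtain M2 where M2: "\<And>M. M \<ge> M2 \<Longrightarrow> \<exists>d\<in>cuntz_diag. norm (degree_part M 0 x - d) \<le> r"
        using degree_part_near_diag[OF x r] by blast
      define M where "M = M1 + M2 + N + nat K + 1"
      obtain d where d: "d \<in> cuntz_diag" "norm (degree_part M 0 x - d) \<le> r"
        using M2[of M] by (auto simp: M_def)
      let ?S = "\<Sum>a<N. \<Sum>b<N. if a = b then 0 else degree_part M (int a - int b) x"
      have "(\<Sum>a<N. \<Sum>b<N. degree_part M (int a - int b) x) =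
          (\<Sum>a<N. \<Sum>b<N. (if a = b then degree_part M 0 x else 0) +
            (if a = b then 0 else degree_part M (int a - int b) x))"
        by (intro sum.cong refl) simp
      also have "\<dots> = (\<Sum>a<N. degree_part M 0 x) + ?S"
        by (simp add: sum.distrib)
      also have "(\<Sum>a<N. degree_part M 0 x) = of_nat N *\<^sub>C degree_part M 0 x"
        using scaleC_of_real[of "real N" "degree_part M 0 x"] by (simp add: sum_constant_scaleR)
      finally have "fejer N M x = degree_part M 0 x + (1 / of_nat N) *\<^sub>C ?S"
        using N by (simp add: fejer_def scaleC_add_right scaleC_scaleC scaleC_one)
      then have "norm (fejer N M x - degree_part M 0 x) = norm ?S / real N"
        by (simp add: norm_scaleC norm_divide)
      also have "\<dots> \<le> norm ?S / 1" using N by (intro divide_left_mono) auto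
      also have "\<dots> \<le> r" using M1[of M] by (simp add: M_def)
      finally have f1: "norm (fejer N M x - degree_part M 0 x) \<le> r" .
      have f2: "norm (fejer N M x - fejer N M p) \<le> r"
        using norm_fejer_le[OF N, of M "x - p"] p(2) by (simp add: fejer_diff M_def)
      have f3: "norm (fejer N M p - p) \<le> r" by (rule fp) (simp add: M_def)
      have "x - d = (x - p) - (fejer N M p - p) - (fejer N M x - fejer N M p) +
          (fejer N M x - degree_part M 0 x) + (degree_part M 0 x - d)" by simp
      then have "norm (x - d) \<le> norm (x - p) + norm (fejer N M p - p) + norm (fejer N M x - fejer N M p) +
          norm (fejer N M x - degree_part M 0 x) + norm (degree_part M 0 x - d)"
        by (smt (verit) norm_triangle_ineq norm_triangle_ineq4)
      also have "\<dots> < e" using p(2) f1 f2 f3 d(2) r unfolding r_def by linarith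
      finally show ?thesis using d(1) by (auto simp: dist_norm norm_minus_commute)
    qed
    then show "x \<in> cuntz_diag"
      using closed_approachable[OF closed_cuntz_diag] by blast
  qed
qed

section \<open>Endomorphisms and the diagonal\<close>

lemma cuntz_hom_eqI:
  fixes f g :: "'n::finite cuntz \<Rightarrow> 'b::unital_cstar_algebra"
  assumes f: "unital_star_hom f" and g: "unital_star_hom g"
    and eq: "\<And>i. f (cuntz_gen i) = g (cuntz_gen i)"
  shows "f = g"
proof -
  have "{x. f x = g x} = UNIV"
  proof (rule cuntz_generated)
    show "closed {x. f x = g x}"
      using linear_continuous_on[OF bounded_linear_unital_star_hom[OF f], of UNIV]
        linear_continuous_on[OF bounded_linear_unital_star_hom[OF g], of UNIV]
      by (rule closed_Collect_eq)
  qed (auto simp: eq unital_star_homD[OF f] unital_star_homD[OF g])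
  then show ?thesis by auto
qed

lemma unital_star_hom_id: "unital_star_hom id"
  by (simp add: unital_star_hom_def)

lemma unital_star_hom_tendsto:
  fixes f :: "'n::finite cuntz \<Rightarrow> 'n cuntz"
  assumes f: "unital_star_hom f" and X: "X \<longlonglongrightarrow> x"
  shows "(\<lambda>k. f (X k)) \<longlonglongrightarrow> f x"
  using bounded_linear.tendsto[OF bounded_linear_unital_star_hom[OF f] X] .

theorem endomorphism_fixing_diag_bij:
  fixes h :: "'n::finite cuntz \<Rightarrow> 'n cuntz"
  assumes n: "CARD('n) \<ge> 2" and h: "unital_star_hom h" and fix_diag: "\<And>x. x \<in> cuntz_diag \<Longrightarrow> h x = x"
  shows "bij h"
proof -
  let ?S = "cuntz_gen :: 'n \<Rightarrow> 'n cuntz"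
  note hom = unital_star_homD[OF h]
  \<comment> \<open>Chosen so that u S_j = h(S_j): by orthogonality only the term i = j
    survives.\<close>
  define u where "u = (\<Sum>i\<in>UNIV. h (?S i) * adj (?S i))"
  have delta: "h (?S i) * (adj (?S i) * ?S j) = (if i = j then h (?S j) else 0)" for i j
    by (simp add: cuntz_gen_orthogonal)
  have uS: "u * ?S j = h (?S j)" for j
    by (simp add: u_def sum_distrib_right mult.assoc delta)
  have au: "adj u = (\<Sum>i\<in>UNIV. ?S i * adj (h (?S i)))"
    by (simp add: u_def adj_sum adj_mult adj_adj)
  have uh: "adj u * h (?S j) = ?S j" for j
  proof -
    have "adj (h (?S i)) * h (?S j) = (if i = j then 1 else 0)" for i
      using hom(3)[of "adj (?S i)" "?S j"] by (auto simp: hom(4,5) cuntz_gen_orthogonal unital_star_hom_zero[OF h])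
    then have "?S i * (adj (h (?S i)) * h (?S j)) = (if i = j then ?S j else 0)" for i by simp
    then show ?thesis by (simp add: au sum_distrib_right mult.assoc)
  qed
  have "adj u * u = (\<Sum>j\<in>UNIV. adj u * (h (?S j) * adj (?S j)))"
    by (subst (2) u_def) (rule sum_distrib_left)
  also have "\<dots> = (\<Sum>j\<in>UNIV. ?S j * adj (?S j))" by (simp only: uh flip: mult.assoc)
  finally have uu: "adj u * u = 1" by (simp only: cuntz_gen_sum)
  have "u * adj u = (\<Sum>i\<in>UNIV. u * ?S i * adj (h (?S i)))"
    by (simp add: au sum_distrib_left mult.assoc)
  also have "\<dots> = h (\<Sum>i\<in>UNIV. ?S i * adj (?S i))"
    by (simp add: uS hom unital_star_hom_sum[OF h])
  finally have uu': "u * adj u = 1" by (simp add: cuntz_gen_sum hom)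
  have "u * x = x * u" if x: "x \<in> cuntz_diag" for x
  proof -
    \<comment> \<open>The compressions of \<open>x\<close> are diagonal and so fixed by
      \<open>h\<close>; through them \<open>x\<close> moves from the right of h(S_i) S_i^* to its
      left.\<close>
    let ?y = "\<lambda>i. adj (?S i) * x * ?S i"
    have comm: "x * (?S i * adj (?S i)) = (?S i * adj (?S i)) * x" for i
      using cuntz_diag_closed(3)[OF x cuntz_proj_in_diag[of "[i]"]] by (simp add: cuntz_proj_def)
    have 1: "?S i * ?y i = x * ?S i" for i
    proof -
      have "?S i * ?y i = (?S i * adj (?S i)) * x * ?S i" by (simp only: mult.assoc)
      also have "\<dots> = x * (?S i * (adj (?S i) * ?S i))" unfolding comm[symmetric] by (simp only: mult.assoc)
      finally show ?thesis by (simp add: cuntz_gen_isometry)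
    qed
    have 2: "?y i * adj (?S i) = adj (?S i) * x" for i
    proof -
      have "?y i * adj (?S i) = adj (?S i) * (x * (?S i * adj (?S i)))" by (simp only: mult.assoc)
      also have "\<dots> = (adj (?S i) * ?S i) * (adj (?S i) * x)" unfolding comm by (simp only: mult.assoc)
      finally show ?thesis by (simp add: cuntz_gen_isometry)
    qed
    have 3: "h (?S i * ?y i) = h (?S i) * ?y i" for i
      unfolding hom(3)[of "?S i" "?y i"] fix_diag[OF cuntz_diag_closed(6)[OF x x]] ..
    have "u * x = (\<Sum>i\<in>UNIV. h (?S i) * (adj (?S i) * x))"
      by (simp only: u_def sum_distrib_right mult.assoc)
    also have "\<dots> = (\<Sum>i\<in>UNIV. h (?S i) * (?y i * adj (?S i)))" by (simp only: 2)
    also have "\<dots> = (\<Sum>i\<in>UNIV. h (?S i * ?y i) * adj (?S i))" unfolding 3 by (simp only: mult.assoc)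
    also have "\<dots> = (\<Sum>i\<in>UNIV. h (x * ?S i) * adj (?S i))" unfolding 1 ..
    also have "\<dots> = x * u" by (simp add: hom(3) fix_diag[OF x] u_def sum_distrib_left mult.assoc)
    finally show ?thesis .
  qed
  then have "u \<in> diag_commutant" by (simp add: diag_commutant_def)
  then have ud: "u \<in> cuntz_diag" "adj u \<in> cuntz_diag"
    using diag_commutant_eq[OF n] cuntz_diag_closed(5) by auto
  \<comment> \<open>The elements u^* S_i satisfy the Cuntz relations again and define the candidate
    inverse \<open>g\<close>.\<close>
  have iso: "adj (adj u * ?S i) * (adj u * ?S i) = 1" for i
  proof -
    have "adj (adj u * ?S i) * (adj u * ?S i) = adj (?S i) * (u * adj u) * ?S i"
      by (simp add: adj_mult adj_adj mult.assoc)
    then show ?thesis by (simp add: uu' cuntz_gen_isometry)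
  qed
  have "(\<Sum>i\<in>UNIV. (adj u * ?S i) * adj (adj u * ?S i)) = adj u * (\<Sum>i\<in>UNIV. ?S i * adj (?S i)) * u"
    by (simp add: adj_mult adj_adj sum_distrib_left sum_distrib_right mult.assoc)
  then have "(\<Sum>i\<in>UNIV. (adj u * ?S i) * adj (adj u * ?S i)) = 1" by (simp add: cuntz_gen_sum uu)
  then obtain g :: "'n cuntz \<Rightarrow> 'n cuntz" where g: "unital_star_hom g" and gS: "\<And>i. g (?S i) = adj u * ?S i"
    using cuntz_universal[of "\<lambda>i. adj u * ?S i"] iso by blast
  have gP: "g (cuntz_proj \<alpha>) = cuntz_proj \<alpha>" for \<alpha>
  proof (induction \<alpha>)
    case Nil
    then show ?case by (simp add: cuntz_proj_def adj_one unital_star_homD[OF g])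
  next
    case (Cons i \<alpha>)
    have "g (cuntz_proj (i # \<alpha>)) = adj u * (cuntz_proj (i # \<alpha>) * u)"
      by (simp add: cuntz_proj_Cons unital_star_homD[OF g] gS Cons adj_mult adj_adj mult.assoc)
    also have "cuntz_proj (i # \<alpha>) * u = u * cuntz_proj (i # \<alpha>)"
      by (rule cuntz_diag_closed(3)[OF cuntz_proj_in_diag ud(1)])
    also have "adj u * (u * cuntz_proj (i # \<alpha>)) = cuntz_proj (i # \<alpha>)"
      by (simp add: uu flip: mult.assoc)
    finally show ?case .
  qed
  have gD: "g x = x" if x: "x \<in> cuntz_diag" for x
  proof -
    obtain X where X: "\<And>k. X k \<in> diag_alg" "X \<longlonglongrightarrow> x" using cuntz_diag_limit[OF x] by blast
    have "g (X k) = X k" for k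
    proof -
      obtain m where "X k \<in> diag_block m" using X(1)[of k] by (auto simp: diag_alg_def)
      then obtain c where "X k = (\<Sum>\<alpha>\<in>words m. c \<alpha> *\<^sub>C cuntz_proj \<alpha>)" by (rule diag_block_expand)
      then show ?thesis by (simp add: unital_star_hom_sum[OF g] unital_star_homD[OF g] gP)
    qed
    then have "X \<longlonglongrightarrow> g x" using unital_star_hom_tendsto[OF g X(2)] by simp
    then show ?thesis using X(2) by (rule LIMSEQ_unique)
  qed
  \<comment> \<open>Both composites fix the generators, because \<open>u\<close> is diagonal and
    hence fixed by \<open>g\<close> and by \<open>h\<close>.\<close>
  have "g \<circ> h = id"
    by (rule cuntz_hom_eqI[OF unital_star_hom_compose[OF g h] unital_star_hom_id])
       (simp add: unital_star_homD[OF g] gD[OF ud(1)] gS uu' flip: uS mult.assoc)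
  moreover have "h \<circ> g = id"
    by (rule cuntz_hom_eqI[OF unital_star_hom_compose[OF h g] unital_star_hom_id])
       (simp add: gS hom fix_diag[OF ud(2), unfolded hom(4)] fix_diag[OF ud(1)] uu flip: uS mult.assoc)
  ultimately show ?thesis by (rule o_bij)
qed

text \<open>For x = sum c_\<alpha> P_\<alpha> the coefficients survive \<open>f\<close>: compressing
  f(x) by the isometry f(S_\<alpha>) returns c_\<alpha>. So each |c_\<alpha>| is at most the norm of
  f(x), and their maximum bounds the norm of x.\<close>

lemma unital_star_hom_isometric_diag_alg:
  fixes f :: "'n::finite cuntz \<Rightarrow> 'n cuntz"
  assumes f: "unital_star_hom f" and x: "x \<in> diag_alg"
  shows "norm (f x) = norm x"
proof (rule antisym[OF unital_star_hom_norm_le[OF f]])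
  obtain k where k: "x \<in> diag_block k" using x by (auto simp: diag_alg_def)
  then obtain c where c: "x = (\<Sum>\<alpha>\<in>words k. c \<alpha> *\<^sub>C cuntz_proj \<alpha>)" by (rule diag_block_expand)
  have "norm (c \<alpha> *\<^sub>C (1 :: 'n cuntz)) \<le> norm (f x)" if \<alpha>: "\<alpha> \<in> words k" for \<alpha>
  proof -
    have "adj (cuntz_word \<alpha>) * cuntz_proj \<beta> * cuntz_word \<alpha> = (if \<beta> = \<alpha> then 1 else 0)" if "\<beta> \<in> words k" for \<beta>
      using that \<alpha> by (auto simp: cuntz_proj_compress words_def)
    then have "adj (cuntz_word \<alpha>) * x * cuntz_word \<alpha> = (\<Sum>\<beta>\<in>words k. if \<beta> = \<alpha> then c \<beta> *\<^sub>C 1 else 0)"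
      unfolding c sum_distrib_left sum_distrib_right mult_scaleC_left mult_scaleC_right
      by (intro sum.cong refl) simp
    then have "adj (cuntz_word \<alpha>) * x * cuntz_word \<alpha> = c \<alpha> *\<^sub>C 1" using \<alpha> by simp
    then have eq: "c \<alpha> *\<^sub>C 1 = adj (f (cuntz_word \<alpha>)) * f x * f (cuntz_word \<alpha>)"
      by (metis f unital_star_homD)
    have "adj (f (cuntz_word \<alpha>)) * f (cuntz_word \<alpha>) = 1"
      by (metis f unital_star_homD cuntz_word_isometry)
    then have w: "norm (f (cuntz_word \<alpha>)) \<le> 1" by (rule norm_isometry_le)
    have "norm (c \<alpha> *\<^sub>C (1 :: 'n cuntz)) \<le> norm (adj (f (cuntz_word \<alpha>))) * norm (f x) * norm (f (cuntz_word \<alpha>))"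
      unfolding eq by (rule norm_mult3_le)
    also have "\<dots> \<le> 1 * norm (f x) * 1" using w by (intro mult_mono) (auto simp: norm_adj)
    finally show ?thesis by simp
  qed
  moreover have "x = (\<Sum>\<alpha>\<in>words k. cuntz_word \<alpha> * (c \<alpha> *\<^sub>C 1) * adj (cuntz_word \<alpha>))"
    by (simp add: c cuntz_proj_def mult_scaleC_left mult_scaleC_right)
  ultimately show "norm x \<le> norm (f x)"
    using norm_word_sum_le[of k "\<lambda>\<alpha>. c \<alpha> *\<^sub>C 1" "norm (f x)"] by simp
qed

lemma unital_star_hom_isometric_diag:
  fixes f :: "'n::finite cuntz \<Rightarrow> 'n cuntz"
  assumes f: "unital_star_hom f" and x: "x \<in> cuntz_diag"
  shows "norm (f x) = norm x"
proof -
  obtain X where X: "\<And>k. X k \<in> diag_alg" "X \<longlonglongrightarrow> x" using cuntz_diag_limit[OF x] by blast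
  have "(\<lambda>k. norm (X k)) \<longlonglongrightarrow> norm (f x)"
    using tendsto_norm[OF unital_star_hom_tendsto[OF f X(2)]]
    by (simp add: unital_star_hom_isometric_diag_alg[OF f X(1)])
  then show ?thesis using tendsto_norm[OF X(2)] by (rule LIMSEQ_unique)
qed

lemma cuntz_diag_diff: "x \<in> cuntz_diag \<Longrightarrow> y \<in> cuntz_diag \<Longrightarrow> x - y \<in> cuntz_diag"
  using cuntz_diag_closed(1)[of x "- 1 *\<^sub>C y"] cuntz_diag_closed(4)[of y y "- 1"] by simp

text \<open>Only the image has to be checked; injectivity comes from \<open>f\<close> being
  isometric on the diagonal.\<close>

lemma diag_restrict_in_star_Aut:
  assumes f: "unital_star_hom f" and im: "f ` cuntz_diag = cuntz_diag"
  shows "diag_restrict f \<in> carrier (star_Aut cuntz_diag)"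
proof -
  have "inj_on f cuntz_diag"
  proof (rule inj_onI)
    fix x y assume xy: "x \<in> cuntz_diag" "y \<in> cuntz_diag" "f x = f y"
    then have "norm (x - y) = norm (f (x - y))"
      by (simp add: unital_star_hom_isometric_diag[OF f] cuntz_diag_diff)
    then show "x = y" using xy by (simp add: unital_star_hom_diff[OF f])
  qed
  then have "bij_betw (diag_restrict f) cuntz_diag cuntz_diag"
    using im by (simp add: bij_betw_def diag_restrict_def inj_on_restrict_eq)
  then show ?thesis
    by (simp add: star_Aut_def diag_restrict_def cuntz_diag_closed unital_star_homD[OF f])
qed

section \<open>The group of automorphisms of the diagonal\<close>

lemma star_Aut_carrierD:
  assumes "\<alpha> \<in> carrier (star_Aut A)"
  shows "\<alpha> \<in> extensional A" "bij_betw \<alpha> A A"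
    "\<And>x y. x \<in> A \<Longrightarrow> y \<in> A \<Longrightarrow> \<alpha> (x + y) = \<alpha> x + \<alpha> y"
    "\<And>c x. x \<in> A \<Longrightarrow> \<alpha> (c *\<^sub>C x) = c *\<^sub>C \<alpha> x"
    "\<And>x y. x \<in> A \<Longrightarrow> y \<in> A \<Longrightarrow> \<alpha> (x * y) = \<alpha> x * \<alpha> y"
    "\<And>x. x \<in> A \<Longrightarrow> \<alpha> (adj x) = adj (\<alpha> x)"
    "\<And>x. x \<in> A \<Longrightarrow> \<alpha> x \<in> A"
  using assms by (auto simp: star_Aut_def bij_betw_def)

lemma group_star_Aut:
  assumes add: "\<And>x y. x \<in> A \<Longrightarrow> y \<in> A \<Longrightarrow> x + y \<in> A" and scale: "\<And>c x. x \<in> A \<Longrightarrow> c *\<^sub>C x \<in> A"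
    and mult: "\<And>x y. x \<in> A \<Longrightarrow> y \<in> A \<Longrightarrow> x * y \<in> A" and adj: "\<And>x. x \<in> A \<Longrightarrow> adj x \<in> A"
  shows "group (star_Aut A)"
proof (rule groupI)
  fix \<alpha> \<beta> assume \<alpha>: "\<alpha> \<in> carrier (star_Aut A)" and \<beta>: "\<beta> \<in> carrier (star_Aut A)"
  note a = star_Aut_carrierD[OF \<alpha>] and b = star_Aut_carrierD[OF \<beta>]
  have "bij_betw (compose A \<alpha> \<beta>) A A" using b(2) a(2) by (rule bij_betw_compose)
  then show "\<alpha> \<otimes>\<^bsub>star_Aut A\<^esub> \<beta> \<in> carrier (star_Aut A)"
    by (simp add: star_Aut_def compose_eq add scale mult adj a(3-6) b(3-7))
next
  fix \<alpha> \<beta> \<gamma> assume "\<alpha> \<in> carrier (star_Aut A)" "\<beta> \<in> carrier (star_Aut A)" and \<gamma>: "\<gamma> \<in> carrier (star_Aut A)"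
  have "\<gamma> \<in> A \<rightarrow> A" using star_Aut_carrierD(7)[OF \<gamma>] by blast
  then show "\<alpha> \<otimes>\<^bsub>star_Aut A\<^esub> \<beta> \<otimes>\<^bsub>star_Aut A\<^esub> \<gamma> = \<alpha> \<otimes>\<^bsub>star_Aut A\<^esub> (\<beta> \<otimes>\<^bsub>star_Aut A\<^esub> \<gamma>)"
    by (simp add: star_Aut_def compose_assoc[symmetric])
next
  show "\<one>\<^bsub>star_Aut A\<^esub> \<in> carrier (star_Aut A)"
    by (auto simp: star_Aut_def add scale mult adj bij_betw_def inj_on_restrict_eq)
next
  fix \<alpha> assume \<alpha>: "\<alpha> \<in> carrier (star_Aut A)"
  note a = star_Aut_carrierD[OF \<alpha>]
  show "\<one>\<^bsub>star_Aut A\<^esub> \<otimes>\<^bsub>star_Aut A\<^esub> \<alpha> = \<alpha>"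
    using a(1,7) by (simp add: star_Aut_def Id_compose)
  let ?\<beta> = "\<lambda>x\<in>A. inv_into A \<alpha> x"
  have bij: "bij_betw ?\<beta> A A" using bij_betw_inv_into[OF a(2)] by simp
  have \<beta>A: "inv_into A \<alpha> x \<in> A" and \<alpha>\<beta>: "\<alpha> (inv_into A \<alpha> x) = x" if "x \<in> A" for x
    using a(2) that by (auto simp: bij_betw_def inv_into_into f_inv_into_f)
  have eqI: "inv_into A \<alpha> x = y" if "x = \<alpha> y" "y \<in> A" for x y
    using a(2) that by (simp add: bij_betw_def)
  have "?\<beta> \<in> carrier (star_Aut A)"
    using bij by (auto simp: star_Aut_def add scale mult adj \<beta>A a(3-6) \<alpha>\<beta> intro!: eqI)
  moreover have "?\<beta> \<otimes>\<^bsub>star_Aut A\<^esub> \<alpha> = \<one>\<^bsub>star_Aut A\<^esub>"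
    using a(7) eqI by (auto simp: star_Aut_def compose_def fun_eq_iff)
  ultimately show "\<exists>\<beta>\<in>carrier (star_Aut A). \<beta> \<otimes>\<^bsub>star_Aut A\<^esub> \<alpha> = \<one>\<^bsub>star_Aut A\<^esub>" by blast
qed

lemma group_diag_Aut: "group (star_Aut (cuntz_diag :: 'n::finite cuntz set))"
  by (rule group_star_Aut) (auto intro: cuntz_diag_closed)

section \<open>A proper endomorphism restricting to an automorphism of the diagonal\<close>

text \<open>In the application \<open>d i j\<close> is the quotient of \<open>j\<close> by \<open>i\<close>; \<open>quotient_word\<close> is the action of the
  homeomorphism of the Cantor space on cylinder sets.\<close>

primrec quotient_word :: "('n \<Rightarrow> 'n \<Rightarrow> 'n) \<Rightarrow> 'n list \<Rightarrow> 'n list"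
  where "quotient_word d [] = []"
  | "quotient_word d (i # \<gamma>) =
      i # (case quotient_word d \<gamma> of [] \<Rightarrow> [] | j # \<mu> \<Rightarrow> d i j # \<mu>)"

lemma length_quotient_word: "length (quotient_word d \<gamma>) = length \<gamma>"
  by (induction \<gamma>) (auto split: list.split simp: length_Suc_conv)

text \<open>Solved from the left: the first letter is kept, the second is pulled back along
  \<open>d i\<close>, and the tail so modified is a shorter instance.\<close>

lemma quotient_word_surj:
  assumes "\<And>i. surj (d i)"
  shows "\<exists>\<gamma>. quotient_word d \<gamma> = \<delta>"
proof (induction "length \<delta>" arbitrary: \<delta>)
  case 0
  then show ?case by (intro exI[of _ "[]"]) simp
next
  case (Suc m)
  then obtain i \<mu> where \<delta>: "\<delta> = i # \<mu>" "length \<mu> = m" by (metis length_Suc_conv)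
  show ?case
  proof (cases \<mu>)
    case Nil
    then show ?thesis using \<delta> by (intro exI[of _ "[i]"]) simp
  next
    case (Cons k \<nu>)
    obtain j where j: "k = d i j" using assms[of i] by (metis surj_def)
    have "m = length (j # \<nu>)" using \<delta> Cons by simp
    then obtain \<gamma> where "quotient_word d \<gamma> = j # \<nu>" using Suc.hyps(1) by blast
    then have "quotient_word d (i # \<gamma>) = \<delta>" using \<delta> Cons j by simp
    then show ?thesis ..
  qed
qed

text \<open>\<open>c\<close> labels the letters by numbers of modulus 1 with angles \<theta>, and
  \<open>c_d\<close> says that \<open>d i j\<close> carries the quotient of the labels of
  \<open>j\<close> and \<open>i\<close>.\<close>

locale quotient_endomorphism =
  fixes c :: "'n::finite \<Rightarrow> complex" and \<theta> :: "'n \<Rightarrow> real" and d :: "'n \<Rightarrow> 'n \<Rightarrow> 'n"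
  assumes c_cis: "c i = cis (\<theta> i)"
    and c_d: "c i * c (d i j) = c j"
    and d_bij: "bij (d i)"
begin

definition perm :: "'n \<Rightarrow> 'n cuntz"
  where "perm i = (\<Sum>j\<in>UNIV. cuntz_gen (d i j) * adj (cuntz_gen j))"

lemma perm_gen: "perm i * cuntz_gen j = cuntz_gen (d i j)"
proof -
  have "cuntz_gen (d i k) * (adj (cuntz_gen k) * cuntz_gen j) = (if k = j then cuntz_gen (d i j) else 0)" for k
    by (simp add: cuntz_gen_orthogonal)
  then show ?thesis by (simp add: perm_def sum_distrib_right mult.assoc)
qed

lemma perm_unitary: "adj (perm i) * perm i = 1" "perm i * adj (perm i) = 1"
proof -
  have adj: "adj (perm i) = (\<Sum>j\<in>UNIV. cuntz_gen j * adj (cuntz_gen (d i j)))"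
    by (simp add: perm_def adj_sum adj_mult adj_adj)
  have "perm i * adj (perm i) = (\<Sum>j\<in>UNIV. (perm i * cuntz_gen j) * adj (cuntz_gen (d i j)))"
    unfolding adj by (simp add: sum_distrib_left mult.assoc)
  also have "\<dots> = (\<Sum>j\<in>UNIV. cuntz_gen (d i j) * adj (cuntz_gen (d i j)))" by (simp only: perm_gen)
  also have "\<dots> = (\<Sum>j\<in>UNIV. cuntz_gen j * adj (cuntz_gen j))"
    using sum.reindex_bij_betw[OF d_bij[of i], of "\<lambda>j. cuntz_gen j * adj (cuntz_gen j)"] by simp
  finally show "perm i * adj (perm i) = 1" by (simp only: cuntz_gen_sum)
  have inj: "d i k = d i j \<longleftrightarrow> k = j" for k j using bij_is_inj[OF d_bij[of i]] by (simp add: inj_eq)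
  have "cuntz_gen k * (adj (cuntz_gen (d i k)) * cuntz_gen (d i j)) = (if k = j then cuntz_gen j else 0)" for j k
    by (simp add: cuntz_gen_orthogonal inj)
  then have "adj (perm i) * cuntz_gen (d i j) = cuntz_gen j" for j
    unfolding adj by (simp add: sum_distrib_right mult.assoc)
  then have "adj (perm i) * perm i = (\<Sum>j\<in>UNIV. cuntz_gen j * adj (cuntz_gen j))"
    by (subst (2) perm_def) (simp add: sum_distrib_left flip: mult.assoc)
  then show "adj (perm i) * perm i = 1" by (simp only: cuntz_gen_sum)
qed

text \<open>A unitary factor on the right of S_i changes neither the isometry relation nor the range
  projection S_i S_i^*, so the Cuntz relations persist.\<close>

lemma endo_exists: "\<exists>f :: 'n cuntz \<Rightarrow> 'n cuntz. unital_star_hom f \<and> (\<forall>i. f (cuntz_gen i) = cuntz_gen i * perm i)"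
proof -
  have "adj (cuntz_gen i * perm i) * (cuntz_gen i * perm i) = 1" for i
  proof -
    have "adj (cuntz_gen i * perm i) * (cuntz_gen i * perm i) =
        adj (perm i) * (adj (cuntz_gen i) * cuntz_gen i) * perm i"
      by (simp only: adj_mult mult.assoc)
    then show ?thesis by (simp add: cuntz_gen_isometry perm_unitary)
  qed
  moreover have "(\<Sum>i\<in>UNIV. cuntz_gen i * perm i * adj (cuntz_gen i * perm i)) = 1"
  proof -
    have "cuntz_gen i * perm i * adj (cuntz_gen i * perm i) =
        cuntz_gen i * (perm i * adj (perm i)) * adj (cuntz_gen i)" for i
      by (simp only: adj_mult mult.assoc)
    then show ?thesis by (simp add: perm_unitary cuntz_gen_sum)
  qed
  ultimately show ?thesis using cuntz_universal[of "\<lambda>i. cuntz_gen i * perm i"] by blast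
qed

definition endo :: "'n cuntz \<Rightarrow> 'n cuntz"
  where "endo = (SOME f. unital_star_hom f \<and> (\<forall>i. f (cuntz_gen i) = cuntz_gen i * perm i))"

lemma endo: "unital_star_hom endo" "endo (cuntz_gen i) = cuntz_gen i * perm i"
  using someI_ex[OF endo_exists] by (auto simp: endo_def)

text \<open>Conjugation by \<open>perm i\<close> alters just the first letter of the word behind
  \<open>i\<close>, which is the recursion of \<open>quotient_word\<close>.\<close>

lemma endo_proj: "endo (cuntz_proj \<gamma>) = cuntz_proj (quotient_word d \<gamma>)"
proof (induction \<gamma>)
  case Nil
  then show ?case by (simp add: cuntz_proj_def adj_one unital_star_homD[OF endo(1)])
next
  case (Cons i \<gamma>)
  have eq: "endo (cuntz_proj (i # \<gamma>)) =
      cuntz_gen i * (perm i * cuntz_proj (quotient_word d \<gamma>) * adj (perm i)) * adj (cuntz_gen i)"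
    by (simp add: cuntz_proj_Cons unital_star_homD[OF endo(1)] endo(2) Cons adj_mult mult.assoc)
  show ?case
  proof (cases "quotient_word d \<gamma>")
    case Nil
    then show ?thesis unfolding eq by (simp add: cuntz_proj_def adj_one perm_unitary)
  next
    case (Cons j \<mu>)
    have "perm i * cuntz_proj (j # \<mu>) * adj (perm i) =
        (perm i * cuntz_gen j) * cuntz_proj \<mu> * adj (perm i * cuntz_gen j)"
      by (simp add: cuntz_proj_Cons adj_mult mult.assoc)
    then show ?thesis unfolding eq by (simp add: Cons perm_gen cuntz_proj_Cons mult.assoc)
  qed
qed

lemma endo_diag_alg: "x \<in> diag_alg \<Longrightarrow> endo x \<in> diag_alg"
proof -
  assume "x \<in> diag_alg"
  then obtain k where "x \<in> diag_block k" by (auto simp: diag_alg_def)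
  then obtain a where "x = (\<Sum>\<alpha>\<in>words k. a \<alpha> *\<^sub>C cuntz_proj \<alpha>)" by (rule diag_block_expand)
  then have "endo x = (\<Sum>\<alpha>\<in>words k. a \<alpha> *\<^sub>C cuntz_proj (quotient_word d \<alpha>))"
    by (simp add: unital_star_hom_sum[OF endo(1)] unital_star_homD[OF endo(1)] endo_proj)
  also have "\<dots> \<in> diag_block k"
    by (intro cvec.subspace_sum[OF subspace_diag_block] cvec.subspace_scale[OF subspace_diag_block]
        cuntz_proj_in_diag_block) (simp add: words_def length_quotient_word)
  finally show ?thesis by (auto simp: diag_alg_def)
qed

text \<open>The image is closed because \<open>endo\<close> is isometric on the complete diagonal,
  and it contains the dense subalgebra \<open>diag_alg\<close> because every word is a
  \<open>quotient_word\<close> of some word.\<close>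

lemma endo_image_diag: "endo ` cuntz_diag = cuntz_diag"
proof
  show "endo ` cuntz_diag \<subseteq> cuntz_diag"
  proof safe
    fix x :: "'n cuntz" assume "x \<in> cuntz_diag"
    then obtain X where "\<And>k. X k \<in> diag_alg" "X \<longlonglongrightarrow> x" using cuntz_diag_limit by blast
    then show "endo x \<in> cuntz_diag"
      by (intro cuntz_diagI[OF endo_diag_alg unital_star_hom_tendsto[OF endo(1)]])
  qed
  have sub: "subspace (cuntz_diag :: 'n cuntz set)"
  proof (rule subspaceI)
    show "0 \<in> (cuntz_diag :: 'n cuntz set)"
      using cuntz_diag_diff[OF cuntz_proj_in_diag cuntz_proj_in_diag, of "[]" "[]"] by simp
    show "r *\<^sub>R x \<in> cuntz_diag" if "x \<in> cuntz_diag" for r and x :: "'n cuntz"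
      using cuntz_diag_closed(4)[OF that that, of "complex_of_real r"] by (simp add: scaleC_of_real)
  qed (rule cuntz_diag_closed(1))
  have "complete (endo ` cuntz_diag)"
    by (rule complete_isometric_image[OF zero_less_one sub bounded_linear_unital_star_hom[OF endo(1)]])
       (simp_all add: unital_star_hom_isometric_diag[OF endo(1)] complete_eq_closed closed_cuntz_diag)
  then have cl: "closed (endo ` cuntz_diag)" by (rule complete_imp_closed)
  have "diag_alg \<subseteq> endo ` cuntz_diag"
  proof
    fix x :: "'n cuntz" assume "x \<in> diag_alg"
    then obtain k where "x \<in> diag_block k" by (auto simp: diag_alg_def)
    then obtain a where x: "x = (\<Sum>\<alpha>\<in>words k. a \<alpha> *\<^sub>C cuntz_proj \<alpha>)" by (rule diag_block_expand)
    have "\<exists>\<gamma>. quotient_word d \<gamma> = \<delta>" for \<delta>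
      by (rule quotient_word_surj) (rule bij_is_surj[OF d_bij])
    then obtain g where g: "\<And>\<delta>. quotient_word d (g \<delta>) = \<delta>" by metis
    have "x = endo (\<Sum>\<alpha>\<in>words k. a \<alpha> *\<^sub>C cuntz_proj (g \<alpha>))"
      by (simp add: x unital_star_hom_sum[OF endo(1)] unital_star_homD[OF endo(1)] endo_proj g)
    moreover have "length (g \<alpha>) = length \<alpha>" for \<alpha> using length_quotient_word[of d "g \<alpha>"] by (simp add: g)
    then have "(\<Sum>\<alpha>\<in>words k. a \<alpha> *\<^sub>C cuntz_proj (g \<alpha>)) \<in> diag_block k"
      by (intro cvec.subspace_sum[OF subspace_diag_block] cvec.subspace_scale[OF subspace_diag_block]
          cuntz_proj_in_diag_block) (simp add: words_def)
    then have "(\<Sum>\<alpha>\<in>words k. a \<alpha> *\<^sub>C cuntz_proj (g \<alpha>)) \<in> cuntz_diag"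
      unfolding cuntz_diag_eq by (intro subsetD[OF closure_subset]) (auto simp: diag_alg_def)
    ultimately show "x \<in> endo ` cuntz_diag" by blast
  qed
  then show "cuntz_diag \<subseteq> endo ` cuntz_diag"
    unfolding cuntz_diag_eq[symmetric] by (subst cuntz_diag_eq) (rule closure_minimal[OF _ cl])
qed

text \<open>The automorphism \<open>S\<^sub>i \<mapsto> c i S\<^sub>i\<close> fixes the range of \<open>endo\<close> pointwise.\<close>

lemma endo_not_surj:
  assumes "c i \<noteq> 1"
  shows "\<not> surj endo"
proof
  assume surj: "surj endo"
  obtain b :: "'n cuntz \<Rightarrow> 'n cuntz" where b: "unital_star_hom b"
    and bS: "\<And>i. b (cuntz_gen i) = c i *\<^sub>C cuntz_gen i"
    using cuntz_gauge_exists[of \<theta>] by (auto simp: c_cis)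
  have cc: "c j * cnj (c j) = 1" for j by (simp add: c_cis cis_cnj cis_mult)
  \<comment> \<open>The total weight of the term S_j S_{d j k} S_k^* of endo(S_j) under the
    automorphism \<open>b\<close>.\<close>
  have "c j * (cnj (c k) * c (d j k)) = 1" for j k
    using cc[of k] c_d[of j k] by (metis mult.commute mult.left_commute)
  then have "c j *\<^sub>C (cuntz_gen j * b (perm j)) = cuntz_gen j * perm j" for j
    by (simp add: perm_def unital_star_hom_sum[OF b] unital_star_homD[OF b] bS adj_scaleC
        sum_distrib_left cvec.scale_sum_right mult_scaleC_left mult_scaleC_right scaleC_scaleC scaleC_one)
  then have "b (endo (cuntz_gen j)) = endo (cuntz_gen j)" for j
    by (simp add: endo(2) unital_star_homD[OF b] bS mult_scaleC_left)
  then have "b \<circ> endo = endo"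
    by (intro cuntz_hom_eqI unital_star_hom_compose b endo(1)) simp
  moreover obtain y where "cuntz_gen i = endo y" using surj by (metis surj_def)
  ultimately have "b (cuntz_gen i) = cuntz_gen i" by (simp add: fun_eq_iff)
  then have "(c i - 1) *\<^sub>C cuntz_gen i = 0" by (simp add: bS cvec.scale_left_diff_distrib scaleC_one)
  then have "(cuntz_gen i :: 'n cuntz) = 0" using assms by simp
  then have "(1 :: 'n cuntz) = 0" using cuntz_gen_isometry[of i] by simp
  then show False using cuntz_one_neq_zero by blast
qed

end

lemma proper_EndAut_exists:
  assumes n: "CARD('n::finite) \<ge> 2"
  shows "\<exists>f :: 'n cuntz \<Rightarrow> 'n cuntz. f \<in> cuntz_EndAut \<and> \<not> bij f"
proof -
  let ?n = "CARD('n)"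
  have n0: "?n > 0" using n by linarith
  obtain e :: "'n \<Rightarrow> nat" where e: "bij_betw e UNIV {..<?n}"
    using finite_same_card_bij[of "UNIV :: 'n set" "{..<?n}"] by auto
  define \<theta> where "\<theta> i = 2 * pi * real (e i) / real ?n" for i
  define c where "c i = cis (\<theta> i)" for i
  have c_bij: "bij_betw c UNIV {z. z ^ ?n = 1}"
    using bij_betw_trans[OF e Complex.bij_betw_roots_unity[OF n0]] by (simp add: c_def[abs_def] \<theta>_def comp_def)
  \<comment> \<open>Quotients of n-th roots of unity are n-th roots of unity, so
    \<open>inv_into\<close> finds the letter with this label.\<close>
  define d where "d i j = inv_into UNIV c (c j / c i)" for i j
  have root: "c i ^ ?n = 1" for i using bij_betw_apply[OF c_bij, of i] by simp
  have ci: "c (inv_into UNIV c z) = z" if "z ^ ?n = 1" for z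
    by (rule bij_betw_inv_into_right[OF c_bij]) (simp add: that)
  have c_d: "c i * c (d i j) = c j" for i j
    by (simp add: d_def ci power_divide root) (simp add: c_def)
  have inj_d: "inj (d i)" for i
  proof (rule injI)
    fix j k assume "d i j = d i k"
    then have "c j = c k" using c_d[of i j] c_d[of i k] by simp
    then show "j = k" using bij_betw_imp_inj_on[OF c_bij] by (simp add: inj_eq)
  qed
  interpret quotient_endomorphism c \<theta> d
    by unfold_locales (auto simp: c_def[symmetric] c_d bij_def inj_d finite_UNIV_inj_surj)
  \<comment> \<open>Distinct letters have distinct labels, so with two letters some label differs
    from 1.\<close>
  obtain j k :: 'n where "j \<noteq> k"
    using n card_le_Suc0_iff_eq[of "UNIV :: 'n set"] by auto
  then have "c j \<noteq> c k" using bij_betw_imp_inj_on[OF c_bij] by (simp add: inj_eq)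
  then obtain i where "c i \<noteq> 1" by metis
  then have "\<not> bij endo" using endo_not_surj bij_is_surj by blast
  moreover have "endo \<in> cuntz_EndAut"
    by (simp add: cuntz_EndAut_def cuntz_End_def endo diag_restrict_in_star_Aut endo_image_diag)
  ultimately show ?thesis by blast
qed

section \<open>The restriction map\<close>

lemma surj_of_comp: "surj (f \<circ> g) \<Longrightarrow> surj f"
  unfolding surj_def comp_def by blast

lemma star_Aut_inv_apply:
  assumes \<alpha>: "\<alpha> \<in> carrier (star_Aut (cuntz_diag :: 'n::finite cuntz set))" and x: "x \<in> cuntz_diag"
  shows "(inv\<^bsub>star_Aut cuntz_diag\<^esub> \<alpha>) (\<alpha> x) = x" "\<alpha> ((inv\<^bsub>star_Aut cuntz_diag\<^esub> \<alpha>) x) = x"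
proof -
  interpret G: group "star_Aut (cuntz_diag :: 'n cuntz set)" by (rule group_diag_Aut)
  have "compose cuntz_diag (inv\<^bsub>star_Aut cuntz_diag\<^esub> \<alpha>) \<alpha> = (\<lambda>x\<in>cuntz_diag. x)"
    using G.l_inv[OF \<alpha>] by (simp add: star_Aut_def)
  then show "(inv\<^bsub>star_Aut cuntz_diag\<^esub> \<alpha>) (\<alpha> x) = x" using x by (metis compose_eq restrict_apply')
  have "compose cuntz_diag \<alpha> (inv\<^bsub>star_Aut cuntz_diag\<^esub> \<alpha>) = (\<lambda>x\<in>cuntz_diag. x)"
    using G.r_inv[OF \<alpha>] by (simp add: star_Aut_def)
  then show "\<alpha> ((inv\<^bsub>star_Aut cuntz_diag\<^esub> \<alpha>) x) = x" using x by (metis compose_eq restrict_apply')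
qed

lemma star_Aut_mult_apply:
  "x \<in> A \<Longrightarrow> (\<alpha> \<otimes>\<^bsub>star_Aut A\<^esub> \<beta>) x = \<alpha> (\<beta> x)"
  by (simp add: star_Aut_def compose_eq)

lemma image_diag_restrict: "diag_restrict ` cuntz_EndAut = diag_extensible cuntz_End"
proof (intro Set.set_eqI iffI)
  fix \<alpha> :: "'a cuntz \<Rightarrow> 'a cuntz" assume "\<alpha> \<in> diag_restrict ` cuntz_EndAut"
  then show "\<alpha> \<in> diag_extensible cuntz_End"
    by (auto simp: cuntz_EndAut_def diag_extensible_def diag_restrict_def)
next
  fix \<alpha> :: "'a cuntz \<Rightarrow> 'a cuntz" assume "\<alpha> \<in> diag_extensible cuntz_End"
  then obtain f where \<alpha>: "\<alpha> \<in> carrier (star_Aut cuntz_diag)" and f: "f \<in> cuntz_End" "\<forall>x\<in>cuntz_diag. f x = \<alpha> x"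
    by (auto simp: diag_extensible_def)
  have "diag_restrict f = \<alpha>"
    unfolding diag_restrict_def using f(2) star_Aut_carrierD(1)[OF \<alpha>]
    by (auto simp: fun_eq_iff extensional_def)
  then show "\<alpha> \<in> diag_restrict ` cuntz_EndAut" using \<alpha> f(1) by (auto simp: cuntz_EndAut_def)
qed

lemma not_subgroup_restrictions:
  assumes n: "CARD('n::finite) \<ge> 2"
  shows "\<not> subgroup (diag_restrict ` (cuntz_EndAut :: ('n cuntz \<Rightarrow> 'n cuntz) set)) (star_Aut cuntz_diag)"
proof
  assume sub: "subgroup (diag_restrict ` (cuntz_EndAut :: ('n cuntz \<Rightarrow> 'n cuntz) set)) (star_Aut cuntz_diag)"
  obtain f :: "'n cuntz \<Rightarrow> 'n cuntz" where f: "f \<in> cuntz_EndAut" "\<not> bij f"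
    using proper_EndAut_exists[OF n] by blast
  define \<alpha> where "\<alpha> = diag_restrict f"
  have \<alpha>: "\<alpha> \<in> carrier (star_Aut cuntz_diag)" and fh: "unital_star_hom f"
    using f(1) by (auto simp: \<alpha>_def cuntz_EndAut_def cuntz_End_def)
  have f\<alpha>: "f x = \<alpha> x" if "x \<in> cuntz_diag" for x using that by (simp add: \<alpha>_def diag_restrict_def)
  have "inv\<^bsub>star_Aut cuntz_diag\<^esub> \<alpha> \<in> diag_extensible cuntz_End"
    using subgroup.m_inv_closed[OF sub] f(1) by (simp add: \<alpha>_def image_diag_restrict[symmetric])
  then obtain g where gh: "unital_star_hom g" and g: "\<And>x. x \<in> cuntz_diag \<Longrightarrow> g x = (inv\<^bsub>star_Aut cuntz_diag\<^esub> \<alpha>) x"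
    and inv: "inv\<^bsub>star_Aut cuntz_diag\<^esub> \<alpha> \<in> carrier (star_Aut cuntz_diag)"
    by (auto simp: diag_extensible_def cuntz_End_def)
  \<comment> \<open>Both composites fix the diagonal pointwise and are therefore bijective; one
    yields surjectivity of \<open>f\<close>, the other injectivity.\<close>
  have "bij (f \<circ> g)"
    using star_Aut_carrierD(7)[OF inv]
    by (intro endomorphism_fixing_diag_bij[OF n unital_star_hom_compose[OF fh gh]])
       (simp add: g f\<alpha> star_Aut_inv_apply[OF \<alpha>])
  moreover have "bij (g \<circ> f)"
    using star_Aut_carrierD(7)[OF \<alpha>]
    by (intro endomorphism_fixing_diag_bij[OF n unital_star_hom_compose[OF gh fh]])
       (simp add: g f\<alpha> star_Aut_inv_apply[OF \<alpha>])
  ultimately have "surj f" "inj f"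
    using surj_of_comp[of f g] inj_on_imageI2[of g f UNIV] by (auto simp: bij_def)
  then show False using f(2) by (simp add: bij_def)
qed

lemma diag_extensible_Aut_Int_proper:
  assumes n: "CARD('n::finite) \<ge> 2"
  shows "diag_extensible (cuntz_Aut :: ('n cuntz \<Rightarrow> 'n cuntz) set) \<inter> diag_extensible cuntz_proper_End = {}"
proof (rule ccontr)
  assume "\<not> ?thesis"
  then obtain \<alpha> :: "'n cuntz \<Rightarrow> 'n cuntz"
    where \<alpha>: "\<alpha> \<in> diag_extensible cuntz_Aut" "\<alpha> \<in> diag_extensible cuntz_proper_End" by blast
  from \<alpha>(1) obtain f where f: "unital_star_hom f" "bij f" "\<And>x. x \<in> cuntz_diag \<Longrightarrow> f x = \<alpha> x"
    by (auto simp: diag_extensible_def cuntz_Aut_def cuntz_End_def)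
  from \<alpha>(2) obtain g where g: "unital_star_hom g" "\<not> bij g" "\<And>x. x \<in> cuntz_diag \<Longrightarrow> g x = \<alpha> x"
    by (auto simp: diag_extensible_def cuntz_proper_End_def cuntz_Aut_def cuntz_End_def)
  \<comment> \<open>Comparing the two extensions gives an endomorphism fixing the diagonal; its
    bijectivity would pass to \<open>g\<close>.\<close>
  have "inv_into UNIV f (g x) = x" if "x \<in> cuntz_diag" for x
    using that f(2,3) g(3) by (metis bij_is_inj inv_f_f)
  then have "bij (inv_into UNIV f \<circ> g)"
    by (intro endomorphism_fixing_diag_bij[OF n] unital_star_hom_compose unital_star_hom_inv f g(1)) simp
  then have "bij (f \<circ> (inv_into UNIV f \<circ> g))" using f(2) by (rule bij_comp)
  moreover have "f \<circ> (inv_into UNIV f \<circ> g) = g"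
    using f(2) by (simp add: fun_eq_iff bij_is_surj surj_f_inv_f)
  ultimately show False using g(2) by simp
qed

lemma subgroup_extensible_Aut:
  "subgroup (diag_extensible (cuntz_Aut :: ('n::finite cuntz \<Rightarrow> 'n cuntz) set)) (star_Aut cuntz_diag)"
proof -
  interpret G: group "star_Aut (cuntz_diag :: 'n cuntz set)" by (rule group_diag_Aut)
  have mem: "\<alpha> \<in> diag_extensible cuntz_Aut \<longleftrightarrow> \<alpha> \<in> carrier (star_Aut cuntz_diag) \<and>
    (\<exists>f. unital_star_hom f \<and> bij f \<and> (\<forall>x\<in>cuntz_diag. f x = \<alpha> x))" for \<alpha> :: "'n cuntz \<Rightarrow> 'n cuntz"
    by (auto simp: diag_extensible_def cuntz_Aut_def cuntz_End_def)
  show ?thesis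
  proof (rule G.subgroupI)
    show "diag_extensible cuntz_Aut \<subseteq> carrier (star_Aut (cuntz_diag :: 'n cuntz set))" by (auto simp: mem)
    have "\<one>\<^bsub>star_Aut cuntz_diag\<^esub> \<in> diag_extensible (cuntz_Aut :: ('n cuntz \<Rightarrow> 'n cuntz) set)"
      unfolding mem using G.one_closed unital_star_hom_id bij_id by (force simp: star_Aut_def)
    then show "diag_extensible (cuntz_Aut :: ('n cuntz \<Rightarrow> 'n cuntz) set) \<noteq> {}" by blast
  next
    fix \<alpha> :: "'n cuntz \<Rightarrow> 'n cuntz" assume "\<alpha> \<in> diag_extensible cuntz_Aut"
    then obtain f where \<alpha>: "\<alpha> \<in> carrier (star_Aut cuntz_diag)"
      and f: "unital_star_hom f" "bij f" "\<And>x. x \<in> cuntz_diag \<Longrightarrow> f x = \<alpha> x" by (auto simp: mem)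
    have "inv_into UNIV f x = (inv\<^bsub>star_Aut cuntz_diag\<^esub> \<alpha>) x" if x: "x \<in> cuntz_diag" for x
    proof -
      let ?y = "(inv\<^bsub>star_Aut cuntz_diag\<^esub> \<alpha>) x"
      have "?y \<in> cuntz_diag" using star_Aut_carrierD(7)[OF G.inv_closed[OF \<alpha>] x] .
      then have "f ?y = x" using f(3) star_Aut_inv_apply(2)[OF \<alpha> x] by simp
      then show ?thesis using f(2) by (metis bij_is_inj inv_f_f)
    qed
    then show "inv\<^bsub>star_Aut cuntz_diag\<^esub> \<alpha> \<in> diag_extensible cuntz_Aut"
      unfolding mem using G.inv_closed[OF \<alpha>] unital_star_hom_inv[OF f(1,2)] bij_imp_bij_inv[OF f(2)] by blast
  next
    fix \<alpha> \<beta> :: "'n cuntz \<Rightarrow> 'n cuntz"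
    assume "\<alpha> \<in> diag_extensible cuntz_Aut" "\<beta> \<in> diag_extensible cuntz_Aut"
    then obtain f g where \<alpha>: "\<alpha> \<in> carrier (star_Aut cuntz_diag)" and \<beta>: "\<beta> \<in> carrier (star_Aut cuntz_diag)"
      and f: "unital_star_hom f" "bij f" "\<And>x. x \<in> cuntz_diag \<Longrightarrow> f x = \<alpha> x"
      and g: "unital_star_hom g" "bij g" "\<And>x. x \<in> cuntz_diag \<Longrightarrow> g x = \<beta> x"
      by (auto simp: mem)
    have "(f \<circ> g) x = (\<alpha> \<otimes>\<^bsub>star_Aut cuntz_diag\<^esub> \<beta>) x" if "x \<in> cuntz_diag" for x
      using that star_Aut_carrierD(7)[OF \<beta>] by (simp add: star_Aut_mult_apply f g)
    then show "\<alpha> \<otimes>\<^bsub>star_Aut cuntz_diag\<^esub> \<beta> \<in> diag_extensible cuntz_Aut"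
      unfolding mem using G.m_closed[OF \<alpha> \<beta>] unital_star_hom_compose[OF f(1) g(1)] bij_comp[OF g(2) f(2)]
      by blast
  qed
qed

text \<open>If \<open>f \<circ> g\<close> is an automorphism then \<open>k = g \<circ> (f \<circ> g)\<^sup>-\<^sup>1\<close> is a right inverse of \<open>f\<close>, and
  \<open>k \<circ> f\<close> fixes the diagonal; so \<open>f\<close> is injective as well, without using simplicity.\<close>

lemma subsemigroup_extensible_proper:
  assumes n: "CARD('n::finite) \<ge> 2"
  shows "subsemigroup (diag_extensible (cuntz_proper_End :: ('n cuntz \<Rightarrow> 'n cuntz) set)) (star_Aut cuntz_diag)"
proof -
  interpret G: group "star_Aut (cuntz_diag :: 'n cuntz set)" by (rule group_diag_Aut)
  have mem: "\<alpha> \<in> diag_extensible cuntz_proper_End \<longleftrightarrow> \<alpha> \<in> carrier (star_Aut cuntz_diag) \<and>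
    (\<exists>f. unital_star_hom f \<and> \<not> bij f \<and> (\<forall>x\<in>cuntz_diag. f x = \<alpha> x))" for \<alpha> :: "'n cuntz \<Rightarrow> 'n cuntz"
    by (auto simp: diag_extensible_def cuntz_Aut_def cuntz_proper_End_def cuntz_End_def)
  have "\<alpha> \<otimes>\<^bsub>star_Aut cuntz_diag\<^esub> \<beta> \<in> diag_extensible cuntz_proper_End"
    if \<alpha>\<beta>: "\<alpha> \<in> diag_extensible cuntz_proper_End" "\<beta> \<in> diag_extensible cuntz_proper_End"
    for \<alpha> \<beta> :: "'n cuntz \<Rightarrow> 'n cuntz"
  proof -
    obtain f g where \<alpha>: "\<alpha> \<in> carrier (star_Aut cuntz_diag)" and \<beta>: "\<beta> \<in> carrier (star_Aut cuntz_diag)"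
      and f: "unital_star_hom f" "\<not> bij f" "\<And>x. x \<in> cuntz_diag \<Longrightarrow> f x = \<alpha> x"
      and g: "unital_star_hom g" "\<not> bij g" "\<And>x. x \<in> cuntz_diag \<Longrightarrow> g x = \<beta> x"
      using \<alpha>\<beta> by (auto simp: mem)
    have fg: "(f \<circ> g) x = (\<alpha> \<otimes>\<^bsub>star_Aut cuntz_diag\<^esub> \<beta>) x" if "x \<in> cuntz_diag" for x
      using that star_Aut_carrierD(7)[OF \<beta>] by (simp add: star_Aut_mult_apply f g)
    have fgh: "unital_star_hom (f \<circ> g)" by (rule unital_star_hom_compose[OF f(1) g(1)])
    have "\<not> bij (f \<circ> g)"
    proof
      assume bij: "bij (f \<circ> g)"
      let ?i = "inv_into UNIV (f \<circ> g)"
      have "(g \<circ> ?i \<circ> f) x = x" if x: "x \<in> cuntz_diag" for x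
      proof -
        \<comment> \<open>The diagonal preimage of \<open>x\<close> under \<open>g\<close>. Then
          f(x) = (f g)(y), and the inverse of f g takes it back to y.\<close>
        let ?y = "(inv\<^bsub>star_Aut cuntz_diag\<^esub> \<beta>) x"
        have y: "?y \<in> cuntz_diag" using star_Aut_carrierD(7)[OF G.inv_closed[OF \<beta>] x] .
        have gy: "g ?y = x" using g(3)[OF y] star_Aut_inv_apply(2)[OF \<beta> x] by simp
        have "?i ((f \<circ> g) ?y) = ?y" by (rule inv_f_f[OF bij_is_inj[OF bij]])
        then show ?thesis using gy by simp
      qed
      then have "bij (g \<circ> ?i \<circ> f)"
        by (intro endomorphism_fixing_diag_bij[OF n] unital_star_hom_compose g(1) f(1)
            unital_star_hom_inv[OF fgh bij])
      then have "inj f" by (rule inj_on_imageI2[OF bij_is_inj])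
      moreover have "surj f" using bij_is_surj[OF bij] by (rule surj_of_comp)
      ultimately show False using f(2) by (simp add: bij_def)
    qed
    then show ?thesis unfolding mem using G.m_closed[OF \<alpha> \<beta>] fgh fg by blast
  qed
  then show ?thesis by (auto simp: subsemigroup_def mem)
qed

theorem theorem3p3:
  assumes "CARD('n::finite) \<ge> 2"
  shows "\<not> diag_restrict ` (cuntz_EndAut :: ('n cuntz \<Rightarrow> 'n cuntz) set)
        = carrier (star_Aut cuntz_diag)
    \<and> \<not> subgroup (diag_restrict ` (cuntz_EndAut :: ('n cuntz \<Rightarrow> 'n cuntz) set))
        (star_Aut cuntz_diag)
    \<and> diag_restrict ` (cuntz_EndAut :: ('n cuntz \<Rightarrow> 'n cuntz) set)
        = diag_extensible cuntz_Aut \<union> diag_extensible cuntz_proper_End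
    \<and> diag_extensible (cuntz_Aut :: ('n cuntz \<Rightarrow> 'n cuntz) set)
        \<inter> diag_extensible cuntz_proper_End = {}
    \<and> subgroup (diag_extensible (cuntz_Aut :: ('n cuntz \<Rightarrow> 'n cuntz) set))
        (star_Aut cuntz_diag)
    \<and> subsemigroup (diag_extensible (cuntz_proper_End :: ('n cuntz \<Rightarrow> 'n cuntz) set))
        (star_Aut cuntz_diag)"
proof (intro conjI)
  show "\<not> subgroup (diag_restrict ` (cuntz_EndAut :: ('n cuntz \<Rightarrow> 'n cuntz) set)) (star_Aut cuntz_diag)"
    by (rule not_subgroup_restrictions[OF assms])
  \<comment> \<open>A surjective restriction map would have the whole group as image, which is a
    subgroup of itself.\<close>
  then show "diag_restrict ` (cuntz_EndAut :: ('n cuntz \<Rightarrow> 'n cuntz) set) \<noteq> carrier (star_Aut cuntz_diag)"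
    using group.subgroup_self[OF group_diag_Aut] by metis
  show "diag_restrict ` (cuntz_EndAut :: ('n cuntz \<Rightarrow> 'n cuntz) set) =
      diag_extensible cuntz_Aut \<union> diag_extensible cuntz_proper_End"
    unfolding image_diag_restrict by (auto simp: diag_extensible_def cuntz_proper_End_def cuntz_Aut_def)
  show "diag_extensible (cuntz_Aut :: ('n cuntz \<Rightarrow> 'n cuntz) set) \<inter> diag_extensible cuntz_proper_End = {}"
    by (rule diag_extensible_Aut_Int_proper[OF assms])
  show "subgroup (diag_extensible (cuntz_Aut :: ('n cuntz \<Rightarrow> 'n cuntz) set)) (star_Aut cuntz_diag)"
    by (rule subgroup_extensible_Aut)
  show "subsemigroup (diag_extensible (cuntz_proper_End :: ('n cuntz \<Rightarrow> 'n cuntz) set)) (star_Aut cuntz_diag)"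
    by (rule subsemigroup_extensible_proper[OF assms])
qed

end
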